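(* Let $\mathcal{C}$ be a finite abstract simplicial complex and $\mathcal{M}$ a matroid on the same finite ground set $V$, let $1\le k\le r(\mathcal{M})$ be an integer, and let $\eta\in\{\eta_\pi,\eta_H\}$. If $\eta(\mathcal{C}[X])+r(\mathcal{M}[V\setminus X])\ge k+1$ for all $X\subseteq V$ for which $V\setminus X$ is a flat of $\mathcal{M}$ of rank at most $k-1$, then $\mathbf{RG}(\mathcal{C},\mathcal{M};k)$ is connected.
   Context: $\mathcal{C}[X]=\{\sigma\in\mathcal{C}:\sigma\subseteq X\}$, $\mathcal{M}[X]=\{A\in\mathcal{M}:A\subseteq X\}$, and $r$ denotes matroid rank. A flat of $\mathcal{M}$ is $F\subseteq V$ with $r(\mathcal{M}[F\cup\{x\}])>r(\mathcal{M}[F])$ for all $x\in V\setminus F$. $\eta_\pi(\mathcal{K})$ (resp. $\eta_H(\mathcal{K})$) is $2$ plus the largest $k\ge-2$ such that $\mathcal{K}$ is homotopically $j$-connected (resp. $\widetilde H_j(\mathcal{K};\mathbb{Q})=0$) for all $-1\le j\le k$, where $(-1)$-connectedness / $\widetilde H_{-1}=0$ means $\mathcal{K}$ has at least one vertex; the value may be $\infty$. $\mathbf{RG}(\mathcal{C},\mathcal{M};k)$ is the graph whose vertices are the independent sets of $\mathcal{M}$ of size $k$ that are simplices of $\mathcal{C}$, two being adjacent if their union is a simplex of $\mathcal{C}$ of cardinality $k+1$. *)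

theory Defs
  imports "HOL-Analysis.Analysis" "HOL-Library.Extended_Nat"
begin

definition abstract_simplicial_complex :: "'a set \<Rightarrow> 'a set set \<Rightarrow> bool" where
  "abstract_simplicial_complex V C \<longleftrightarrow> C \<subseteq> Pow V \<and> (\<forall>\<sigma>\<in>C. \<forall>\<tau>. \<tau> \<subseteq> \<sigma> \<longrightarrow> \<tau> \<in> C)"

definition induced :: "'a set set \<Rightarrow> 'a set \<Rightarrow> 'a set set" where
  "induced C X = {\<sigma> \<in> C. \<sigma> \<subseteq> X}"

text \<open>Standard geometric realization: barycentric-coordinate functions whose support is a simplex,
  with the topology of the product topology on functions into the reals.\<close>
definition realization :: "'a set set \<Rightarrow> ('a \<Rightarrow> real) topology" where
  "realization C = subtopology (powertop_real UNIV)
     {f. (\<forall>v. 0 \<le> f v) \<and> {v. f v \<noteq> 0} \<in> C \<and> sum f {v. f v \<noteq> 0} = 1}"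

definition homotopically_connected :: "'b topology \<Rightarrow> int \<Rightarrow> bool" where
  "homotopically_connected X j \<longleftrightarrow>
     topspace X \<noteq> {} \<and>
     (\<forall>m::nat. int m \<le> j \<longrightarrow> (\<forall>f. continuous_map (nsphere m) X f \<longrightarrow>
        (\<exists>c. homotopic_with (\<lambda>_. True) (nsphere m) X f (\<lambda>_. c))))"

text \<open>Oriented j-chains over \<rat>, represented as alternating functions on ordered tuples:
  supported on distinct (j+1)-tuples spanning a simplex (the empty tuple for j = -1, the
  augmentation), and changing sign under swapping adjacent entries.\<close>
definition chains :: "'a set set \<Rightarrow> int \<Rightarrow> ('a list \<Rightarrow> rat) set" where
  "chains C j = {c. (\<forall>xs. c xs \<noteq> 0 \<longrightarrow>
        int (length xs) = j + 1 \<and> distinct xs \<and> (xs = [] \<or> set xs \<in> C)) \<and>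
     (\<forall>xs i. Suc i < length xs \<longrightarrow>
        c (xs[i := xs ! Suc i, Suc i := xs ! i]) = - c xs)}"

text \<open>Boundary map (including the augmentation from 0-chains to (-1)-chains).\<close>
definition bd :: "'a set set \<Rightarrow> ('a list \<Rightarrow> rat) \<Rightarrow> ('a list \<Rightarrow> rat)" where
  "bd C c = (\<lambda>ws. \<Sum>v\<in>\<Union>C. c (v # ws))"

text \<open>Vanishing of the reduced rational homology group in degree j \<ge> -1
  (cycles are boundaries; in degree -1 every chain is a cycle).\<close>
definition reduced_rat_homology_vanishes :: "'a set set \<Rightarrow> int \<Rightarrow> bool" where
  "reduced_rat_homology_vanishes C j \<longleftrightarrow>
     (\<forall>c\<in>chains C j. (j = -1 \<or> bd C c = (\<lambda>_. 0)) \<longrightarrow>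
        (\<exists>d\<in>chains C (j + 1). bd C d = c))"

definition eta_of :: "(int \<Rightarrow> bool) \<Rightarrow> enat" where
  "eta_of P = Sup {enat (nat (k + 2)) | k. k \<ge> -2 \<and> (\<forall>j. -1 \<le> j \<and> j \<le> k \<longrightarrow> P j)}"

definition eta_pi :: "'a set set \<Rightarrow> enat" where
  "eta_pi C = eta_of (\<lambda>j. homotopically_connected (realization C) j)"

definition eta_H :: "'a set set \<Rightarrow> enat" where
  "eta_H C = eta_of (\<lambda>j. reduced_rat_homology_vanishes C j)"

definition matroid :: "'a set \<Rightarrow> 'a set set \<Rightarrow> bool" where
  "matroid V M \<longleftrightarrow> finite V \<and> M \<subseteq> Pow V \<and> {} \<in> M \<and>
     (\<forall>A\<in>M. \<forall>B. B \<subseteq> A \<longrightarrow> B \<in> M) \<and>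
     (\<forall>A\<in>M. \<forall>B\<in>M. card A < card B \<longrightarrow> (\<exists>x\<in>B - A. insert x A \<in> M))"

definition restr :: "'a set set \<Rightarrow> 'a set \<Rightarrow> 'a set set" where
  "restr M X = {A \<in> M. A \<subseteq> X}"

definition mrank :: "'a set set \<Rightarrow> nat" where
  "mrank M = Max (card ` M)"

definition flat :: "'a set \<Rightarrow> 'a set set \<Rightarrow> 'a set \<Rightarrow> bool" where
  "flat V M F \<longleftrightarrow> F \<subseteq> V \<and>
     (\<forall>x\<in>V - F. mrank (restr M (F \<union> {x})) > mrank (restr M F))"

definition RG_vertices :: "'a set set \<Rightarrow> 'a set set \<Rightarrow> nat \<Rightarrow> 'a set set" where
  "RG_vertices C M k = {A. A \<in> M \<and> card A = k \<and> A \<in> C}"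

definition RG_adj :: "'a set set \<Rightarrow> 'a set set \<Rightarrow> nat \<Rightarrow> 'a set \<Rightarrow> 'a set \<Rightarrow> bool" where
  "RG_adj C M k A B \<longleftrightarrow> A \<in> RG_vertices C M k \<and> B \<in> RG_vertices C M k \<and>
     A \<union> B \<in> C \<and> card (A \<union> B) = k + 1"

definition RG_connected :: "'a set set \<Rightarrow> 'a set set \<Rightarrow> nat \<Rightarrow> bool" where
  "RG_connected C M k \<longleftrightarrow> RG_vertices C M k \<noteq> {} \<and>
     (\<forall>A\<in>RG_vertices C M k. \<forall>B\<in>RG_vertices C M k. (RG_adj C M k)\<^sup>*\<^sup>* A B)"

end

theory Submission
  imports Defs "HOL-Homology.Simplices"
begin

text \<open>
  Truncate the matroid to rank \<open>k\<close> and join \<open>C\<close> with the dual of the truncation on a second copy of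
  \<open>V\<close>. A simplex of the join that contains exactly one copy of each element of \<open>V\<close> is a simplex
  \<open>\<sigma>\<close> of \<open>C\<close> that spans, together with the complement of \<open>\<sigma>\<close>, and two such simplices in a common
  simplex with \<open>|V| + 1\<close> elements come from spanning simplices whose union lies in \<open>C\<close>. All bases inside
  one simplex of \<open>C\<close> are connected by exchanges, so it suffices to treat the partition matroid of the
  pairs of copies. By deletion and contraction in the dual matroid, the hypothesis on complements of
  flats makes the join over every nonempty \<open>I \<subseteq> V\<close> acyclic up to dimension \<open>|I| - 1\<close> (over complements
  of non-flats it is a cone). Hence the prism over a simplex with vertex set \<open>V\<close> has a chain map into
  the join with prescribed ends, and the rainbow simplices of one connectivity class, counted with
  signs, form a cocycle that takes the same value on both ends.

  Homotopical connectivity is reduced to the homological one: coning singular simplices,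
  subdividing and taking, for each point, a vertex of large barycentric coordinate yields a
  contracting homotopy of the simplicial chain complex in low degrees.
\<close>

section \<open>Signed chains on finite set systems\<close>

text \<open>The numerical margin shapes the argument. If \<open>C[I]\<close> is exact in
  cardinalities below \<open>a\<close>, deletion and contraction make the join over \<open>I\<close>
  exact for all \<open>t\<close> with \<open>t + k < a + card I + r(V - I)\<close>. The hypothesis
  supplies \<open>a = k + 1 - r(V - I)\<close>, so exactness reaches \<open>t = card I\<close>.
  Exactness at \<open>card I - 1\<close> already forces a rainbow simplex to exist; the one extra
  cardinality is what fills the prism between two of them. Rank k needs no hypothesis: once
  \<open>V - I\<close> has truncated rank k, no element can raise it, which is a cone case. A class
  can be counted without cancellation because vertices are ordered by colour: a rainbow simplex,
  viewed as a chain map, contributes exactly 0 or 1 to the count. The obstacle in the homotopical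
  case is that the cone over a simplex has to have that very simplex in its boundary after
  subdivision and approximation. This holds because approximating a subdivided simplex of
  \<open>C\<close> gives the simplex back, an algebraic form of the Sperner lemma.\<close>

definition sgn_at :: "('b \<Rightarrow> nat) \<Rightarrow> 'b \<Rightarrow> 'b set \<Rightarrow> rat" where
  "sgn_at p v S = (-1) ^ card {u \<in> S. p u < p v}"

text \<open>The simplicial boundary read off coefficientwise: the value at \<open>S\<close> collects
  the cofaces of \<open>S\<close>. Summing over the whole ground set instead of the vertices of a
  complex gives one operator for all subcomplexes.\<close>

definition bdry :: "('b \<Rightarrow> nat) \<Rightarrow> 'b set \<Rightarrow> ('b set \<Rightarrow> rat) \<Rightarrow> 'b set \<Rightarrow> rat" where
  "bdry p W c = (\<lambda>S. \<Sum>v\<in>W - S. sgn_at p v S * c (insert v S))"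

text \<open>Exterior multiplication by \<open>v\<close> from the left; simplices that already
  contain \<open>v\<close> are sent to 0.\<close>

definition wedge :: "('b \<Rightarrow> nat) \<Rightarrow> 'b \<Rightarrow> ('b set \<Rightarrow> rat) \<Rightarrow> 'b set \<Rightarrow> rat" where
  "wedge p v c = (\<lambda>S. if v \<in> S then sgn_at p v (S - {v}) * c (S - {v}) else 0)"

definition set_chains :: "'b set set \<Rightarrow> nat \<Rightarrow> ('b set \<Rightarrow> rat) set" where
  "set_chains K t = {c. \<forall>S. c S \<noteq> 0 \<longrightarrow> S \<in> K \<and> card S = t}"

text \<open>Here \<open>t\<close> counts vertices, so this is vanishing of reduced homology in
  dimension \<open>t - 1\<close>. The empty set is a generator whenever it lies in \<open>K\<close>,
  which builds in the augmentation.\<close>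

definition exact_at :: "('b \<Rightarrow> nat) \<Rightarrow> 'b set \<Rightarrow> 'b set set \<Rightarrow> nat \<Rightarrow> bool" where
  "exact_at p W K t \<longleftrightarrow>
     (\<forall>c\<in>set_chains K t. bdry p W c = (\<lambda>_. 0) \<longrightarrow> (\<exists>d\<in>set_chains K (Suc t). bdry p W d = c))"

lemma set_chainsD:
  "c \<in> set_chains K t \<Longrightarrow> c S \<noteq> 0 \<Longrightarrow> S \<in> K"
  "c \<in> set_chains K t \<Longrightarrow> c S \<noteq> 0 \<Longrightarrow> card S = t"
  by (auto simp: set_chains_def)

lemma set_chains_0: "(\<lambda>_. 0) \<in> set_chains K t"
  by (simp add: set_chains_def)

lemma set_chains_add: "c \<in> set_chains K t \<Longrightarrow> d \<in> set_chains K t \<Longrightarrow> (\<lambda>S. c S + d S) \<in> set_chains K t"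
  by (auto simp: set_chains_def) (metis add_0)+

lemma set_chains_mult: "c \<in> set_chains K t \<Longrightarrow> (\<lambda>S. a * c S) \<in> set_chains K t"
  by (auto simp: set_chains_def)

lemma set_chains_diff: "c \<in> set_chains K t \<Longrightarrow> d \<in> set_chains K t \<Longrightarrow> (\<lambda>S. c S - d S) \<in> set_chains K t"
  using set_chains_add[OF _ set_chains_mult[of d K t "-1"]] by fastforce

lemma set_chains_sum: "(\<And>i. i \<in> I \<Longrightarrow> c i \<in> set_chains K t) \<Longrightarrow> (\<lambda>S. \<Sum>i\<in>I. c i S) \<in> set_chains K t"
  by (induction I rule: infinite_finite_induct) (auto simp: set_chains_0 intro: set_chains_add)

lemma set_chains_mono: "K \<subseteq> L \<Longrightarrow> set_chains K t \<subseteq> set_chains L t"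
  by (auto simp: set_chains_def)

lemma sgn_at_square: "sgn_at p v S * sgn_at p v S = 1" 
  by (simp add: sgn_at_def flip: power_add)

lemma sgn_at_nonzero: "sgn_at p v S \<noteq> 0"
  by (simp add: sgn_at_def)

lemma bdry_add: "bdry p W (\<lambda>S. c S + d S) = (\<lambda>S. bdry p W c S + bdry p W d S)"
  by (simp add: bdry_def sum.distrib algebra_simps)

lemma bdry_mult: "bdry p W (\<lambda>S. a * c S) = (\<lambda>S. a * bdry p W c S)"
  by (simp add: bdry_def sum_distrib_left algebra_simps)

lemma bdry_diff: "bdry p W (\<lambda>S. c S - d S) = (\<lambda>S. bdry p W c S - bdry p W d S)"
  by (simp add: bdry_def sum_subtractf algebra_simps)

lemma bdry_0: "bdry p W (\<lambda>_. 0) = (\<lambda>_. 0)"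
  by (simp add: bdry_def)

lemma bdry_sum: "bdry p W (\<lambda>S. \<Sum>i\<in>I. c i S) = (\<lambda>S. \<Sum>i\<in>I. bdry p W (c i) S)"
  by (induction I rule: infinite_finite_induct) (auto simp: bdry_0 bdry_add)

lemma wedge_mult: "wedge p v (\<lambda>S. a * c S) = (\<lambda>S. a * wedge p v c S)"
  by (auto simp: wedge_def algebra_simps)

lemma wedge_0: "wedge p v (\<lambda>_. 0) = (\<lambda>_. 0)"
  by (auto simp: wedge_def)

lemma wedge_add: "wedge p v (\<lambda>S. c S + d S) = (\<lambda>S. wedge p v c S + wedge p v d S)"
  by (auto simp: wedge_def algebra_simps)

lemma wedge_sum: "wedge p v (\<lambda>S. \<Sum>i\<in>I. c i S) = (\<lambda>S. \<Sum>i\<in>I. wedge p v (c i) S)"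
  by (induction I rule: infinite_finite_induct) (auto simp: wedge_0 wedge_add)

locale ordered_ground =
  fixes p :: "'b \<Rightarrow> nat" and W :: "'b set"
  assumes fin: "finite W" and inj: "inj_on p W"
begin

text \<open>Exactly one of \<open>u\<close> and \<open>v\<close> precedes the other, so exactly one
  of the two signs changes when the other vertex is inserted.\<close>

lemma sgn_at_anticommute:
  assumes "u \<in> W" "v \<in> W" "u \<noteq> v" "S \<subseteq> W" "u \<notin> S" "v \<notin> S"
  shows "sgn_at p v S * sgn_at p u (insert v S) = - (sgn_at p u S * sgn_at p v (insert u S))"
proof -
  have f: "finite {w \<in> S. p w < p x}" for x
    using assms(4) fin finite_subset by fastforce
  have *: "sgn_at p x (insert y S) = (if p y < p x then - sgn_at p x S else sgn_at p x S)"
    if "y \<notin> S" for x y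
  proof -
    have "{w \<in> insert y S. p w < p x} = (if p y < p x then insert y {w \<in> S. p w < p x} else {w \<in> S. p w < p x})"
      by auto
    then show ?thesis using that f by (simp add: sgn_at_def)
  qed
  have "p u \<noteq> p v" using assms inj by (auto dest: inj_onD)
  then show ?thesis using assms by (auto simp: *)
qed

lemma sgn_at_swap:
  assumes "u \<in> W" "v \<in> W" "u \<noteq> v" "S \<subseteq> W" "u \<notin> S" "v \<notin> S"
  shows "sgn_at p u (insert v S) * sgn_at p v (insert u S) = - (sgn_at p u S * sgn_at p v S)"
proof -
  have "sgn_at p u (insert v S) * sgn_at p v (insert u S)
     = (sgn_at p v S * sgn_at p v S) * (sgn_at p u (insert v S) * sgn_at p v (insert u S))"
    by (simp add: sgn_at_square)
  also have "\<dots> = sgn_at p v S * sgn_at p v (insert u S) * (sgn_at p v S * sgn_at p u (insert v S))"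
    by (simp only: ac_simps)
  also have "\<dots> = - (sgn_at p u S * sgn_at p v S) * (sgn_at p v (insert u S) * sgn_at p v (insert u S))"
    by (simp add: sgn_at_anticommute[OF assms] algebra_simps)
  finally show ?thesis by (simp add: sgn_at_square)
qed

lemma sum_antisym_pairs:
  fixes F :: "'b \<Rightarrow> 'b \<Rightarrow> rat"
  assumes "finite A" "\<And>u v. u \<in> A \<Longrightarrow> v \<in> A \<Longrightarrow> u \<noteq> v \<Longrightarrow> F u v = - F v u"
  shows "(\<Sum>v\<in>A. \<Sum>u\<in>A - {v}. F v u) = 0"
proof -
  let ?G = "\<lambda>v u. if u = v then 0 else F v u"
  have "(\<Sum>v\<in>A. \<Sum>u\<in>A - {v}. F v u) = (\<Sum>v\<in>A. \<Sum>u\<in>A. ?G v u)"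
    using assms(1) by (intro sum.cong sum.mono_neutral_cong_left) auto
  moreover have "(\<Sum>v\<in>A. \<Sum>u\<in>A. ?G v u) = (\<Sum>v\<in>A. \<Sum>u\<in>A. ?G u v)"
    by (rule sum.swap)
  moreover have "(\<Sum>v\<in>A. \<Sum>u\<in>A. ?G u v) = - (\<Sum>v\<in>A. \<Sum>u\<in>A. ?G v u)"
    unfolding sum_negf[symmetric]
  proof (intro sum.cong refl)
    fix v u assume "v \<in> A" "u \<in> A"
    then show "?G u v = - ?G v u" using assms(2)[of u v] by (cases "u = v") auto
  qed
  ultimately have "(\<Sum>v\<in>A. \<Sum>u\<in>A - {v}. F v u) = - (\<Sum>v\<in>A. \<Sum>u\<in>A - {v}. F v u)"
    by (metis (no_types, lifting))
  then show ?thesis by simp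
qed

lemma bdry_bdry:
  assumes "\<And>S. c S \<noteq> 0 \<Longrightarrow> S \<subseteq> W"
  shows "bdry p W (bdry p W c) = (\<lambda>_. 0)"
proof
  fix S
  show "bdry p W (bdry p W c) S = 0"
  proof (cases "S \<subseteq> W")
    case False
    then have "c (insert v (insert u S)) = 0" for u v using assms by blast
    then show ?thesis by (simp add: bdry_def)
  next
    case True
    have "bdry p W (bdry p W c) S = (\<Sum>v\<in>W - S. \<Sum>u\<in>(W - S) - {v}.
        sgn_at p v S * sgn_at p u (insert v S) * c (insert u (insert v S)))"
      unfolding bdry_def by (intro sum.cong) (auto simp: sum_distrib_left mult.assoc intro!: sum.cong)
    also have "\<dots> = 0"
    proof (intro sum_antisym_pairs)
      fix u v assume uv: "u \<in> W - S" "v \<in> W - S" "u \<noteq> v"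
      then have "sgn_at p u S * sgn_at p v (insert u S) = - (sgn_at p v S * sgn_at p u (insert v S))"
        using True by (intro sgn_at_anticommute) auto
      then show "sgn_at p u S * sgn_at p v (insert u S) * c (insert v (insert u S)) =
        - (sgn_at p v S * sgn_at p u (insert v S) * c (insert u (insert v S)))"
        by (simp add: insert_commute[of u v])
    qed (use fin in auto)
    finally show ?thesis .
  qed
qed

text \<open>The boundary is contraction with the functional that is 1 on every vertex, and this is
  its anticommutation relation with exterior multiplication. It makes \<open>wedge p v\<close> a
  contracting homotopy of every complex closed under inserting \<open>v\<close>.\<close>

lemma bdry_wedge:
  assumes "v \<in> W" and c: "\<And>S. c S \<noteq> 0 \<Longrightarrow> S \<subseteq> W"
  shows "bdry p W (wedge p v c) = (\<lambda>S. c S - wedge p v (bdry p W c) S)"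
proof
  fix S
  show "bdry p W (wedge p v c) S = c S - wedge p v (bdry p W c) S"
  proof (cases "S \<subseteq> W")
    case False
    have z: "c T = 0" if "S - {v} \<subseteq> T" for T
    proof (rule ccontr)
      assume "c T \<noteq> 0"
      with c that have "S - {v} \<subseteq> W" by blast
      with False assms(1) show False by blast
    qed
    have "wedge p v c (insert u S) = 0" for u
      using z[of "insert u S - {v}"] by (auto simp: wedge_def)
    moreover have "bdry p W c (S - {v}) = 0"
      unfolding bdry_def by (intro sum.neutral) (auto intro: z)
    moreover have "c S = 0" by (rule z) blast
    ultimately show ?thesis by (auto simp: bdry_def[of p W "wedge p v c"] wedge_def[of p v "bdry p W c"])
  next
    case SW: True
    show ?thesis
    proof (cases "v \<in> S")
      case False
      have "bdry p W (wedge p v c) S = (\<Sum>u\<in>W - S. if u = v then c S else 0)"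
        unfolding bdry_def wedge_def using False sgn_at_square[of p v S]
        by (intro sum.cong refl) (auto simp: mult.assoc[symmetric])
      also have "\<dots> = c S"
        using False assms(1) fin by simp
      finally show ?thesis using False by (simp add: wedge_def)
    next
      case True
      define T where "T = S - {v}"
      have T: "S = insert v T" "v \<notin> T" "T \<subseteq> W" using True SW by (auto simp: T_def)
      have WT: "W - T = insert v (W - S)" using T assms(1) by auto
      have "wedge p v (bdry p W c) S = sgn_at p v T * (\<Sum>u\<in>W - T. sgn_at p u T * c (insert u T))"
        using True by (simp add: wedge_def bdry_def T_def)
      also have "\<dots> = c S + (\<Sum>u\<in>W - S. sgn_at p v T * sgn_at p u T * c (insert u T))"
        using fin T(1) True unfolding WT 
        by (simp add: sum_distrib_left distrib_left sgn_at_square mult.assoc[symmetric])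
      also have "(\<Sum>u\<in>W - S. sgn_at p v T * sgn_at p u T * c (insert u T)) = - bdry p W (wedge p v c) S"
        unfolding bdry_def sum_negf[symmetric]
      proof (intro sum.cong refl)
        fix u assume u: "u \<in> W - S"
        have "insert u S - {v} = insert u T" using u T by auto
        moreover have "sgn_at p u S * sgn_at p v (insert u T) = - (sgn_at p u T * sgn_at p v T)"
          using sgn_at_swap[of u v T] u T assms(1) by auto
        ultimately show "sgn_at p v T * sgn_at p u T * c (insert u T) =
             - (sgn_at p u S * wedge p v c (insert u S))"
          using True by (simp add: wedge_def mult.assoc[symmetric])
      qed
      finally show ?thesis by simp
    qed
  qed
qed

lemma wedge_set_chains:
  assumes "c \<in> set_chains K t" "\<And>S. S \<in> K \<Longrightarrow> v \<notin> S \<Longrightarrow> insert v S \<in> L" "K \<subseteq> Pow W"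
  shows "wedge p v c \<in> set_chains L (Suc t)"
  unfolding set_chains_def
proof (intro CollectI allI impI)
  fix S assume "wedge p v c S \<noteq> 0"
  then have *: "v \<in> S" "c (S - {v}) \<noteq> 0" by (auto simp: wedge_def split: if_splits)
  then have **: "S - {v} \<in> K" "card (S - {v}) = t" using set_chainsD[OF assms(1)] by auto
  then have "finite (S - {v})" using assms(3) fin finite_subset by blast
  then have "card S = Suc (card (S - {v}))" using *(1) card.remove by fastforce
  then show "S \<in> L \<and> card S = Suc t"
    using * ** assms(2)[of "S - {v}"] by (auto simp: insert_absorb)
qed

lemma exact_at_cone:
  assumes "K \<subseteq> Pow W" "v \<in> W" "\<And>S. S \<in> K \<Longrightarrow> insert v S \<in> K"
  shows "exact_at p W K t"
  unfolding exact_at_def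
proof (intro ballI impI)
  fix c assume c: "c \<in> set_chains K t" "bdry p W c = (\<lambda>_. 0)"
  have "bdry p W (wedge p v c) = c"
  proof (subst bdry_wedge)
    show "S \<subseteq> W" if "c S \<noteq> 0" for S using set_chainsD(1)[OF c(1) that] assms(1) by blast
  qed (simp_all add: c wedge_0 assms(2))
  moreover have "wedge p v c \<in> set_chains K (Suc t)"
    by (rule wedge_set_chains[OF c(1)]) (use assms in auto)
  ultimately show "\<exists>d\<in>set_chains K (Suc t). bdry p W d = c" by blast
qed

text \<open>Mayer-Vietoris for deletion and star of \<open>x\<close>, carried out on chains. Write
  \<open>z = x \<and> y + w\<close>. Then \<open>y\<close> is a cycle of the link; with a filling
  \<open>y'\<close> of it in the link, adding the boundary of \<open>x \<and> y'\<close> turns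
  \<open>z\<close> into the cycle \<open>w + y'\<close> of the deletion. At \<open>t = 0\<close>
  there is no link part.\<close>

lemma exact_at_link_deletion:
  assumes K: "K \<subseteq> Pow W" and x: "x \<in> W"
    and sub: "\<And>S. x \<notin> S \<Longrightarrow> insert x S \<in> K \<Longrightarrow> S \<in> K"
    and del: "exact_at p W {S \<in> K. x \<notin> S} t"
    and link: "t > 0 \<Longrightarrow> exact_at p W {S. x \<notin> S \<and> insert x S \<in> K} (t - 1)"
  shows "exact_at p W K t"
  unfolding exact_at_def
proof (intro ballI impI)
  let ?D = "{S \<in> K. x \<notin> S}" and ?L = "{S. x \<notin> S \<and> insert x S \<in> K}"
  fix z assume z: "z \<in> set_chains K t" "bdry p W z = (\<lambda>_. 0)"
  have zW: "S \<subseteq> W" if "z S \<noteq> 0" for S using set_chainsD(1)[OF z(1) that] K by blast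
  define y where "y S = (if x \<in> S then 0 else sgn_at p x S * z (insert x S))" for S
  define w where "w S = (if x \<in> S then 0 else z S)" for S
  have yW: "S \<subseteq> W" if "y S \<noteq> 0" for S using that zW[of "insert x S"] by (auto simp: y_def split: if_splits)
  have split: "z = (\<lambda>S. wedge p x y S + w S)"
    by (auto simp: fun_eq_iff wedge_def y_def w_def mult.assoc[symmetric] sgn_at_square insert_absorb)
  have "bdry p W z = (\<lambda>S. y S - wedge p x (bdry p W y) S + bdry p W w S)"
    by (subst split, subst bdry_add, subst bdry_wedge) (use x yW in \<open>blast+ | simp\<close>)+
  then have *: "y S - wedge p x (bdry p W y) S + bdry p W w S = 0" for S
    using z(2) by metis
  have yc: "bdry p W y = (\<lambda>_. 0)"
  proof
    fix S show "bdry p W y S = 0"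
    proof (cases "x \<in> S")
      case True
      then show ?thesis by (simp add: bdry_def y_def)
    next
      case False
      have "wedge p x (bdry p W y) (insert x S) = 0"
        using *[of "insert x S"] by (simp add: bdry_def y_def w_def)
      then show ?thesis using False by (simp add: wedge_def sgn_at_nonzero)
    qed
  qed
  have wK: "w \<in> set_chains ?D t" using z(1) by (auto simp: set_chains_def w_def)
  have "\<exists>y'\<in>set_chains ?L t. bdry p W y' = y"
  proof (cases "t = 0")
    case True
    have "y = (\<lambda>_. 0)"
    proof
      fix S show "y S = 0"
      proof (rule ccontr)
        assume "y S \<noteq> 0"
        then have "z (insert x S) \<noteq> 0" by (auto simp: y_def split: if_splits)
        then have "card (insert x S) = 0" "insert x S \<subseteq> W"
          using set_chainsD[OF z(1)] True zW by auto
        then show False using fin by (metis card_0_eq finite_subset insert_not_empty)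
      qed
    qed
    then show ?thesis using set_chains_0 bdry_0 by blast
  next
    case False
    have "y \<in> set_chains ?L (t - 1)"
      unfolding set_chains_def
    proof (intro CollectI allI impI)
      fix S assume "y S \<noteq> 0"
      then have 1: "x \<notin> S" "z (insert x S) \<noteq> 0" by (auto simp: y_def split: if_splits)
      then have "insert x S \<in> K" "card (insert x S) = t" "finite S"
        using set_chainsD[OF z(1)] zW finite_subset[OF _ fin, of "insert x S"] by auto
      then show "S \<in> ?L \<and> card S = t - 1" using 1 by auto
    qed
    then show ?thesis using link yc False unfolding exact_at_def by fastforce
  qed
  then obtain y' where y': "y' \<in> set_chains ?L t" "bdry p W y' = y" by blast
  have y'D: "y' \<in> set_chains ?D t"
    using y'(1) sub set_chains_mono[of ?L ?D t] by blast
  have y'W: "S \<subseteq> W" if "y' S \<noteq> 0" for S using set_chainsD(1)[OF y'D that] K by blast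
  have wy: "wedge p x y' \<in> set_chains K (Suc t)"
    by (rule wedge_set_chains[OF y'(1)]) (use K sub in blast)+
  have eq: "(\<lambda>S. z S + bdry p W (wedge p x y') S) = (\<lambda>S. w S + y' S)"
  proof -
    have "bdry p W (wedge p x y') = (\<lambda>S. y' S - wedge p x y S)"
      using bdry_wedge[of x y'] x y'W y'(2) by simp
    then show ?thesis by (subst split) simp
  qed
  have "bdry p W (\<lambda>S. w S + y' S) = (\<lambda>_. 0)"
  proof -
    have "bdry p W (bdry p W (wedge p x y')) = (\<lambda>_. 0)"
      using set_chainsD(1)[OF wy] K by (intro bdry_bdry) blast
    then show ?thesis unfolding eq[symmetric] by (simp add: bdry_add z(2))
  qed
  then obtain d where d: "d \<in> set_chains ?D (Suc t)" "bdry p W d = (\<lambda>S. w S + y' S)"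
    using del set_chains_add[OF wK y'D] unfolding exact_at_def by blast
  have dK: "d \<in> set_chains K (Suc t)" using d(1) set_chains_mono[of ?D K] by blast
  show "\<exists>d\<in>set_chains K (Suc t). bdry p W d = z"
  proof (rule bexI[OF _ set_chains_diff[OF dK wy]])
    show "bdry p W (\<lambda>S. d S - wedge p x y' S) = z"
      using fun_cong[OF eq] by (auto simp: bdry_diff d(2) fun_eq_iff algebra_simps)
  qed
qed

end

section \<open>A homological Hall theorem for colourings\<close>

definition below :: "('b \<Rightarrow> 'a) \<Rightarrow> 'b set set \<Rightarrow> 'a set \<Rightarrow> 'b set set" where
  "below col K I = {S \<in> K. col ` S \<subseteq> I}"

lemma below_mono: "K \<subseteq> L \<Longrightarrow> I \<subseteq> J \<Longrightarrow> below col K I \<subseteq> below col L J"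
  by (auto simp: below_def)

text \<open>Vertices are ordered by colour first; this gives every rainbow simplex the sign \<open>+1\<close> when its
  colours are pushed forward to \<open>V\<close>.\<close>
locale coloured_ground = vert: ordered_ground p W + colr: ordered_ground q V
  for p :: "'b \<Rightarrow> nat" and W :: "'b set" and q :: "'a \<Rightarrow> nat" and V :: "'a set" +
  fixes col :: "'b \<Rightarrow> 'a"
  assumes col: "col ` W \<subseteq> V"
    and refines: "\<And>x y. x \<in> W \<Longrightarrow> y \<in> W \<Longrightarrow> q (col x) < q (col y) \<Longrightarrow> p x < p y"
begin

definition rainbow :: "'b set \<Rightarrow> bool" where
  "rainbow S \<longleftrightarrow> S \<subseteq> W \<and> bij_betw col S V"

text \<open>The acyclic carrier argument, by induction on \<open>card I\<close>: the prescribed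
  right-hand side is a cycle because its double sum over pairs is antisymmetric and its single sum
  cancels against \<open>gb\<close>. The parameters cover two uses: \<open>g = 0\<close>,
  \<open>\<kappa> = 1\<close>, \<open>e = 0\<close> builds a chain map from the simplex on
  \<open>V\<close>, while \<open>\<kappa> = -1\<close>, \<open>e = 1\<close> and \<open>g\<close> a
  difference of chain maps builds a homotopy between them.\<close>

lemma extend_family:
  assumes K: "K \<subseteq> Pow W"
    and ex: "\<And>I. I \<subseteq> V \<Longrightarrow> I \<noteq> {} \<Longrightarrow> exact_at p W (below col K I) (card I + e - 1)"
    and g: "\<And>I. I \<subseteq> V \<Longrightarrow> I \<noteq> {} \<Longrightarrow> g I \<in> set_chains (below col K I) (card I + e - 1)"
    and gb: "\<And>I. I \<subseteq> V \<Longrightarrow> I \<noteq> {} \<Longrightarrow>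
       bdry p W (g I) = (\<lambda>S. - \<kappa> * (\<Sum>v\<in>I. sgn_at q v (I - {v}) * g (I - {v}) S))"
    and c0: "c0 \<in> set_chains (below col K {}) e" "bdry p W c0 = g {}"
  shows "\<exists>c. c {} = c0 \<and> (\<forall>I\<subseteq>V. c I \<in> set_chains (below col K I) (card I + e) \<and>
       bdry p W (c I) = (\<lambda>S. g I S + \<kappa> * (\<Sum>v\<in>I. sgn_at q v (I - {v}) * c (I - {v}) S)))"
proof -
  let ?ok = "\<lambda>c I. c I \<in> set_chains (below col K I) (card I + e) \<and>
       bdry p W (c I) = (\<lambda>S. g I S + \<kappa> * (\<Sum>v\<in>I. sgn_at q v (I - {v}) * c (I - {v}) S))"
  have finI: "finite I" if "I \<subseteq> V" for I using that colr.fin finite_subset by blast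
  have "\<exists>c. c {} = c0 \<and> (\<forall>I\<subseteq>V. card I \<le> m \<longrightarrow> ?ok c I)" for m
  proof (induction m)
    case 0
    have "?ok (\<lambda>_. c0) I" if "I \<subseteq> V" "card I \<le> 0" for I
    proof -
      have "I = {}" using that finI by auto
      then show ?thesis using c0 by simp
    qed
    then show ?case by (intro exI[of _ "\<lambda>_. c0"] conjI allI impI refl) blast+
  next
    case (Suc m)
    then obtain c where c0: "c {} = c0 \<and> (\<forall>I\<subseteq>V. card I \<le> m \<longrightarrow> ?ok c I)" by (elim exE)
    then have c: "c {} = c0" "\<And>I. I \<subseteq> V \<Longrightarrow> card I \<le> m \<Longrightarrow> ?ok c I" by blast+
    define R where "R I = (\<lambda>S. g I S + \<kappa> * (\<Sum>v\<in>I. sgn_at q v (I - {v}) * c (I - {v}) S))" for I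
    have "\<exists>d\<in>set_chains (below col K I) (card I + e). bdry p W d = R I"
      if I: "I \<subseteq> V" "card I = Suc m" for I
    proof -
      have ne: "I \<noteq> {}" using I by auto
      have cd: "card (I - {v}) = m" if "v \<in> I" for v using that I finI by simp
      have cI: "?ok c (I - {v})" if "v \<in> I" for v
        using c(2)[of "I - {v}"] cd[OF that] I by auto
      have "R I \<in> set_chains (below col K I) (card I + e - 1)"
        unfolding R_def
      proof (intro set_chains_add set_chains_mult set_chains_sum g I ne)
        fix v assume v: "v \<in> I"
        have "c (I - {v}) \<in> set_chains (below col K (I - {v})) (card I + e - 1)"
          using cI[OF v] cd[OF v] I(2) by simp
        then show "c (I - {v}) \<in> set_chains (below col K I) (card I + e - 1)"
          using set_chains_mono[OF below_mono[of K K "I - {v}" I]] by blast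
      qed
      moreover have "bdry p W (R I) = (\<lambda>_. 0)"
      proof
        fix S
        have "(\<Sum>v\<in>I. sgn_at q v (I - {v}) * bdry p W (c (I - {v})) S) =
          (\<Sum>v\<in>I. sgn_at q v (I - {v}) * g (I - {v}) S) +
          (\<Sum>v\<in>I. sgn_at q v (I - {v}) * (\<kappa> * (\<Sum>u\<in>I - {v}. sgn_at q u (I - {v} - {u}) * c (I - {v} - {u}) S)))"
          unfolding sum.distrib[symmetric] using cI by (intro sum.cong) (auto simp: distrib_left)
        also have "(\<Sum>v\<in>I. sgn_at q v (I - {v}) * (\<kappa> * (\<Sum>u\<in>I - {v}. sgn_at q u (I - {v} - {u}) * c (I - {v} - {u}) S)))
          = (\<Sum>v\<in>I. \<Sum>u\<in>I - {v}. \<kappa> * (sgn_at q u (I - {v} - {u}) * sgn_at q v (I - {v}) * c (I - {v} - {u}) S))"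
          by (simp add: sum_distrib_left ac_simps)
        also have "\<dots> = 0"
        proof (rule colr.sum_antisym_pairs)
          show "finite I" using finI I by blast
          fix u v assume uv: "u \<in> I" "v \<in> I" "u \<noteq> v"
          let ?T = "I - {u} - {v}"
          have eq: "I - {u} - {v} = I - {v} - {u}" "I - {u} = insert v ?T" "I - {v} = insert u ?T" using uv by auto
          have "sgn_at q v ?T * sgn_at q u (insert v ?T) = - (sgn_at q u ?T * sgn_at q v (insert u ?T))"
            by (rule colr.sgn_at_anticommute) (use uv I in auto)
          then have "sgn_at q v ?T * sgn_at q u (I - {u}) = - (sgn_at q u ?T * sgn_at q v (I - {v}))"
            using eq(2,3) by simp
          then show "\<kappa> * (sgn_at q v (I - {u} - {v}) * sgn_at q u (I - {u}) * c (I - {u} - {v}) S) =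
            - (\<kappa> * (sgn_at q u (I - {v} - {u}) * sgn_at q v (I - {v}) * c (I - {v} - {u}) S))"
            unfolding eq(1) by simp
        qed
        finally have "bdry p W (\<lambda>S. \<Sum>v\<in>I. sgn_at q v (I - {v}) * c (I - {v}) S) S =
           (\<Sum>v\<in>I. sgn_at q v (I - {v}) * g (I - {v}) S)"
          by (simp add: bdry_sum bdry_mult)
        then show "bdry p W (R I) S = 0"
          unfolding R_def by (simp add: bdry_add bdry_mult gb[OF I(1) ne])
      qed
      ultimately have "\<exists>d\<in>set_chains (below col K I) (Suc (card I + e - 1)). bdry p W d = R I"
        using ex[OF I(1) ne] unfolding exact_at_def by blast
      then show ?thesis using I(2) by simp
    qed
    then have "\<forall>I. \<exists>d. I \<subseteq> V \<and> card I = Suc m \<longrightarrow> d \<in> set_chains (below col K I) (card I + e) \<and> bdry p W d = R I"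
      by blast
    then obtain D where D: "\<And>I. I \<subseteq> V \<Longrightarrow> card I = Suc m \<Longrightarrow>
        D I \<in> set_chains (below col K I) (card I + e) \<and> bdry p W (D I) = R I"
      by metis
    define c' where "c' I = (if card I = Suc m then D I else c I)" for I
    have "?ok c' I" if I: "I \<subseteq> V" "card I \<le> Suc m" for I
    proof -
      have sub: "c' (I - {v}) = c (I - {v})" if "v \<in> I" for v
      proof -
        have "card (I - {v}) < card I" using that I finI by (intro psubset_card_mono) auto
        then show ?thesis using I by (simp add: c'_def)
      qed
      show ?thesis
      proof (cases "card I = Suc m")
        case True
        then show ?thesis using D[OF I(1) True] sub by (auto simp: c'_def[of I] R_def intro!: sum.cong)
      next
        case False
        then show ?thesis using c(2)[of I] I sub by (auto simp: c'_def[of I] intro!: sum.cong)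
      qed
    qed
    moreover have "c' {} = c0" using c(1) by (simp add: c'_def)
    ultimately have "c' {} = c0 \<and> (\<forall>I\<subseteq>V. card I \<le> Suc m \<longrightarrow> ?ok c' I)" by blast
    then show ?case by (rule exI[of _ c'])
  qed
  from this[of "card V"] obtain c where "c {} = c0 \<and> (\<forall>I\<subseteq>V. card I \<le> card V \<longrightarrow> ?ok c I)"
    by (elim exE)
  then have "c {} = c0 \<and> (\<forall>I\<subseteq>V. ?ok c I)" using card_mono[OF colr.fin] by blast
  then show ?thesis by (rule exI[of _ c])
qed

section \<open>Rainbow simplices and the cocycle of a class\<close>

text \<open>The colour of \<open>v\<close> occurs exactly twice in \<open>T\<close>, at
  \<open>v\<close> and at \<open>u\<close>, and every other colour once. A rainbow facet must
  therefore omit one of these two.\<close>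

lemma rainbow_faces:
  assumes T: "T \<subseteq> W" and v: "v \<in> T" and rv: "rainbow (T - {v})"
  obtains u where "u \<in> T" "u \<noteq> v" "\<And>w. w \<in> T \<Longrightarrow> rainbow (T - {w}) \<longleftrightarrow> w = u \<or> w = v"
    "sgn_at p u (T - {u}) = - sgn_at p v (T - {v})"
proof -
  have bij: "inj_on col (T - {v})" "col ` (T - {v}) = V" using rv by (auto simp: rainbow_def bij_betw_def)
  have "col v \<in> V" using T v col by auto
  then have "col v \<in> col ` (T - {v})" using bij(2) by simp
  then obtain u where "col v = col u" "u \<in> T - {v}" by (rule imageE)
  then have u: "u \<in> T" "u \<noteq> v" "col u = col v" by auto
  have ru: "rainbow (T - {u})"
  proof -
    have "inj_on col (T - {u})"
    proof (rule inj_onI)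
      fix x y assume xy: "x \<in> T - {u}" "y \<in> T - {u}" "col x = col y"
      have *: "z = v" if "z \<in> T - {u}" "col z = col v" for z
        using inj_onD[OF bij(1), of z u] that u by auto
      show "x = y"
        using *[of x] *[of y] xy inj_onD[OF bij(1), of x y] by (cases "x = v"; cases "y = v") auto
    qed
    moreover have "col ` (T - {u}) = V"
    proof
      show "col ` (T - {u}) \<subseteq> V" using T col by auto
      show "V \<subseteq> col ` (T - {u})"
      proof
        fix c assume "c \<in> V"
        then have "c \<in> col ` (T - {v})" using bij(2) by simp
        then obtain w where "c = col w" "w \<in> T - {v}" by (rule imageE)
        then show "c \<in> col ` (T - {u})" using u v by (cases "w = u") auto
      qed
    qed
    ultimately show ?thesis using T by (auto simp: rainbow_def bij_betw_def)
  qed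
  have notr: "\<not> rainbow (T - {w})" if "w \<noteq> u" "w \<noteq> v" for w
    using that u v inj_onD[of col "T - {w}" u v] by (auto simp: rainbow_def bij_betw_def)
  \<comment> \<open>Two vertices of equal colour are neighbours in \<open>T\<close>: anything
    strictly between them would share their colour, as the order sorts by colour. Their positions,
    and hence their signs, differ by one step.\<close>
  have key: "sgn_at p b (T - {b}) = - sgn_at p a (T - {a})"
    if ab: "a \<in> T" "b \<in> T" "p a < p b" "col a = col b" and inj: "inj_on col (T - {a})" "inj_on col (T - {b})" for a b
  proof -
    have "{w \<in> T - {b}. p w < p b} = insert a {w \<in> T - {a}. p w < p a}"
    proof (intro equalityI subsetI)
      fix w assume w: "w \<in> {w \<in> T - {b}. p w < p b}"
      show "w \<in> insert a {w \<in> T - {a}. p w < p a}"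
      proof (cases "w = a")
        case False
        then have "col w \<noteq> col a" using inj_onD[OF inj(2), of w a] w ab by auto
        moreover have "col w \<in> V" "col a \<in> V" using w ab T col by auto
        ultimately have "q (col w) \<noteq> q (col a)" using colr.inj by (auto dest: inj_onD)
        moreover have "\<not> q (col a) < q (col w)"
          using refines[of b w] w ab T by auto
        ultimately have "q (col w) < q (col a)" by simp
        then show ?thesis using refines[of w a] w ab T False by auto
      qed simp
    qed (use ab in auto)
    moreover have "finite {w \<in> T - {a}. p w < p a}" using T vert.fin finite_subset by fastforce
    ultimately show ?thesis by (simp add: sgn_at_def)
  qed
  have "p u \<noteq> p v" using u v T vert.inj by (auto dest: inj_onD)
  moreover have "inj_on col (T - {u})" using ru by (auto simp: rainbow_def bij_betw_def)
  ultimately have "sgn_at p u (T - {u}) = - sgn_at p v (T - {v})"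
    using key[of u v] key[of v u] u v bij(1) by (cases "p u < p v") auto
  then show ?thesis using that[of u] u(1,2) ru rv notr by blast
qed

text \<open>The condition that makes the indicator function of \<open>P\<close> a cocycle on
  \<open>K\<close>: a coface in \<open>K\<close> cannot have just one of its two rainbow facets in
  \<open>P\<close>. Members of \<open>P\<close> need not lie in \<open>K\<close>.\<close>

definition class_closed :: "'b set set \<Rightarrow> 'b set set \<Rightarrow> bool" where
  "class_closed K P \<longleftrightarrow> (\<forall>S\<in>P. rainbow S) \<and>
     (\<forall>T\<in>K. \<forall>S S'. S \<in> P \<and> rainbow S' \<and> S \<subseteq> T \<and> S' \<subseteq> T \<and> card T = Suc (card V) \<longrightarrow> S' \<in> P)"

lemma class_closed_rainbow: "class_closed K P \<Longrightarrow> S \<in> P \<Longrightarrow> rainbow S"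
  unfolding class_closed_def by blast

lemma class_closed_subset: "class_closed K P \<Longrightarrow> P \<subseteq> Pow W"
  using class_closed_rainbow by (auto simp: rainbow_def)

text \<open>After exchanging the summations, each \<open>T\<close> contributes the signs of its
  facets in \<open>P\<close>. By closedness these are none, or a pair with opposite signs.\<close>

lemma class_sum_bdry:
  assumes K: "K \<subseteq> Pow W" and P: "class_closed K P" and c: "c \<in> set_chains K (Suc (card V))"
  shows "(\<Sum>S\<in>P. bdry p W c S) = 0"
proof -
  have PW: "P \<subseteq> Pow W" using class_closed_subset[OF P] .
  then have finP: "finite P" using vert.fin finite_subset by blast
  have finS: "finite S" if "S \<subseteq> W" for S using that vert.fin finite_subset by blast
  have "(\<Sum>S\<in>P. bdry p W c S) = (\<Sum>(S,v)\<in>Sigma P (\<lambda>S. W - S). sgn_at p v S * c (insert v S))"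
    unfolding bdry_def by (rule sum.Sigma) (use finP vert.fin in auto)
  also have "\<dots> = (\<Sum>(T,v)\<in>Sigma (Pow W) (\<lambda>T. {v\<in>T. T - {v} \<in> P}). sgn_at p v (T - {v}) * c T)"
    by (rule sum.reindex_bij_witness[where i="\<lambda>(T,v). (T - {v}, v)" and j="\<lambda>(S,v). (insert v S, v)"])
       (use PW in \<open>auto simp: insert_absorb\<close>)
  also have "\<dots> = (\<Sum>T\<in>Pow W. \<Sum>v\<in>{v\<in>T. T - {v} \<in> P}. sgn_at p v (T - {v}) * c T)"
    by (rule sum.Sigma[symmetric]) (use vert.fin finS in auto)
  also have "\<dots> = 0"
  proof (rule sum.neutral, rule ballI)
    fix T assume T: "T \<in> Pow W"
    show "(\<Sum>v\<in>{v\<in>T. T - {v} \<in> P}. sgn_at p v (T - {v}) * c T) = 0"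
    proof (cases "c T = 0 \<or> {v\<in>T. T - {v} \<in> P} = {}")
      case True
      then show ?thesis by (elim disjE) (simp, simp only: sum.empty)
    next
      case False
      then have cT: "T \<in> K" "card T = Suc (card V)" using set_chainsD[OF c, of T] by auto
      obtain v where v: "v \<in> T" "T - {v} \<in> P" using False by auto
      then have rv: "rainbow (T - {v})" using class_closed_rainbow[OF P] by blast
      obtain u where u: "u \<in> T" "u \<noteq> v" "\<And>w. w \<in> T \<Longrightarrow> rainbow (T - {w}) \<longleftrightarrow> w = u \<or> w = v"
        "sgn_at p u (T - {u}) = - sgn_at p v (T - {v})"
        using rainbow_faces[of T v] T v rv by auto
      have mem: "T - {w} \<in> P \<longleftrightarrow> rainbow (T - {w})" if "w \<in> T" for w
        using P cT v that unfolding class_closed_def by blast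
      have "{v\<in>T. T - {v} \<in> P} = {u, v}" using u v mem by auto
      then show ?thesis using u by simp
    qed
  qed
  finally show ?thesis .
qed

section \<open>Comparison of chain maps from the simplex of colours\<close>

text \<open>The chain map of the section of the colouring that \<open>R\<close> defines: the face
  \<open>I\<close> of the simplex on \<open>V\<close> goes to the part of \<open>R\<close> coloured
  by \<open>I\<close>.\<close>

definition transversal_chain :: "'b set \<Rightarrow> 'a set \<Rightarrow> 'b set \<Rightarrow> rat" where
  "transversal_chain R I S = (if S = {x \<in> R. col x \<in> I} then 1 else 0)"

lemma transversal_chain_in:
  assumes "rainbow R" "I \<subseteq> V" "\<And>S. S \<subseteq> R \<Longrightarrow> S \<in> K"
  shows "transversal_chain R I \<in> set_chains (below col K I) (card I)"
proof -
  have "bij_betw col {x \<in> R. col x \<in> I} I"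
    using assms(1,2) by (auto simp: rainbow_def bij_betw_def intro: inj_on_subset)
  then have "card {x \<in> R. col x \<in> I} = card I" by (rule bij_betw_same_card)
  then show ?thesis using assms(3)
    by (auto simp: set_chains_def transversal_chain_def below_def split: if_splits)
qed

text \<open>Because vertices are ordered by colour, the colouring is an order isomorphism from
  \<open>R\<close> to \<open>V\<close>, so facets correspond together with their signs.\<close>

lemma bdry_transversal_chain:
  assumes R: "rainbow R" and I: "I \<subseteq> V"
  shows "bdry p W (transversal_chain R I) =
     (\<lambda>S. \<Sum>v\<in>I. sgn_at q v (I - {v}) * transversal_chain R (I - {v}) S)"
proof
  fix S
  let ?R = "\<lambda>I. {x \<in> R. col x \<in> I}"
  \<comment> \<open>\<open>?X\<close> holds the vertices whose removal from the I-coloured part of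
    \<open>R\<close> leaves \<open>S\<close>; \<open>?Y\<close> turns out to be the set of their
    colours.\<close>
  let ?X = "{x \<in> W - S. insert x S = ?R I}" and ?Y = "{v \<in> I. S = ?R (I - {v})}"
  have RW: "R \<subseteq> W" and injR: "inj_on col R" and imR: "col ` R = V"
    using R by (auto simp: rainbow_def bij_betw_def)
  have finI: "finite I" using I colr.fin finite_subset by blast
  have eqc: "x = y" if "x \<in> R" "y \<in> R" "col x = col y" for x y
    using inj_onD[OF injR] that by blast
  have bij: "bij_betw col ?X ?Y"
    unfolding bij_betw_def
  proof
    show "inj_on col ?X" by (rule inj_on_subset[OF injR]) auto
    show "col ` ?X = ?Y"
    proof (intro equalityI subsetI)
      fix v assume "v \<in> col ` ?X"
      then obtain x where x: "x \<notin> S" "insert x S = ?R I" "v = col x" by auto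
      have xR: "x \<in> R" "col x \<in> I" using x(2) by auto
      have "S = ?R I - {x}" using x by auto
      also have "\<dots> = ?R (I - {v})" using xR x(3) eqc by auto
      finally show "v \<in> ?Y" using xR x by simp
    next
      fix v assume v: "v \<in> ?Y"
      then have "v \<in> V" using I by auto
      then obtain x where x: "x \<in> R" "v = col x" using imR by auto
      have "insert x S = ?R I" using v x eqc by auto
      moreover have "x \<notin> S" using v x by auto
      ultimately show "v \<in> col ` ?X" using x RW by auto
    qed
  qed
  have sg: "sgn_at p x S = sgn_at q (col x) (I - {col x})" if x: "x \<in> ?X" for x
  proof -
    have xR: "x \<in> R" "col x \<in> I" using x by auto
    have "col x \<in> ?Y" using bij_betw_apply[OF bij x] .
    then have S: "S = ?R (I - {col x})" by simp
    have iff: "p y < p x \<longleftrightarrow> q (col y) < q (col x)" if "y \<in> S" for y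
    proof -
      have y: "y \<in> R" "col y \<noteq> col x" "col y \<in> V" "col x \<in> V" using that S xR I by auto
      then have "q (col y) \<noteq> q (col x)" using colr.inj by (auto dest: inj_onD)
      then show ?thesis using refines[of x y] refines[of y x] y(1) xR(1) RW by fastforce
    qed
    have "bij_betw col {u \<in> S. p u < p x} {u \<in> I - {col x}. q u < q (col x)}"
      unfolding bij_betw_def
    proof
      show "inj_on col {u \<in> S. p u < p x}" by (rule inj_on_subset[OF injR]) (use S in auto)
      show "col ` {u \<in> S. p u < p x} = {u \<in> I - {col x}. q u < q (col x)}"
      proof (intro equalityI subsetI)
        fix v assume "v \<in> col ` {u \<in> S. p u < p x}"
        then show "v \<in> {u \<in> I - {col x}. q u < q (col x)}" using iff S by auto
      next
        fix v assume v: "v \<in> {u \<in> I - {col x}. q u < q (col x)}"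
        then have "v \<in> V" using I by auto
        then obtain y where y: "y \<in> R" "v = col y" using imR by auto
        then have "y \<in> S" using v S by auto
        then show "v \<in> col ` {u \<in> S. p u < p x}" using y v iff by auto
      qed
    qed
    then show ?thesis unfolding sgn_at_def by (simp add: bij_betw_same_card)
  qed
  have "bdry p W (transversal_chain R I) S = (\<Sum>x\<in>?X. sgn_at p x S)"
    unfolding bdry_def transversal_chain_def using vert.fin
    by (intro sum.mono_neutral_cong_right) auto
  also have "\<dots> = (\<Sum>x\<in>?X. sgn_at q (col x) (I - {col x}))"
    using sg by (intro sum.cong) auto
  also have "\<dots> = (\<Sum>v\<in>?Y. sgn_at q v (I - {v}))"
    by (rule sum.reindex_bij_betw[OF bij])
  also have "\<dots> = (\<Sum>v\<in>I. sgn_at q v (I - {v}) * transversal_chain R (I - {v}) S)"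
    unfolding transversal_chain_def using finI by (intro sum.mono_neutral_cong_left) auto
  finally show "bdry p W (transversal_chain R I) S =
     (\<Sum>v\<in>I. sgn_at q v (I - {v}) * transversal_chain R (I - {v}) S)" .
qed

text \<open>\<open>A\<close> and \<open>B\<close> are chain maps from the simplex on
  \<open>V\<close> that agree on the empty face. The family \<open>c\<close> is the prism between
  them, with zero as its value on the empty face. Summed over \<open>P\<close>, the boundary of
  \<open>c V\<close> vanishes, which leaves the two ends.\<close>

lemma class_sum_eq:
  assumes K: "K \<subseteq> Pow W" and P: "class_closed K P"
    and ex: "\<And>I. I \<subseteq> V \<Longrightarrow> I \<noteq> {} \<Longrightarrow> exact_at p W (below col K I) (card I)"
    and A: "\<And>I. I \<subseteq> V \<Longrightarrow> A I \<in> set_chains (below col K I) (card I)"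
      "\<And>I. I \<subseteq> V \<Longrightarrow> bdry p W (A I) = (\<lambda>S. \<Sum>v\<in>I. sgn_at q v (I - {v}) * A (I - {v}) S)"
    and B: "\<And>I. I \<subseteq> V \<Longrightarrow> B I \<in> set_chains (below col K I) (card I)"
      "\<And>I. I \<subseteq> V \<Longrightarrow> bdry p W (B I) = (\<lambda>S. \<Sum>v\<in>I. sgn_at q v (I - {v}) * B (I - {v}) S)"
    and AB: "A {} = B {}"
  shows "(\<Sum>S\<in>P. A V S) = (\<Sum>S\<in>P. B V S)"
proof -
  have "\<exists>c. c {} = (\<lambda>_. 0) \<and> (\<forall>I\<subseteq>V. c I \<in> set_chains (below col K I) (card I + 1) \<and>
       bdry p W (c I) = (\<lambda>S. (\<lambda>S. A I S - B I S) S + (-1) * (\<Sum>v\<in>I. sgn_at q v (I - {v}) * c (I - {v}) S)))"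
  proof (rule extend_family[OF K])
    fix I assume I: "I \<subseteq> V" "I \<noteq> {}"
    show "exact_at p W (below col K I) (card I + 1 - 1)" using ex I by simp
    show "(\<lambda>S. A I S - B I S) \<in> set_chains (below col K I) (card I + 1 - 1)"
      using set_chains_diff[OF A(1) B(1)] I by simp
    show "bdry p W (\<lambda>S. A I S - B I S) =
      (\<lambda>S. - (-1) * (\<Sum>v\<in>I. sgn_at q v (I - {v}) * (A (I - {v}) S - B (I - {v}) S)))"
      by (simp add: bdry_diff A(2) B(2) I sum_subtractf right_diff_distrib)
  qed (simp_all add: set_chains_0 bdry_0 AB)
  then obtain c where c: "\<And>I. I \<subseteq> V \<Longrightarrow> c I \<in> set_chains (below col K I) (card I + 1)"
    "bdry p W (c V) = (\<lambda>S. A V S - B V S - (\<Sum>v\<in>V. sgn_at q v (V - {v}) * c (V - {v}) S))"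
    by auto
  \<comment> \<open>The side walls of the prism each miss a colour, so the class does not see
    them.\<close>
  have z: "c (V - {v}) S = 0" if "v \<in> V" "S \<in> P" for v S
  proof (rule ccontr)
    assume "c (V - {v}) S \<noteq> 0"
    then have "col ` S \<subseteq> V - {v}" using set_chainsD(1)[OF c(1)] by (auto simp: below_def)
    moreover have "col ` S = V" using class_closed_rainbow[OF P that(2)] by (simp add: rainbow_def bij_betw_def)
    ultimately show False using that by auto
  qed
  have "set_chains (below col K V) (card V + 1) \<subseteq> set_chains K (Suc (card V))"
    using set_chains_mono[of "below col K V" K] by (auto simp: below_def)
  then have "(\<Sum>S\<in>P. bdry p W (c V) S) = 0"
    using class_sum_bdry[OF K P] c(1)[of V] by blast
  moreover have "(\<Sum>S\<in>P. bdry p W (c V) S) = (\<Sum>S\<in>P. A V S - B V S)"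
    unfolding c(2) by (intro sum.cong refl) (simp add: z)
  ultimately show ?thesis by (simp add: sum_subtractf)
qed

lemma transversal_chain_class:
  assumes "P \<subseteq> Pow W" "rainbow R"
  shows "(\<Sum>S\<in>P. transversal_chain R V S) = (if R \<in> P then 1 else 0)"
proof -
  have "{x \<in> R. col x \<in> V} = R" using assms(2) by (auto simp: rainbow_def bij_betw_def)
  moreover have "finite P" using assms(1) vert.fin finite_subset by blast
  ultimately show ?thesis by (simp add: transversal_chain_def)
qed

text \<open>The class sum of a transversal chain is 1 or 0 according to membership in
  \<open>P\<close>, so equality of the two sums carries membership from \<open>R\<close> to
  \<open>R'\<close>.\<close>

theorem hall_connected:
  assumes K: "K \<subseteq> Pow W" "\<And>S T. S \<in> K \<Longrightarrow> T \<subseteq> S \<Longrightarrow> T \<in> K" and P: "class_closed K P"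
    and ex: "\<And>I. I \<subseteq> V \<Longrightarrow> I \<noteq> {} \<Longrightarrow> exact_at p W (below col K I) (card I)"
    and R: "R \<in> P" "R \<in> K" and R': "R' \<in> K" "rainbow R'"
  shows "R' \<in> P"
proof -
  have rR: "rainbow R" using class_closed_rainbow[OF P R(1)] .
  have "(\<Sum>S\<in>P. transversal_chain R V S) = (\<Sum>S\<in>P. transversal_chain R' V S)"
  proof (rule class_sum_eq[OF K(1) P ex])
    fix I assume I: "I \<subseteq> V"
    show "transversal_chain R I \<in> set_chains (below col K I) (card I)"
      using rR I K(2)[OF R(2)] by (rule transversal_chain_in)
    show "transversal_chain R' I \<in> set_chains (below col K I) (card I)"
      using R'(2) I K(2)[OF R'(1)] by (rule transversal_chain_in)
  next
    show "transversal_chain R {} = transversal_chain R' {}"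
      by (simp add: transversal_chain_def fun_eq_iff)
  qed (simp_all add: bdry_transversal_chain rR R'(2))
  then show ?thesis
    unfolding transversal_chain_class[OF class_closed_subset[OF P] rR]
      transversal_chain_class[OF class_closed_subset[OF P] R'(2)]
    using R(1) by (simp split: if_splits)
qed

text \<open>A degree argument: a chain map into \<open>K\<close> is compared, inside the full
  simplex on \<open>W\<close>, with the one given by a reference transversal \<open>R\<close> that
  need not lie in \<open>K\<close>. Its rainbow coefficients therefore add up to 1. In
  \<open>K\<close> only a chain map is built and no homotopy, so one cardinality less
  suffices.\<close>

theorem hall_nonempty:
  assumes K: "K \<subseteq> Pow W" "{} \<in> K"
    and ex: "\<And>I. I \<subseteq> V \<Longrightarrow> I \<noteq> {} \<Longrightarrow> exact_at p W (below col K I) (card I - 1)"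
    and R: "rainbow R"
  shows "\<exists>S\<in>K. rainbow S"
proof -
  let ?one = "\<lambda>S::'b set. if S = {} then 1 else 0 :: rat"
  have b1: "bdry p W ?one = (\<lambda>_. 0)" by (simp add: bdry_def)
  have "\<exists>c. c {} = ?one \<and> (\<forall>I\<subseteq>V. c I \<in> set_chains (below col K I) (card I + 0) \<and>
       bdry p W (c I) = (\<lambda>S. (\<lambda>_ _. 0) I S + 1 * (\<Sum>v\<in>I. sgn_at q v (I - {v}) * c (I - {v}) S)))"
    by (rule extend_family[OF K(1)])
      (use K ex b1 in \<open>auto simp: set_chains_0 bdry_0 set_chains_def below_def split: if_splits\<close>)
  then obtain A where A: "A {} = ?one" "\<And>I. I \<subseteq> V \<Longrightarrow> A I \<in> set_chains (below col K I) (card I)"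
    "\<And>I. I \<subseteq> V \<Longrightarrow> bdry p W (A I) = (\<lambda>S. \<Sum>v\<in>I. sgn_at q v (I - {v}) * A (I - {v}) S)"
    by auto
  let ?P = "{S. rainbow S}"
  have P: "class_closed (Pow W) ?P" by (simp add: class_closed_def)
  have "(\<Sum>S\<in>?P. A V S) = (\<Sum>S\<in>?P. transversal_chain R V S)"
  proof (rule class_sum_eq[OF _ P])
    fix I assume I: "I \<subseteq> V"
    show "A I \<in> set_chains (below col (Pow W) I) (card I)"
      using A(2)[OF I] set_chains_mono[OF below_mono[of K "Pow W" I I]] K(1) by blast
    show "transversal_chain R I \<in> set_chains (below col (Pow W) I) (card I)"
      using R by (intro transversal_chain_in) (auto simp: rainbow_def I)
    \<comment> \<open>Any vertex of \<open>R\<close> with colour in \<open>I\<close> is a cone point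
      here; this is the only place where the existence of a transversal matters.\<close>
    show "exact_at p W (below col (Pow W) I) (card I)" if ne: "I \<noteq> {}"
    proof -
      obtain v where v: "v \<in> I" "v \<in> V" using ne I by blast
      then obtain x where "x \<in> R" "col x = v" using R unfolding rainbow_def bij_betw_def by blast
      then show ?thesis using v R by (intro vert.exact_at_cone[where v=x]) (auto simp: below_def rainbow_def)
    qed
  next
    show "A {} = transversal_chain R {}" by (simp add: A(1) transversal_chain_def fun_eq_iff)
  qed (simp_all add: A bdry_transversal_chain R)
  also have "\<dots> = 1"
    using transversal_chain_class[OF class_closed_subset[OF P] R] R by simp
  finally have "\<exists>S. rainbow S \<and> A V S \<noteq> 0"
    by (metis (mono_tags, lifting) mem_Collect_eq sum.neutral zero_neq_one)
  then show ?thesis using set_chainsD(1)[OF A(2)[of V]] by (auto simp: below_def)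
qed

end

section \<open>Matroids and the join with the dual matroid\<close>

definition trank :: "'a set set \<Rightarrow> nat \<Rightarrow> 'a set \<Rightarrow> nat" where
  "trank M k X = Max (card ` {A \<in> M. A \<subseteq> X \<and> card A \<le> k})"

lemma matroid_finite: "matroid V M \<Longrightarrow> finite M"
  unfolding matroid_def by (meson finite_Pow_iff finite_subset)

lemma matroid_indep_finite: "matroid V M \<Longrightarrow> A \<in> M \<Longrightarrow> finite A"
  unfolding matroid_def by (meson PowD finite_subset subsetD)

lemma matroid_augment:
  "matroid V M \<Longrightarrow> A \<in> M \<Longrightarrow> B \<in> M \<Longrightarrow> card A < card B \<Longrightarrow> \<exists>x\<in>B - A. insert x A \<in> M"
  unfolding matroid_def by blast

lemma matroid_subset: "matroid V M \<Longrightarrow> A \<in> M \<Longrightarrow> B \<subseteq> A \<Longrightarrow> B \<in> M"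
  unfolding matroid_def by blast

lemma trank_ge: "matroid V M \<Longrightarrow> A \<in> M \<Longrightarrow> A \<subseteq> X \<Longrightarrow> card A \<le> k \<Longrightarrow> card A \<le> trank M k X"
  unfolding trank_def using matroid_finite[of V M] by (intro Max_ge) auto

lemma trank_witness:
  assumes "matroid V M"
  obtains A where "A \<in> M" "A \<subseteq> X" "card A = trank M k X" "card A \<le> k"
proof -
  have "{} \<in> M" using assms by (simp add: matroid_def)
  then have "trank M k X \<in> card ` {A \<in> M. A \<subseteq> X \<and> card A \<le> k}"
    unfolding trank_def using matroid_finite[OF assms] by (intro Max_in) auto
  then show ?thesis using that by auto
qed

lemma trank_le: "matroid V M \<Longrightarrow> trank M k X \<le> k"
  using trank_witness[of V M X k] by auto

lemma trank_mono:
  assumes M: "matroid V M" and XY: "X \<subseteq> Y"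
  shows "trank M k X \<le> trank M k Y"
proof -
  obtain A where A: "A \<in> M" "A \<subseteq> X" "card A = trank M k X" "card A \<le> k" by (rule trank_witness[OF M])
  then show ?thesis using trank_ge[OF M A(1) order_trans[OF A(2) XY] A(4)] by simp
qed

lemma trank_insert_le:
  assumes M: "matroid V M"
  shows "trank M k (insert x X) \<le> Suc (trank M k X)"
proof -
  obtain A where A: "A \<in> M" "A \<subseteq> insert x X" "card A = trank M k (insert x X)" "card A \<le> k"
    by (rule trank_witness[OF M])
  have "card (A - {x}) \<le> trank M k X"
    using A card_Diff1_le[of A x] by (intro trank_ge[OF M] matroid_subset[OF M A(1)]) auto
  moreover have "card A \<le> Suc (card (A - {x}))"
    by (auto simp: card_Diff_singleton_if)
  ultimately show ?thesis using A(3) by linarith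
qed

text \<open>Extend a basis \<open>B0\<close> of \<open>J\<close> to a largest admissible independent
  set \<open>B\<close> inside \<open>S\<close>. If \<open>x\<close> raised the rank of
  \<open>S\<close>, augmenting \<open>B\<close> could only add \<open>x\<close>, and then
  \<open>x\<close> would be independent of \<open>B0\<close> already.\<close>

lemma trank_closure:
  assumes M: "matroid V M" and eq: "trank M k (insert x J) = trank M k J" and S: "J \<subseteq> S"
  shows "trank M k (insert x S) = trank M k S"
proof (rule antisym)
  show "trank M k S \<le> trank M k (insert x S)" by (rule trank_mono[OF M]) auto
  show "trank M k (insert x S) \<le> trank M k S"
  proof (rule ccontr)
    assume "\<not> ?thesis"
    then have lt: "trank M k S < trank M k (insert x S)" by simp
    obtain B0 where B0: "B0 \<in> M" "B0 \<subseteq> J" "card B0 = trank M k J" "card B0 \<le> k"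
      by (rule trank_witness[OF M])
    define BB where "BB = {B \<in> M. B0 \<subseteq> B \<and> B \<subseteq> S \<and> card B \<le> k}"
    have "finite BB" using matroid_finite[OF M] by (simp add: BB_def)
    moreover have "B0 \<in> BB" using B0 S by (auto simp: BB_def)
    ultimately have "Max (card ` BB) \<in> card ` BB" "\<And>B'. B' \<in> BB \<Longrightarrow> card B' \<le> Max (card ` BB)"
      by (auto intro!: Max_in)
    then obtain B where B: "B \<in> BB" "\<And>B'. B' \<in> BB \<Longrightarrow> card B' \<le> card B" by (metis imageE)
    have BM: "B \<in> M" "B0 \<subseteq> B" "B \<subseteq> S" "card B \<le> k" using B(1) by (auto simp: BB_def)
    obtain A where A: "A \<in> M" "A \<subseteq> insert x S" "card A = trank M k (insert x S)" "card A \<le> k"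
      by (rule trank_witness[OF M])
    have "card B \<le> trank M k S" using BM by (intro trank_ge[OF M]) auto
    then have "card B < card A" using lt A by simp
    then obtain y where y: "y \<in> A - B" "insert y B \<in> M" using matroid_augment[OF M BM(1) A(1)] by blast
    have fB: "finite B" using matroid_indep_finite[OF M BM(1)] .
    have cy: "card (insert y B) = Suc (card B)" using y fB by simp
    have "y \<notin> S"
    proof
      assume "y \<in> S"
      then have "insert y B \<in> BB" using y BM cy \<open>card B < card A\<close> A(4) by (auto simp: BB_def)
      then show False using B(2) cy by fastforce
    qed
    then have yx: "y = x" "x \<notin> S" using y A by auto
    have "insert x B0 \<in> M" using matroid_subset[OF M y(2)] BM yx by blast
    moreover have c0: "card (insert x B0) = Suc (card B0)"
      using B0 S yx matroid_indep_finite[OF M B0(1)] by (subst card_insert_disjoint) auto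
    \<comment> \<open>Truncation is respected: \<open>card B0 \<le> card B < card A \<le> k\<close>
      leaves room for one more element.\<close>
    moreover have "card B0 \<le> card B" using BM fB by (intro card_mono)
    ultimately have "card (insert x B0) \<le> trank M k (insert x J)"
      using B0 \<open>card B < card A\<close> A(4) by (intro trank_ge[OF M]) auto
    then show False using c0 eq B0(3) by simp
  qed
qed

lemma mrank_restr_ge: "matroid V M \<Longrightarrow> A \<in> M \<Longrightarrow> A \<subseteq> X \<Longrightarrow> card A \<le> mrank (restr M X)"
  unfolding mrank_def restr_def using matroid_finite[of V M] by (intro Max_ge) auto

lemma mrank_restr_witness:
  assumes "matroid V M"
  obtains A where "A \<in> M" "A \<subseteq> X" "card A = mrank (restr M X)"
proof -
  have "{} \<in> M" using assms by (simp add: matroid_def)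
  then have "mrank (restr M X) \<in> card ` restr M X"
    unfolding mrank_def using matroid_finite[OF assms] by (intro Max_in) (auto simp: restr_def)
  then show ?thesis using that by (auto simp: restr_def)
qed

lemma trank_eq_min:
  assumes M: "matroid V M"
  shows "trank M k X = min k (mrank (restr M X))"
proof (rule antisym)
  obtain A where "A \<in> M" "A \<subseteq> X" "card A = trank M k X" "card A \<le> k" by (rule trank_witness[OF M])
  then show "trank M k X \<le> min k (mrank (restr M X))" using mrank_restr_ge[OF M, of A X] by simp
next
  obtain A where A: "A \<in> M" "A \<subseteq> X" "card A = mrank (restr M X)" by (rule mrank_restr_witness[OF M])
  obtain B where B: "B \<subseteq> A" "card B = min k (card A)"
    by (meson obtain_subset_with_card_n min.cobounded2)
  then show "min k (mrank (restr M X)) \<le> trank M k X"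
    using A trank_ge[OF M matroid_subset[OF M A(1) B(1)], of X k] by auto
qed

text \<open>Ordinary basis exchange. Every intermediate set stays inside \<open>\<sigma>\<close>, so
  each exchange step has its union in \<open>C\<close> and is an edge of the graph.\<close>

lemma bases_connected:
  assumes M: "matroid V M" and C: "\<And>\<tau>. \<tau> \<subseteq> \<sigma> \<Longrightarrow> \<tau> \<in> C"
    and A: "A \<in> M" "card A = k" "A \<subseteq> \<sigma>" and B: "B \<in> M" "card B = k" "B \<subseteq> \<sigma>"
  shows "(RG_adj C M k)\<^sup>*\<^sup>* A B"
  using A
proof (induction "card (B - A)" arbitrary: A rule: less_induct)
  case less
  have fin: "finite A" "finite B" using less.prems B matroid_indep_finite[OF M] by auto
  show ?case
  proof (cases "A \<subseteq> B")
    case True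
    then have "A = B" using less.prems B fin by (simp add: card_subset_eq)
    then show ?thesis by simp
  next
    case False
    then obtain x where x: "x \<in> A" "x \<notin> B" by auto
    have "card (A - {x}) < card B" using x fin less.prems B(2) by (metis card_Diff1_less)
    then obtain y where y: "y \<in> B - (A - {x})" "insert y (A - {x}) \<in> M"
      using matroid_augment[OF M matroid_subset[OF M less.prems(1)] B(1)] by (metis Diff_subset)
    have yA: "y \<notin> A" using x y by auto
    let ?A = "insert y (A - {x})"
    have c: "card ?A = k"
    proof -
      have "card ?A = Suc (card (A - {x}))" using yA fin(1) by (intro card_insert_disjoint) auto
      then show ?thesis using card_Suc_Diff1[OF fin(1) x(1)] less.prems(2) by simp
    qed
    have "card (B - ?A) < card (B - A)"
      using y yA x fin by (intro psubset_card_mono) auto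
    then have "(RG_adj C M k)\<^sup>*\<^sup>* ?A B"
      using less.hyps[of ?A] y c less.prems(3) B(3) by auto
    moreover have "RG_adj C M k A ?A"
    proof -
      have "A \<union> ?A = insert y A" by auto
      moreover have "card (insert y A) = k + 1" using yA fin less.prems by simp
      ultimately show ?thesis
        unfolding RG_adj_def RG_vertices_def
        using less.prems y c C[of A] C[of ?A] C[of "insert y A"] B(3) by auto
    qed
    ultimately show ?thesis by (rule converse_rtranclp_into_rtranclp[rotated])
  qed
qed

text \<open>For \<open>J = V - I\<close> and \<open>\<rho>\<close> the rank function truncated at \<open>k\<close>, the \<open>Inr\<close> parts are the independent
  sets of the dual matroid inside \<open>I\<close>: those whose complement spans.\<close>
definition join_dual :: "nat \<Rightarrow> ('a set \<Rightarrow> nat) \<Rightarrow> 'a set set \<Rightarrow> 'a set \<Rightarrow> 'a set \<Rightarrow> ('a + 'a) set set" where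
  "join_dual k \<rho> D I J = {S. Inl -` S \<in> D \<and> Inr -` S \<subseteq> I \<and> k \<le> \<rho> ((I - Inr -` S) \<union> J)}"

text \<open>Doubling puts the two copies of \<open>v\<close> next to each other, so this order sorts
  by colour; on first copies it is the order given by \<open>q\<close>.\<close>

definition sum_pos :: "('a \<Rightarrow> nat) \<Rightarrow> 'a + 'a \<Rightarrow> nat" where
  "sum_pos q = case_sum (\<lambda>v. 2 * q v) (\<lambda>v. 2 * q v + 1)"

lemma vimage_insert_sum [simp]:
  "Inl -` insert (Inl x) S = insert x (Inl -` S)" "Inl -` insert (Inr y) S = Inl -` S"
  "Inr -` insert (Inr y) S = insert y (Inr -` S)" "Inr -` insert (Inl x) S = Inr -` S"
  by auto

lemma ordered_ground_sum:
  assumes "ordered_ground q V"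
  shows "ordered_ground (sum_pos q) (V <+> V)"
proof
  show "finite (V <+> V)" using assms by (simp add: ordered_ground_def)
  have q: "inj_on q V" using assms by (simp add: ordered_ground_def)
  show "inj_on (sum_pos q) (V <+> V)"
  proof (rule inj_onI)
    fix x y assume "x \<in> V <+> V" "y \<in> V <+> V" "sum_pos q x = sum_pos q y"
    then show "x = y"
      using inj_onD[OF q] by (cases x; cases y) (auto simp: sum_pos_def Suc_double_not_eq_double double_not_eq_Suc_double)
  qed
qed

lemma coloured_ground_sum:
  assumes "ordered_ground q V"
  shows "coloured_ground (sum_pos q) (V <+> V) q V (case_sum id id)"
proof -
  interpret vert: ordered_ground "sum_pos q" "V <+> V" by (rule ordered_ground_sum[OF assms])
  interpret colr: ordered_ground q V by (rule assms)
  show ?thesis by unfold_locales (auto simp: sum_pos_def)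
qed

lemma exact_at_empty: "exact_at p W {} t"
proof -
  have "c = (\<lambda>_. 0)" if "c \<in> set_chains {} t" for c using that by (auto simp: set_chains_def)
  then show ?thesis unfolding exact_at_def using bdry_0 set_chains_0 by blast
qed

lemma bdry_Inl:
  assumes "finite V" "\<And>S. c S \<noteq> 0 \<Longrightarrow> Inr -` S = {}"
  shows "bdry (sum_pos q) (V <+> V) c (Inl ` \<sigma>) = bdry q V (\<lambda>\<sigma>. c (Inl ` \<sigma>)) \<sigma>"
proof -
  have sg: "sgn_at (sum_pos q) (Inl v) (Inl ` \<sigma>) = sgn_at q v \<sigma>" for v
  proof -
    have "{u \<in> Inl ` \<sigma>. sum_pos q u < sum_pos q (Inl v)} = Inl ` {u \<in> \<sigma>. q u < q v}"
      by (auto simp: sum_pos_def)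
    then show ?thesis by (simp add: sgn_at_def card_image)
  qed
  have "bdry (sum_pos q) (V <+> V) c (Inl ` \<sigma>) =
      (\<Sum>w\<in>Inl ` (V - \<sigma>). sgn_at (sum_pos q) w (Inl ` \<sigma>) * c (insert w (Inl ` \<sigma>)))"
    unfolding bdry_def
  proof (rule sum.mono_neutral_right)
    show "\<forall>w\<in>(V <+> V) - Inl ` \<sigma> - Inl ` (V - \<sigma>).
        sgn_at (sum_pos q) w (Inl ` \<sigma>) * c (insert w (Inl ` \<sigma>)) = 0"
    proof
      fix w assume "w \<in> (V <+> V) - Inl ` \<sigma> - Inl ` (V - \<sigma>)"
      then obtain v where "w = Inr v" by auto
      then have "c (insert w (Inl ` \<sigma>)) = 0" using assms(2)[of "insert w (Inl ` \<sigma>)"] by auto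
      then show "sgn_at (sum_pos q) w (Inl ` \<sigma>) * c (insert w (Inl ` \<sigma>)) = 0" by simp
    qed
  qed (use assms(1) in auto)
  also have "\<dots> = bdry q V (\<lambda>\<sigma>. c (Inl ` \<sigma>)) \<sigma>"
    unfolding bdry_def by (subst sum.reindex) (auto simp: sg)
  finally show ?thesis .
qed

lemma exact_at_Inl:
  assumes "finite V" and ex: "exact_at q V D t"
  shows "exact_at (sum_pos q) (V <+> V) {S. Inl -` S \<in> D \<and> Inr -` S = {}} t"
  unfolding exact_at_def
proof (intro ballI impI)
  let ?K = "{S. Inl -` S \<in> D \<and> Inr -` S = {}}"
  have img: "Inl ` (Inl -` S) = S" if "Inr -` S = {}" for S :: "('a + 'a) set"
  proof (intro equalityI subsetI)
    fix x assume "x \<in> S"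
    then show "x \<in> Inl ` (Inl -` S)" using that by (cases x) auto
  qed auto
  have crd: "card (Inl -` S) = card S" if "Inr -` S = {}" for S :: "('a + 'a) set"
    by (metis img[OF that] card_image inj_Inl)
  have vim: "Inl -` Inl ` \<sigma> = \<sigma>" "Inr -` Inl ` \<sigma> = {}" for \<sigma> :: "'a set" by auto
  fix c assume c: "c \<in> set_chains ?K t" "bdry (sum_pos q) (V <+> V) c = (\<lambda>_. 0)"
  have cR: "Inr -` S = {}" if "c S \<noteq> 0" for S using set_chainsD(1)[OF c(1) that] by simp
  have "(\<lambda>\<sigma>. c (Inl ` \<sigma>)) \<in> set_chains D t"
    using c(1) by (auto simp: set_chains_def vim card_image)
  moreover have "bdry q V (\<lambda>\<sigma>. c (Inl ` \<sigma>)) = (\<lambda>_. 0)"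
    using bdry_Inl[OF assms(1) cR] c(2) by (metis (no_types, lifting))
  ultimately obtain d' where d': "d' \<in> set_chains D (Suc t)" "bdry q V d' = (\<lambda>\<sigma>. c (Inl ` \<sigma>))"
    using ex unfolding exact_at_def by blast
  define d where "d S = (if Inr -` S = {} then d' (Inl -` S) else 0)" for S :: "('a + 'a) set"
  have dK: "d \<in> set_chains ?K (Suc t)"
    using d'(1) crd by (auto simp: set_chains_def d_def split: if_splits)
  have dR: "Inr -` S = {}" if "d S \<noteq> 0" for S using that by (auto simp: d_def split: if_splits)
  have dI: "(\<lambda>\<sigma>. d (Inl ` \<sigma>)) = d'" by (simp add: d_def vim fun_eq_iff)
  have "bdry (sum_pos q) (V <+> V) d S = c S" for S
  proof (cases "Inr -` S = {}")
    case True
    have "bdry (sum_pos q) (V <+> V) d (Inl ` (Inl -` S)) = c (Inl ` (Inl -` S))"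
      using bdry_Inl[OF assms(1) dR, where \<sigma>="Inl -` S" and q=q] dI d'(2) by simp
    then show ?thesis by (simp only: img[OF True])
  next
    case False
    then have "d (insert v S) = 0" for v by (auto simp: d_def)
    moreover have "c S = 0" using cR False by blast
    ultimately show ?thesis by (simp add: bdry_def)
  qed
  then show "\<exists>d\<in>set_chains ?K (Suc t). bdry (sum_pos q) (V <+> V) d = c" using dK by blast
qed

section \<open>Deletion and contraction in the join with the dual matroid\<close>

locale rank_function =
  fixes \<rho> :: "'a set \<Rightarrow> nat" and k :: nat
  assumes le: "\<rho> X \<le> k"
    and mono: "X \<subseteq> Y \<Longrightarrow> \<rho> X \<le> \<rho> Y"
    and insert_le: "\<rho> (insert x X) \<le> Suc (\<rho> X)"
    and closure: "\<rho> (insert x X) = \<rho> X \<Longrightarrow> X \<subseteq> Y \<Longrightarrow> \<rho> (insert x Y) = \<rho> Y"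
begin

lemma join_dual_subset:
  assumes "D \<subseteq> Pow V" "I \<subseteq> V"
  shows "join_dual k \<rho> D I J \<subseteq> Pow (V <+> V)"
proof
  fix S assume S: "S \<in> join_dual k \<rho> D I J"
  have "x \<in> V <+> V" if "x \<in> S" for x
    using that S assms by (cases x) (auto simp: join_dual_def)
  then show "S \<in> Pow (V <+> V)" by auto
qed

text \<open>An element \<open>x\<close> in the closure of \<open>J\<close> is a loop after
  contracting \<open>J\<close>, hence a coloop of the dual: removing it from a spanning set that
  contains \<open>J\<close> leaves a spanning set.\<close>

lemma join_dual_cone:
  assumes q: "ordered_ground q V" and D: "D \<subseteq> Pow V" and I: "I \<subseteq> V"
    and x: "x \<in> I" "\<rho> (insert x J) = \<rho> J"
  shows "exact_at (sum_pos q) (V <+> V) (join_dual k \<rho> D I J) t"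
proof (rule ordered_ground.exact_at_cone[OF ordered_ground_sum[OF q] join_dual_subset[OF D I]])
  show "Inr x \<in> V <+> V" using x I by auto
  fix S assume S: "S \<in> join_dual k \<rho> D I J"
  let ?T = "(I - insert x (Inr -` S)) \<union> J"
  have "k \<le> \<rho> ((I - Inr -` S) \<union> J)" using S by (simp add: join_dual_def)
  also have "\<dots> \<le> \<rho> (insert x ?T)" by (rule mono) auto
  also have "\<dots> = \<rho> ?T" by (rule closure[OF x(2)]) auto
  finally show "insert (Inr x) S \<in> join_dual k \<rho> D I J"
    using S x by (simp add: join_dual_def)
qed

text \<open>If \<open>I \<union> J\<close> spans, the dual of the contraction by \<open>J\<close>
  has rank \<open>card I + \<rho> J - k\<close>; a matroid complex of rank r is exact below
  cardinality r, and these bounds add under joins. The inequality is kept in additive form to avoid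
  truncated subtraction.\<close>

lemma join_dual_exact:
  assumes q: "ordered_ground q V" and D: "D \<subseteq> Pow V"
    and ex: "\<And>t. t < a \<Longrightarrow> exact_at q V D t"
    and IJ: "I \<subseteq> V" "I \<inter> J = {}" and t: "t + k < a + card I + \<rho> J"
  shows "exact_at (sum_pos q) (V <+> V) (join_dual k \<rho> D I J) t"
proof -
  have finV: "finite V" using q by (simp add: ordered_ground_def)
  have "finite I" using IJ(1) finV finite_subset by blast
  then show ?thesis using IJ t
  proof (induction I arbitrary: J t)
    \<comment> \<open>Since \<open>\<rho> J \<le> k\<close>, what remains is \<open>t < a\<close>.
      The join is a copy of \<open>D\<close> if \<open>J\<close> spans, and otherwise has no simplex
      at all, not even the empty one.\<close>
    case empty
    then have "t < a" using le[of J] by simp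
    then have *: "exact_at (sum_pos q) (V <+> V) {S. Inl -` S \<in> D \<and> Inr -` S = {}} t"
      using exact_at_Inl[OF finV] ex by blast
    show ?case
    proof (cases "k \<le> \<rho> J")
      case True
      then have "join_dual k \<rho> D {} J = {S. Inl -` S \<in> D \<and> Inr -` S = {}}" by (auto simp: join_dual_def)
      then show ?thesis using * by simp
    next
      case False
      then have "join_dual k \<rho> D {} J = {}" by (auto simp: join_dual_def)
      then show ?thesis using exact_at_empty by metis
    qed
  next
    case (insert x I)
    let ?K = "join_dual k \<rho> D (insert x I) J"
    show ?case
    proof (cases "\<rho> (insert x J) = \<rho> J")
      case True
      show ?thesis by (rule join_dual_cone[OF q D insert.prems(1) _ True]) simp
    next
      case False
      then have \<rho>: "\<rho> (insert x J) = Suc (\<rho> J)"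
        using insert_le[of x J] mono[OF subset_insertI[of J x]] by linarith
      \<comment> \<open>Without \<open>Inr x\<close>, the element \<open>x\<close> always stays in
        the complement, so it moves to \<open>J\<close>; the rise of the rank pays for the smaller
        \<open>I\<close>.\<close>
      have del: "{S \<in> ?K. Inr x \<notin> S} = join_dual k \<rho> D I (insert x J)"
      proof -
        have "S \<in> ?K \<and> Inr x \<notin> S \<longleftrightarrow> S \<in> join_dual k \<rho> D I (insert x J)" for S
        proof (cases "Inr x \<in> S")
          case True
          then show ?thesis using insert.hyps(2) by (auto simp: join_dual_def)
        next
          case False
          then have "(insert x I - Inr -` S) \<union> J = (I - Inr -` S) \<union> insert x J"
            "Inr -` S \<subseteq> insert x I \<longleftrightarrow> Inr -` S \<subseteq> I" by auto
          then show ?thesis using False unfolding join_dual_def by simp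
        qed
        then show ?thesis by blast
      qed
      \<comment> \<open>In the link, \<open>x\<close> is already removed from the complement and
        disappears from the data; the loss in \<open>card I\<close> is matched by passing to
        \<open>t - 1\<close>.\<close>
      have link: "{S. Inr x \<notin> S \<and> insert (Inr x) S \<in> ?K} = join_dual k \<rho> D I J"
      proof -
        have "insert x I - insert x R = I - R" for R using insert.hyps(2) by auto
        then show ?thesis using insert.hyps(2) by (auto simp: join_dual_def)
      qed
      show ?thesis
      proof (rule ordered_ground.exact_at_link_deletion[OF ordered_ground_sum[OF q], where x="Inr x"])
        show "?K \<subseteq> Pow (V <+> V)" by (rule join_dual_subset[OF D insert.prems(1)])
        show "Inr x \<in> V <+> V" using insert.prems by auto
        show "S \<in> ?K" if "Inr x \<notin> S" "insert (Inr x) S \<in> ?K" for S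
          using that order_trans[OF _ mono, of k "(insert x I - Inr -` insert (Inr x) S) \<union> J" "(insert x I - Inr -` S) \<union> J"]
          by (auto simp: join_dual_def)
        show "exact_at (sum_pos q) (V <+> V) {S \<in> ?K. Inr x \<notin> S} t"
          unfolding del using insert.prems insert.hyps \<rho> by (intro insert.IH) auto
        show "exact_at (sum_pos q) (V <+> V) {S. Inr x \<notin> S \<and> insert (Inr x) S \<in> ?K} (t - 1)" if "t > 0"
          unfolding link using insert.prems insert.hyps that by (intro insert.IH) auto
      qed
    qed
  qed
qed

end

lemma rank_function_trank: "matroid V M \<Longrightarrow> rank_function (trank M k) k"
  by unfold_locales (auto intro: trank_le trank_mono trank_insert_le trank_closure)

section \<open>Graph vertices as rainbow simplices of the join\<close>

theorem RG_connected_if_exact: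
  assumes q: "ordered_ground q V" and C: "abstract_simplicial_complex V C" "{} \<in> C"
    and M: "matroid V M" and k: "k \<le> mrank M"
    and ex: "\<And>X t. X \<subseteq> V \<Longrightarrow> flat V M (V - X) \<Longrightarrow> mrank (restr M (V - X)) < k \<Longrightarrow>
       t + mrank (restr M (V - X)) < k + 1 \<Longrightarrow> exact_at q V (induced C X) t"
  shows "RG_connected C M k"
proof -
  let ?r = "trank M k" and ?col = "case_sum id id :: 'a + 'a \<Rightarrow> 'a" and ?W = "V <+> V"
  interpret rank_function ?r k by (rule rank_function_trank[OF M])
  interpret G: coloured_ground "sum_pos q" ?W q V ?col by (rule coloured_ground_sum[OF q])
  have CV: "C \<subseteq> Pow V" and Csub: "\<And>\<sigma> \<tau>. \<sigma> \<in> C \<Longrightarrow> \<tau> \<subseteq> \<sigma> \<Longrightarrow> \<tau> \<in> C"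
    using C by (auto simp: abstract_simplicial_complex_def)
  have MV: "M \<subseteq> Pow V" using M by (simp add: matroid_def)
  have "restr M V = M" using MV by (auto simp: restr_def)
  then have rV: "?r V = k" using k by (simp add: trank_eq_min[OF M])
  define K where "K = join_dual k ?r C V {}"
  have K: "K \<subseteq> Pow ?W" unfolding K_def by (rule join_dual_subset[OF CV]) simp
  have Ksub: "S' \<in> K" if "S \<in> K" "S' \<subseteq> S" for S S'
  proof -
    have "Inl -` S' \<subseteq> Inl -` S" "Inr -` S' \<subseteq> Inr -` S" using that by auto
    moreover have "?r (V - Inr -` S) \<le> ?r (V - Inr -` S')" using that by (intro mono) auto
    ultimately show ?thesis
      using that(1) Csub[of "Inl -` S" "Inl -` S'"] order_trans[of "Inr -` S'" "Inr -` S" V]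
        order_trans[of k "?r (V - Inr -` S)" "?r (V - Inr -` S')"]
      unfolding K_def join_dual_def by simp
  qed
  \<comment> \<open>No second copy outside \<open>I\<close> may be used, so all of
    \<open>V - I\<close> survives in the complement that has to span: restricting colours amounts to
    contracting \<open>V - I\<close>.\<close>
  have below: "below ?col K I = join_dual k ?r (induced C I) I (V - I)" if I: "I \<subseteq> V" for I
  proof -
    have 1: "?col ` S \<subseteq> I \<longleftrightarrow> Inl -` S \<subseteq> I \<and> Inr -` S \<subseteq> I" for S
    proof -
      have "?col ` S = Inl -` S \<union> Inr -` S"
      proof (intro equalityI subsetI)
        fix y assume "y \<in> ?col ` S"
        then obtain x where "x \<in> S" "y = ?col x" by auto
        then show "y \<in> Inl -` S \<union> Inr -` S" by (cases x) auto
      qed force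
      then show ?thesis by simp
    qed
    have "(I - Inr -` S) \<union> (V - I) = V - Inr -` S" if "Inr -` S \<subseteq> I" for S :: "('a + 'a) set"
      using that I by auto
    then show ?thesis using I unfolding below_def K_def join_dual_def induced_def 1 by auto
  qed
  have exK: "exact_at (sum_pos q) ?W (below ?col K I) t" if I: "I \<subseteq> V" "I \<noteq> {}" "t \<le> card I" for I t
  proof (cases "\<exists>x\<in>I. ?r (insert x (V - I)) = ?r (V - I)")
    case True
    then obtain x where x: "x \<in> I" "?r (insert x (V - I)) = ?r (V - I)" by blast
    have "induced C I \<subseteq> Pow V" using CV by (auto simp: induced_def)
    then show ?thesis unfolding below[OF I(1)] by (rule join_dual_cone[OF q _ I(1) x])
  next
    \<comment> \<open>No element of \<open>I\<close> lies in the truncated closure of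
      \<open>V - I\<close>. As \<open>I\<close> is nonempty, the truncated rank of
      \<open>V - I\<close> is below k, where it equals the rank in \<open>M\<close>; so
      \<open>V - I\<close> is a flat to which the hypothesis applies.\<close>
    case False
    have VI: "V - (V - I) = I" using I by auto
    have gt: "?r (V - I) < ?r (insert x (V - I))" if "x \<in> I" for x
      using False that mono[of "V - I" "insert x (V - I)"] by (metis le_neq_implies_less subset_insertI)
    obtain x0 where "x0 \<in> I" using I by auto
    then have lt: "?r (V - I) < k" using gt le order_less_le_trans by blast
    then have r: "?r (V - I) = mrank (restr M (V - I))" by (simp add: trank_eq_min[OF M] min_def split: if_splits)
    have "flat V M (V - I)"
      unfolding flat_def
    proof (intro conjI ballI)
      fix x assume "x \<in> V - (V - I)"
      then have "?r (V - I) < ?r (insert x (V - I))" using gt by blast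
      also have "\<dots> \<le> mrank (restr M (insert x (V - I)))" by (simp add: trank_eq_min[OF M])
      finally show "mrank (restr M (V - I)) < mrank (restr M (V - I \<union> {x}))" using r by simp
    qed auto
    then have e: "exact_at q V (induced C I) t" if "t < k + 1 - ?r (V - I)" for t
      using ex[OF I(1), of t] that r lt by auto
    \<comment> \<open>With \<open>a = k + 1 - r(V - I)\<close> the bound of
      \<open>join_dual_exact\<close> becomes exactly \<open>t \<le> card I\<close>.\<close>
    show ?thesis unfolding below[OF I(1)]
      by (rule join_dual_exact[OF q _ e I(1)])
        (use CV I lt in \<open>auto simp: induced_def\<close>)
  qed
  have col_bij: "Inr -` S = V - Inl -` S" if "G.rainbow S" for S
  proof -
    have b: "inj_on ?col S" "?col ` S = V" and S: "S \<subseteq> V <+> V" using that by (auto simp: G.rainbow_def bij_betw_def)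
    show ?thesis
    proof (intro equalityI subsetI)
      fix v assume "v \<in> Inr -` S"
      then show "v \<in> V - Inl -` S" using S inj_onD[OF b(1), of "Inl v" "Inr v"] by auto
    next
      fix v assume v: "v \<in> V - Inl -` S"
      then have "v \<in> ?col ` S" using b(2) by simp
      then obtain x where "v = ?col x" "x \<in> S" by (rule imageE)
      then show "v \<in> Inr -` S" using v by (cases x) auto
    qed
  qed
  have basis: "\<exists>B\<in>M. B \<subseteq> Inl -` S \<and> card B = k" if S: "G.rainbow S" "S \<in> K" for S
  proof -
    have "Inl -` S \<subseteq> V" using S K by auto
    then have "V - Inr -` S = Inl -` S" using col_bij[OF S(1)] by auto
    then have "k \<le> ?r (Inl -` S)" using S(2) by (simp add: K_def join_dual_def)
    then have "?r (Inl -` S) = k" using le[of "Inl -` S"] by simp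
    then show ?thesis using trank_witness[OF M, of "Inl -` S" k] by metis
  qed
  \<comment> \<open>The representative of a graph vertex \<open>A\<close>: it has no first copies
    beyond \<open>A\<close>, so \<open>A\<close> is the only independent set of size k among
    them.\<close>
  define E where "E A = Inl ` A \<union> Inr ` (V - A)" for A :: "'a set"
  have E: "G.rainbow (E A)" "Inl -` E A = A" "Inr -` E A = V - A" if "A \<subseteq> V" for A
  proof -
    show "Inl -` E A = A" "Inr -` E A = V - A" using that by (auto simp: E_def)
    have "inj_on ?col (E A)" by (auto simp: E_def inj_on_def)
    moreover have "?col ` E A = V" using that by (auto simp: E_def image_Un image_image)
    ultimately show "G.rainbow (E A)" using that by (auto simp: G.rainbow_def bij_betw_def E_def)
  qed
  have EK: "E A \<in> K" if "A \<in> RG_vertices C M k" for A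
  proof -
    have A: "A \<in> M" "card A = k" "A \<in> C" "A \<subseteq> V" using that MV by (auto simp: RG_vertices_def)
    moreover have "V - (V - A) = A" using A by auto
    ultimately show ?thesis using trank_ge[OF M A(1), of A k] by (simp add: K_def join_dual_def E)
  qed
  show ?thesis
    unfolding RG_connected_def
  proof (intro conjI ballI)
    have "{} \<in> K" using C(2) rV by (simp add: K_def join_dual_def)
    then obtain S where S: "S \<in> K" "G.rainbow S"
      using G.hall_nonempty[OF K _ _ E(1)[of V]] exK by (metis diff_le_self order_refl)
    then obtain B where "B \<in> M" "B \<subseteq> Inl -` S" "card B = k" using basis by blast
    moreover have "Inl -` S \<in> C" using S by (simp add: K_def join_dual_def)
    ultimately show "RG_vertices C M k \<noteq> {}" using Csub by (auto simp: RG_vertices_def)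
  next
    fix A B assume A: "A \<in> RG_vertices C M k" and B: "B \<in> RG_vertices C M k"
    \<comment> \<open>Recording one reachable basis per simplex is enough. Closedness holds because
      bases from two rainbow faces of \<open>T\<close> both lie in the simplex of \<open>C\<close>
      formed by the first copies in \<open>T\<close>, where \<open>bases_connected\<close>
      applies.\<close>
    define P where "P = {S. G.rainbow S \<and> S \<in> K \<and>
      (\<exists>B\<in>M. B \<subseteq> Inl -` S \<and> card B = k \<and> (RG_adj C M k)\<^sup>*\<^sup>* A B)}"
    have cc: "G.class_closed K P"
      unfolding G.class_closed_def
    proof (intro conjI ballI allI impI)
      fix T S S' assume T: "T \<in> K" and *: "S \<in> P \<and> G.rainbow S' \<and> S \<subseteq> T \<and> S' \<subseteq> T \<and> card T = Suc (card V)"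
      then obtain B1 where B1: "B1 \<in> M" "B1 \<subseteq> Inl -` S" "card B1 = k" "(RG_adj C M k)\<^sup>*\<^sup>* A B1"
        by (auto simp: P_def)
      have S': "S' \<in> K" using Ksub T * by blast
      then obtain B2 where B2: "B2 \<in> M" "B2 \<subseteq> Inl -` S'" "card B2 = k" using basis * by blast
      have TC: "Inl -` T \<in> C" using T by (simp add: K_def join_dual_def)
      have "Inl -` S \<subseteq> Inl -` T" "Inl -` S' \<subseteq> Inl -` T" using * by auto
      then have "B1 \<subseteq> Inl -` T" "B2 \<subseteq> Inl -` T" using B1(2) B2(2) by auto
      then have "(RG_adj C M k)\<^sup>*\<^sup>* B1 B2"
        by (intro bases_connected[OF M Csub[OF TC]] B1 B2)
      then have "(RG_adj C M k)\<^sup>*\<^sup>* A B2" using B1(4) by simp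
      then show "S' \<in> P" using B2 S' * unfolding P_def by blast
    qed (simp add: P_def)
    have AV: "A \<subseteq> V" "B \<subseteq> V" using A B MV by (auto simp: RG_vertices_def)
    have EA: "E A \<in> P"
      using A E[OF AV(1)] EK[OF A] by (auto simp: P_def RG_vertices_def)
    have "E B \<in> P"
    proof (rule G.hall_connected[OF K _ cc _ EA EK[OF A] EK[OF B] E(1)[OF AV(2)]])
      show "S' \<in> K" if "S \<in> K" "S' \<subseteq> S" for S S' using Ksub that .
      show "exact_at (sum_pos q) ?W (below ?col K I) (card I)" if "I \<subseteq> V" "I \<noteq> {}" for I
        using exK that by simp
    qed
    then obtain B' where "B' \<in> M" "B' \<subseteq> B" "card B' = k" "(RG_adj C M k)\<^sup>*\<^sup>* A B'"
      using E(2)[OF AV(2)] by (auto simp: P_def)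
    \<comment> \<open>The first copies in \<open>E B\<close> are just \<open>B\<close>, so the
      reachable basis found there has no choice but to be \<open>B\<close>.\<close>
    moreover have "B' = B"
      using calculation B matroid_indep_finite[OF M] by (intro card_subset_eq) (auto simp: RG_vertices_def)
    ultimately show "(RG_adj C M k)\<^sup>*\<^sup>* A B" by simp
  qed
qed

section \<open>Reduced rational homology\<close>

text \<open>On lists with distinct entries and an injective \<open>q\<close> this is -1 to the
  number of inversions, the sign of the sorting permutation.\<close>

primrec list_sgn :: "('a \<Rightarrow> nat) \<Rightarrow> 'a list \<Rightarrow> rat" where
  "list_sgn q [] = 1"
| "list_sgn q (x # xs) = sgn_at q x (set xs) * list_sgn q xs"

lemma list_sgn_square: "list_sgn q xs * list_sgn q xs = 1"
  by (induction xs) (auto simp: algebra_simps sgn_at_square mult.assoc[symmetric])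

text \<open>Adjacent transpositions generate all rearrangements. The fixed multiset \<open>m\<close>
  limits the swap hypothesis to rearrangements of one list, and the prefix \<open>P\<close> carries
  the induction.\<close>

lemma perm_invariant:
  assumes swap: "\<And>P a b R. mset (P @ a # b # R) = m \<Longrightarrow> F (P @ a # b # R) = F (P @ b # a # R)"
    and "mset (P @ xs) = m" "mset xs = mset ys"
  shows "F (P @ xs) = F (P @ ys)"
  using assms(2,3)
proof (induction xs arbitrary: P ys)
  case Nil
  then show ?case by simp
next
  case (Cons x xs)
  have front: "F (P @ A @ x # B) = F (P @ x # A @ B)" if "mset (P @ A @ x # B) = m" for A B
    using that
  proof (induction A arbitrary: B rule: rev_induct)
    case Nil
    then show ?case by simp
  next
    case (snoc a A)
    have "F ((P @ A) @ a # x # B) = F ((P @ A) @ x # a # B)"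
    proof (rule swap)
      have "mset ((P @ A) @ a # x # B) = mset (P @ (A @ [a]) @ x # B)" by simp
      then show "mset ((P @ A) @ a # x # B) = m" using snoc.prems by (rule trans)
    qed
    moreover have "F (P @ A @ x # a # B) = F (P @ x # A @ a # B)"
    proof (rule snoc.IH)
      have "mset (P @ A @ x # a # B) = mset (P @ (A @ [a]) @ x # B)" by (simp add: add_mset_commute)
      then show "mset (P @ A @ x # a # B) = m" using snoc.prems by (rule trans)
    qed
    ultimately show ?case by simp
  qed
  have "x \<in> set ys" using Cons.prems(2) by (metis list.set_intros(1) mset_eq_setD)
  then obtain A B where ys: "ys = A @ x # B" by (meson split_list)
  have "F ((P @ [x]) @ xs) = F ((P @ [x]) @ A @ B)"
    by (rule Cons.IH) (use Cons.prems ys in auto)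
  moreover have "F (P @ A @ x # B) = F (P @ x # A @ B)"
    by (rule front) (use Cons.prems ys in auto)
  ultimately show ?case using ys by simp
qed

context ordered_ground
begin

lemma list_sgn_swap:
  assumes "distinct (P @ a # b # R)" "set (P @ a # b # R) \<subseteq> W"
  shows "list_sgn p (P @ b # a # R) = - list_sgn p (P @ a # b # R)"
  using assms
proof (induction P)
  case Nil
  then have "sgn_at p b (set R) * sgn_at p a (insert b (set R)) =
      - (sgn_at p a (set R) * sgn_at p b (insert a (set R)))"
    by (intro sgn_at_anticommute) auto
  then show ?case by (simp add: ac_simps)
next
  case (Cons x P)
  then show ?case by (simp add: insert_commute)
qed

text \<open>A set chain \<open>z\<close> corresponds to the alternating function
  \<open>list_sgn p xs * z (set xs)\<close>; conversely, an alternating function is determined by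
  its value on one enumeration of each set. The index \<open>int t - 1\<close> converts cardinality
  into dimension.\<close>

lemma exact_at_of_reduced_homology:
  assumes C: "C \<subseteq> Pow W" and van: "reduced_rat_homology_vanishes C (int t - 1)"
  shows "exact_at p W C t"
  unfolding exact_at_def
proof (intro ballI impI)
  fix z assume z: "z \<in> set_chains C t" "bdry p W z = (\<lambda>_. 0)"
  have zW: "S \<subseteq> W" if "z S \<noteq> 0" for S using set_chainsD(1)[OF z(1) that] C by blast
  have UC: "\<Union>C \<subseteq> W" "finite (\<Union>C)" using C fin finite_subset[of "\<Union>C" W] by auto
  define c where "c xs = (if distinct xs then list_sgn p xs * z (set xs) else 0)" for xs
  have c0: "c xs = 0" if "\<not> (distinct xs \<and> z (set xs) \<noteq> 0)" for xs using that by (auto simp: c_def)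
  have sw: "xs[i := xs ! Suc i, Suc i := xs ! i] = P @ b # a # R" 
    if "Suc i < length xs" "xs = P @ a # b # R" "length P = i" for xs :: "'b list" and P a b R i
    using that by (auto simp: list_update_append nth_append)
  have split: "\<exists>P a b R. xs = P @ a # b # R \<and> length P = i" if "Suc i < length xs" for xs :: "'b list" and i
    using that id_take_nth_drop[of i xs] Cons_nth_drop_Suc[of "Suc i" xs]
    by (intro exI[of _ "take i xs"] exI[of _ "xs ! i"] exI[of _ "xs ! Suc i"] exI[of _ "drop (Suc (Suc i)) xs"]) auto
  have "c \<in> chains C (int t - 1)"
    unfolding chains_def
  proof (intro CollectI conjI allI impI)
    fix xs assume "c xs \<noteq> 0"
    then have xs: "distinct xs" "z (set xs) \<noteq> 0" by (auto simp: c_def split: if_splits)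
    then show "distinct xs" by simp
    show "xs = [] \<or> set xs \<in> C" using set_chainsD(1)[OF z(1) xs(2)] by simp
    show "int (length xs) = int t - 1 + 1"
      using set_chainsD(2)[OF z(1) xs(2)] distinct_card[OF xs(1)] by simp
  next
    fix xs :: "'b list" and i assume i: "Suc i < length xs"
    then obtain P a b R where xs: "xs = P @ a # b # R" "length P = i" using split by blast
    have "c (P @ b # a # R) = - c (P @ a # b # R)"
    proof (cases "distinct (P @ a # b # R) \<and> z (set (P @ a # b # R)) \<noteq> 0")
      case True
      then have "list_sgn p (P @ b # a # R) = - list_sgn p (P @ a # b # R)"
        using zW by (intro list_sgn_swap) auto
      moreover have "set (P @ b # a # R) = set (P @ a # b # R)"
        "distinct (P @ b # a # R) \<longleftrightarrow> distinct (P @ a # b # R)" by auto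
      ultimately show ?thesis unfolding c_def by simp
    next
      case False
      moreover have "set (P @ b # a # R) = set (P @ a # b # R)"
        "distinct (P @ b # a # R) \<longleftrightarrow> distinct (P @ a # b # R)" by auto
      ultimately have "\<not> (distinct (P @ b # a # R) \<and> z (set (P @ b # a # R)) \<noteq> 0)" by argo
      then have "c (P @ b # a # R) = 0" by (rule c0)
      then show ?thesis using c0[OF False] by simp
    qed
    then show "c (xs[i := xs ! Suc i, Suc i := xs ! i]) = - c xs"
      using sw[OF i xs] xs(1) by simp
  qed
  moreover have "bd C c = (\<lambda>_. 0)"
  proof
    fix ws
    show "bd C c ws = 0"
    proof (cases "distinct ws")
      case True
      have "bd C c ws = (\<Sum>v\<in>W - set ws. list_sgn p ws * (sgn_at p v (set ws) * z (insert v (set ws))))"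
        unfolding bd_def
      proof (rule sum.mono_neutral_cong)
        show "c (v # ws) = 0" if "v \<in> \<Union>C - (W - set ws)" for v
          using that UC by (auto simp: c_def)
        show "list_sgn p ws * (sgn_at p v (set ws) * z (insert v (set ws))) = 0" if "v \<in> (W - set ws) - \<Union>C" for v
          using that set_chainsD(1)[OF z(1), of "insert v (set ws)"] by auto
      qed (use fin UC True in \<open>auto simp: c_def\<close>)
      also have "\<dots> = list_sgn p ws * bdry p W z (set ws)"
        by (simp add: bdry_def sum_distrib_left)
      finally show ?thesis using z(2) by simp
    qed (simp add: bd_def c_def)
  qed
  ultimately obtain d where d: "d \<in> chains C (int t - 1 + 1)" "bd C d = c"
    using van unfolding reduced_rat_homology_vanishes_def by blast
  have dsupp: "length xs = Suc t" "distinct xs" "set xs \<in> C" if "d xs \<noteq> 0" for xs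
    using d(1) that unfolding chains_def by fastforce+
  have dswap: "d (P @ b # a # R) = - d (P @ a # b # R)" for P a b R
  proof -
    have "\<forall>xs i. Suc i < length xs \<longrightarrow> d (xs[i := xs ! Suc i, Suc i := xs ! i]) = - d xs"
      using d(1) unfolding chains_def by blast
    moreover have "Suc (length P) < length (P @ a # b # R)" by simp
    ultimately have "d ((P @ a # b # R)[length P := (P @ a # b # R) ! Suc (length P),
        Suc (length P) := (P @ a # b # R) ! length P]) = - d (P @ a # b # R)" by blast
    then show ?thesis using sw[of "length P" "P @ a # b # R" P a b R] by simp
  qed
  have inv: "list_sgn p xs * d xs = list_sgn p ys * d ys"
    if "distinct xs" "distinct ys" "set xs = set ys" "set xs \<subseteq> W" for xs ys
  proof -
    have "list_sgn p ([] @ xs) * d ([] @ xs) = list_sgn p ([] @ ys) * d ([] @ ys)"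
    proof (rule perm_invariant[where m="mset xs" and F="\<lambda>xs. list_sgn p xs * d xs"])
      fix P a b R assume m: "mset (P @ a # b # R) = mset xs"
      then have "distinct (P @ a # b # R)" "set (P @ a # b # R) \<subseteq> W"
        using that mset_eq_imp_distinct_iff[OF m] mset_eq_setD[OF m] by blast+
      then show "list_sgn p (P @ a # b # R) * d (P @ a # b # R) = list_sgn p (P @ b # a # R) * d (P @ b # a # R)"
        using dswap[of P b a R] by (simp only: list_sgn_swap mult_minus_left mult_minus_right minus_minus)
    qed (use that set_eq_iff_mset_eq_distinct in auto)
    then show ?thesis by simp
  qed
  \<comment> \<open>Any enumeration will do, since \<open>inv\<close> makes the signed value
    independent of it.\<close>
  define l where "l S = (SOME xs. distinct xs \<and> set xs = S)" for S :: "'b set"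
  have l: "distinct (l S)" "set (l S) = S" if "finite S" for S
    using someI_ex[of "\<lambda>xs. distinct xs \<and> set xs = S"] finite_distinct_list[OF that] unfolding l_def by blast+
  define w where "w S = (if finite S then list_sgn p (l S) * d (l S) else 0)" for S
  have wC: "w \<in> set_chains C (Suc t)"
    unfolding set_chains_def
  proof (intro CollectI allI impI)
    fix S assume "w S \<noteq> 0"
    then have S: "finite S" "d (l S) \<noteq> 0" unfolding w_def by (presburger, metis mult_zero_right)
    have "set (l S) = S" by (rule l(2)[OF S(1)])
    moreover have "card (set (l S)) = Suc t"
      using distinct_card[OF dsupp(2)[OF S(2)]] dsupp(1)[OF S(2)] by (rule trans)
    ultimately show "S \<in> C \<and> card S = Suc t" using dsupp(3)[OF S(2)] by simp
  qed
  have "bdry p W w S = z S" for S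
  proof (cases "S \<subseteq> W")
    case False
    have "w (insert v S) = 0" for v
      using set_chainsD(1)[OF wC, of "insert v S"] C False by blast
    moreover have "z S = 0" using zW False by blast
    ultimately show ?thesis by (simp add: bdry_def)
  next
    case True
    then have fS: "finite S" using fin finite_subset by blast
    note lS = l[OF fS]
    have "bdry p W w S = (\<Sum>v\<in>\<Union>C. list_sgn p (l S) * d (v # l S))"
      unfolding bdry_def
    proof (rule sum.mono_neutral_cong)
      show "sgn_at p v S * w (insert v S) = 0" if "v \<in> (W - S) - \<Union>C" for v
        using that set_chainsD(1)[OF wC, of "insert v S"] by auto
      show "list_sgn p (l S) * d (v # l S) = 0" if "v \<in> \<Union>C - (W - S)" for v
        using that dsupp(2)[of "v # l S"] lS UC by auto
      show "sgn_at p v S * w (insert v S) = list_sgn p (l S) * d (v # l S)" if "v \<in> (W - S) \<inter> \<Union>C" for v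
      proof -
        have "w (insert v S) = list_sgn p (v # l S) * d (v # l S)"
          unfolding w_def using fS that l[of "insert v S"] lS True
          by (simp del: list_sgn.simps) (rule inv, auto)
        then show ?thesis using lS sgn_at_square[of p v S] by (simp add: mult.assoc[symmetric])
      qed
    qed (use fin UC in auto)
    also have "\<dots> = list_sgn p (l S) * c (l S)"
      unfolding d(2)[symmetric] bd_def by (simp add: sum_distrib_left)
    also have "\<dots> = z S" using lS list_sgn_square[of p "l S"] by (simp add: c_def mult.assoc[symmetric])
    finally show ?thesis .
  qed
  then show "\<exists>d\<in>set_chains C (Suc t). bdry p W d = z" using wC by blast
qed

end

text \<open>The chain group in degree -1 contains the empty tuple even when the complex has no
  simplex, but then there is no vertex to bound it.\<close>

lemma not_reduced_rat_homology_vanishes_void: "\<not> reduced_rat_homology_vanishes {} (- 1)"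
proof
  assume v: "reduced_rat_homology_vanishes ({} :: 'a set set) (- 1)"
  let ?c = "\<lambda>xs :: 'a list. if xs = [] then 1 else 0 :: rat"
  have "?c \<in> chains {} (- 1)" by (auto simp: chains_def)
  then obtain d where "bd {} d = ?c" using v unfolding reduced_rat_homology_vanishes_def by blast
  then have "bd {} d [] = 1" by simp
  then show False by (simp add: bd_def)
qed

section \<open>From the connectivity parameters to exactness\<close>

text \<open>A failure in degree \<open>t - 1\<close> caps every admissible \<open>k\<close> at
  \<open>t - 2\<close>, and adding 2 gives at most \<open>t\<close>. Infinite values need no
  separate case.\<close>

lemma eta_of_ge:
  assumes "enat (Suc t) \<le> eta_of P"
  shows "P (int t - 1)"
proof (rule ccontr)
  assume n: "\<not> P (int t - 1)"
  have "eta_of P \<le> enat t"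
    unfolding eta_of_def
  proof (rule Sup_least)
    fix x assume "x \<in> {enat (nat (k + 2)) | k. k \<ge> -2 \<and> (\<forall>j. -1 \<le> j \<and> j \<le> k \<longrightarrow> P j)}"
    then obtain k where k: "x = enat (nat (k + 2))" "k \<ge> -2" "\<forall>j. -1 \<le> j \<and> j \<le> k \<longrightarrow> P j" by blast
    then have "k < int t - 1" using k(3)[rule_format, of "int t - 1"] n by linarith
    then show "x \<le> enat t" using k(1) by simp
  qed
  then show False using assms by (metis Suc_ile_eq enat_ord_simps(2) leD)
qed

theorem RG_connected_if_eta:
  fixes eta :: "'a set set \<Rightarrow> enat"
  assumes q: "ordered_ground q V" and C: "abstract_simplicial_complex V C" and M: "matroid V M"
    and k: "1 \<le> k" "k \<le> mrank M"
    and eta: "\<forall>X. X \<subseteq> V \<and> flat V M (V - X) \<and> mrank (restr M (V - X)) \<le> k - 1 \<longrightarrow>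
           eta (induced C X) + enat (mrank (restr M (V - X))) \<ge> enat (k + 1)"
    and ex: "\<And>X t. X \<subseteq> V \<Longrightarrow> enat (Suc t) \<le> eta (induced C X) \<Longrightarrow> exact_at q V (induced C X) t"
    and ne: "\<And>X. enat 1 \<le> eta (induced C X) \<Longrightarrow> induced C X \<noteq> {}"
  shows "RG_connected C M k"
proof (rule RG_connected_if_exact[OF q C _ M k(2)])
  have ge: "enat (Suc t) \<le> eta (induced C X)"
    if "X \<subseteq> V" "flat V M (V - X)" "mrank (restr M (V - X)) < k" "t + mrank (restr M (V - X)) < k + 1" for X t
  proof -
    have "enat (k + 1) \<le> eta (induced C X) + enat (mrank (restr M (V - X)))" using eta that by auto
    then show ?thesis using that(4) by (cases "eta (induced C X)") auto
  qed
  then show "exact_at q V (induced C X) t"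
    if "X \<subseteq> V" "flat V M (V - X)" "mrank (restr M (V - X)) < k" "t + mrank (restr M (V - X)) < k + 1" for X t
    using ex that by blast
  \<comment> \<open>The loops form a flat of rank 0. At this flat the hypothesis makes
    \<open>eta\<close> positive, which rules out a complex without simplices and so puts the empty
    set into \<open>C\<close>.\<close>
  define F where "F = {x \<in> V. {x} \<notin> M}"
  have F0: "mrank (restr M F) = 0"
  proof -
    obtain A where A: "A \<in> M" "A \<subseteq> F" "card A = mrank (restr M F)" by (rule mrank_restr_witness[OF M])
    have "A = {}" using A(1,2) matroid_subset[OF M A(1)] by (auto simp: F_def)
    then show ?thesis using A(3) by simp
  qed
  have "flat V M F"
    unfolding flat_def
  proof (intro conjI ballI)
    fix x assume "x \<in> V - F"
    then have "{x} \<in> M" by (auto simp: F_def)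
    then show "mrank (restr M F) < mrank (restr M (F \<union> {x}))"
      using mrank_restr_ge[OF M, of "{x}" "F \<union> {x}"] F0 by simp
  qed (auto simp: F_def)
  moreover have "V - (V - F) = F" by (auto simp: F_def)
  ultimately have "enat (Suc 0) \<le> eta (induced C (V - F))"
    using ge[of "V - F" 0] F0 k by simp
  then have "induced C (V - F) \<noteq> {}" using ne by simp
  then show "{} \<in> C" using C by (auto simp: induced_def abstract_simplicial_complex_def)
qed

lemma exact_at_of_eta_H:
  assumes "ordered_ground q V" "D \<subseteq> Pow V" "enat (Suc t) \<le> eta_H D"
  shows "exact_at q V D t"
  using assms eta_of_ge unfolding eta_H_def by (intro ordered_ground.exact_at_of_reduced_homology) auto

lemma eta_H_nonempty: "enat 1 \<le> eta_H D \<Longrightarrow> D \<noteq> {}"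
  using eta_of_ge[of 0] not_reduced_rat_homology_vanishes_void unfolding eta_H_def by fastforce

section \<open>Spheres, simplices and singular cones\<close>

definition simplex_boundary :: "nat \<Rightarrow> (nat \<Rightarrow> real) set" where
  "simplex_boundary m = {x \<in> standard_simplex m. \<exists>i\<le>m. x i = 0}"

abbreviation simplex_top :: "nat \<Rightarrow> (nat \<Rightarrow> real) topology" where
  "simplex_top m \<equiv> subtopology (powertop_real UNIV) (standard_simplex m)"

abbreviation boundary_top :: "nat \<Rightarrow> (nat \<Rightarrow> real) topology" where
  "boundary_top m \<equiv> subtopology (powertop_real UNIV) (simplex_boundary m)"

lemma standard_simplexI:
  assumes "\<And>i. i \<le> m \<Longrightarrow> 0 \<le> x i" "\<And>i. i > m \<Longrightarrow> x i = 0" "(\<Sum>i\<le>m. x i) = 1"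
  shows "x \<in> standard_simplex m"
proof -
  have 0: "0 \<le> x i" for i using assms(1,2) by (cases "i \<le> m") auto
  have "x i \<le> 1" for i
  proof (cases "i \<le> m")
    case True
    then have "x i \<le> (\<Sum>i\<le>m. x i)" using 0 by (intro member_le_sum) auto
    then show ?thesis using assms(3) by simp
  qed (use assms(2) in simp)
  then show ?thesis using 0 assms(2,3) by (simp add: standard_simplex_def)
qed

lemma standard_simplexD:
  assumes "x \<in> standard_simplex m"
  shows "0 \<le> x i" "i > m \<Longrightarrow> x i = 0" "(\<Sum>i\<le>m. x i) = 1"
  using assms by (auto simp: standard_simplex_def)

lemma compactin_simplex_boundary: "compactin (powertop_real UNIV) (simplex_boundary m)"
proof (rule closed_compactin[OF compactin_standard_simplex[of m]])
  show "simplex_boundary m \<subseteq> standard_simplex m" by (auto simp: simplex_boundary_def)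
  have eq: "simplex_boundary m = standard_simplex m \<inter> (\<Union>i\<in>{..m}. {x \<in> topspace (powertop_real UNIV). x i \<in> {0}})"
    by (auto simp: simplex_boundary_def)
  have cl: "closedin (powertop_real UNIV) (\<Union>i\<in>{..m}. {x \<in> topspace (powertop_real UNIV). (x i :: real) \<in> {0}})"
  proof (intro closedin_Union)
    fix T assume "T \<in> (\<lambda>i. {x \<in> topspace (powertop_real UNIV). (x i :: real) \<in> {0}}) ` {..m}"
    then obtain i where T: "T = {x \<in> topspace (powertop_real UNIV). (x i :: real) \<in> {0}}" by blast
    show "closedin (powertop_real UNIV) T"
      unfolding T by (rule closedin_continuous_map_preimage[where Y=euclideanreal])
        (auto intro: continuous_map_product_projection)
  qed simp
  show "closedin (powertop_real UNIV) (simplex_boundary m)"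
    unfolding eq by (rule closedin_Int[OF closedin_standard_simplex cl])
qed

text \<open>Such a map is closed, hence a quotient map. This is what lets maps descend from the
  boundary to the sphere and from the cylinder to the simplex.\<close>

lemma compact_quotient:
  assumes "compact_space X" "Hausdorff_space Y" "continuous_map X Y f" "f ` topspace X = topspace Y"
  shows "quotient_map X Y f"
  using assms by (intro continuous_closed_imp_quotient_map continuous_imp_closed_map_gen Hausdorff_imp_kc_space)

lemma Hausdorff_powertop: "Hausdorff_space (subtopology (powertop_real UNIV) S)"
  by (intro Hausdorff_space_subtopology) (simp add: Hausdorff_space_product_topology)

text \<open>Radial projection from the barycentre, followed by forgetting the last coordinate.\<close>

definition sphere_proj :: "nat \<Rightarrow> (nat \<Rightarrow> real) \<Rightarrow> nat \<Rightarrow> real" where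
  "sphere_proj n y = (\<lambda>i. if i \<le> n then (y i - 1 / (real n + 2)) / sqrt (\<Sum>i\<le>n. (y i - 1 / (real n + 2))\<^sup>2) else 0)"

text \<open>\<open>1 / (real n + 2)\<close> is the barycentric coordinate of the centre of a simplex
  with \<open>n + 2\<close> vertices. If the first \<open>n + 1\<close> coordinates had this value,
  so would the last, and no coordinate would vanish.\<close>

lemma sphere_proj_norm_pos:
  assumes "y \<in> simplex_boundary (Suc n)"
  shows "(\<Sum>i\<le>n. (y i - 1 / (real n + 2))\<^sup>2) > 0"
proof (rule ccontr)
  assume "\<not> ?thesis"
  then have "(\<Sum>i\<le>n. (y i - 1 / (real n + 2))\<^sup>2) = 0"
    using sum_nonneg[of "{..n}" "\<lambda>i. (y i - 1 / (real n + 2))\<^sup>2"] by auto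
  then have y: "y i = 1 / (real n + 2)" if "i \<le> n" for i
    using that by (subst (asm) sum_nonneg_eq_0_iff) auto
  have "(\<Sum>i\<le>Suc n. y i) = 1" using assms by (auto simp: simplex_boundary_def dest: standard_simplexD)
  then have "(real n + 1) * (1 / (real n + 2)) + y (Suc n) = 1" using y by (simp add: add.commute)
  then have "y (Suc n) = 1 / (real n + 2)" by (simp add: field_simps)
  then have "y i = 1 / (real n + 2)" if "i \<le> Suc n" for i using y that by (cases "i = Suc n") auto
  then have "y i \<noteq> 0" if "i \<le> Suc n" for i using that by simp
  then show False using assms by (auto simp: simplex_boundary_def)
qed

lemma sphere_proj_continuous: "continuous_map (boundary_top (Suc n)) (nsphere n) (sphere_proj n)"
proof -
  let ?c = "1 / (real n + 2)"
  have pr: "continuous_map (boundary_top (Suc n)) euclideanreal (\<lambda>y. y i)" for i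
    by (intro continuous_map_from_subtopology continuous_map_product_projection) auto
  have "continuous_map (boundary_top (Suc n)) euclideanreal (\<lambda>y. sphere_proj n y i)" for i
  proof (cases "i \<le> n")
    case True
    have "continuous_map (boundary_top (Suc n)) euclideanreal (\<lambda>y. (y i - ?c) / sqrt (\<Sum>i\<le>n. (y i - ?c)\<^sup>2))"
    proof (intro continuous_map_real_divide continuous_map_diff pr)
      show "continuous_map (boundary_top (Suc n)) euclideanreal (\<lambda>y. sqrt (\<Sum>i\<le>n. (y i - ?c)\<^sup>2))"
        by (intro continuous_map_sqrt continuous_map_sum continuous_map_real_pow continuous_map_diff pr) auto
      show "sqrt (\<Sum>i\<le>n. (y i - ?c)\<^sup>2) \<noteq> 0" if "y \<in> topspace (boundary_top (Suc n))" for y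
        using sphere_proj_norm_pos[of y n] that by auto
    qed auto
    then show ?thesis using True by (simp add: sphere_proj_def)
  qed (simp add: sphere_proj_def)
  moreover have "(\<Sum>i\<le>n. (sphere_proj n y i)\<^sup>2) = 1" if "y \<in> simplex_boundary (Suc n)" for y
    using sphere_proj_norm_pos[OF that]
    by (simp add: sphere_proj_def power_divide sum_divide_distrib[symmetric])
  ultimately show ?thesis
    unfolding nsphere continuous_map_in_subtopology continuous_map_componentwise_UNIV
    by (auto simp: sphere_proj_def)
qed

text \<open>Equal images mean \<open>y - c = l * (z - c)\<close>, in the forgotten coordinate too
  because the differences sum to 0. A zero coordinate of \<open>z\<close> gives
  \<open>l \<le> 1\<close>, and one of \<open>y\<close> gives \<open>l \<ge> 1\<close>.\<close>

lemma sphere_proj_inj: "inj_on (sphere_proj n) (simplex_boundary (Suc n))"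
proof (rule inj_onI)
  fix y z assume y: "y \<in> simplex_boundary (Suc n)" and z: "z \<in> simplex_boundary (Suc n)"
    and eq: "sphere_proj n y = sphere_proj n z"
  define c where "c = 1 / (real n + 2)"
  have c: "c > 0" "(real n + 2) * c = 1" by (simp_all add: c_def)
  define \<nu> where "\<nu> x = sqrt (\<Sum>i\<le>n. (x i - c)\<^sup>2)" for x :: "nat \<Rightarrow> real"
  have pos: "\<nu> y > 0" "\<nu> z > 0" using sphere_proj_norm_pos[OF y] sphere_proj_norm_pos[OF z] by (simp_all add: \<nu>_def c_def)
  define l where "l = \<nu> y / \<nu> z"
  have lpos: "l > 0" using pos by (simp add: l_def)
  have 1: "y i - c = l * (z i - c)" if "i \<le> n" for i
  proof -
    have "(y i - c) / \<nu> y = (z i - c) / \<nu> z"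
      using fun_cong[OF eq, of i] that by (simp add: sphere_proj_def \<nu>_def c_def)
    then show ?thesis using pos by (simp add: l_def field_simps)
  qed
  have s: "(\<Sum>i\<le>Suc n. x i - c) = 0" if "x \<in> simplex_boundary (Suc n)" for x
  proof -
    have "(\<Sum>i\<le>Suc n. x i) = 1" using that by (auto simp: simplex_boundary_def dest: standard_simplexD)
    then show ?thesis using c(2) by (simp add: sum_subtractf algebra_simps)
  qed
  have "y (Suc n) - c = l * (z (Suc n) - c)"
  proof -
    have "y (Suc n) - c = - (\<Sum>i\<le>n. y i - c)" using s[OF y] by simp
    also have "\<dots> = - (\<Sum>i\<le>n. l * (z i - c))" using 1 by simp
    also have "\<dots> = l * (- (\<Sum>i\<le>n. z i - c))" by (simp add: sum_distrib_left)
    also have "- (\<Sum>i\<le>n. z i - c) = z (Suc n) - c" using s[OF z] by simp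
    finally show ?thesis .
  qed
  then have 2: "y i - c = l * (z i - c)" if "i \<le> Suc n" for i
    using 1 that by (cases "i = Suc n") auto
  obtain i j where ij: "i \<le> Suc n" "y i = 0" "j \<le> Suc n" "z j = 0" using y z by (auto simp: simplex_boundary_def)
  have ge: "0 \<le> y i" "0 \<le> z i" for i using y z by (auto simp: simplex_boundary_def dest: standard_simplexD)
  have "c - l * c \<ge> 0" using 2[OF ij(3)] ij(4) ge(1)[of j] by (simp add: algebra_simps)
  then have "l * c \<le> 1 * c" by simp
  then have "l \<le> 1" using c(1) by (rule mult_right_le_imp_le)
  moreover have "l * z i = l * c - 1 * c" using 2[OF ij(1)] ij(2) by (simp add: algebra_simps)
  then have "1 * c \<le> l * c" using ge(2)[of i] lpos by (metis diff_ge_0_iff_ge mult_nonneg_nonneg less_imp_le)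
  then have "1 \<le> l" using c(1) by (rule mult_right_le_imp_le)
  ultimately have "l = 1" by simp
  then have "y i = z i" if "i \<le> Suc n" for i using 2[OF that] by simp
  moreover have "y i = z i" if "i > Suc n" for i
    using that y z standard_simplexD(2)[of y "Suc n" i] standard_simplexD(2)[of z "Suc n" i]
    by (auto simp: simplex_boundary_def)
  ultimately show "y = z" by (metis ext not_le)
qed

lemma sphere_proj_surj: "sphere_proj n ` simplex_boundary (Suc n) = topspace (nsphere n)"
proof
  show "sphere_proj n ` simplex_boundary (Suc n) \<subseteq> topspace (nsphere n)"
    using continuous_map_image_subset_topspace[OF sphere_proj_continuous[of n]] by simp
  show "topspace (nsphere n) \<subseteq> sphere_proj n ` simplex_boundary (Suc n)"
  proof
    fix x assume "x \<in> topspace (nsphere n)"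
    then have x: "(\<Sum>i\<le>n. (x i)\<^sup>2) = 1" "\<And>i. i > n \<Longrightarrow> x i = 0" by (auto simp: nsphere)
    define c where "c = 1 / (real n + 2)"
    have c: "c > 0" "(real n + 2) * c = 1" by (simp_all add: c_def)
    \<comment> \<open>The forgotten last coordinate is recovered from the condition that
      displacements from the barycentre sum to 0.\<close>
    define xh where "xh i = (if i \<le> n then x i else if i = Suc n then - (\<Sum>i\<le>n. x i) else 0)" for i
    have xh0: "(\<Sum>i\<le>Suc n. xh i) = 0" by (simp add: xh_def)
    obtain k where k: "k \<le> Suc n" "\<And>i. i \<le> Suc n \<Longrightarrow> xh k \<le> xh i"
    proof -
      have "finite (xh ` {..Suc n})" "xh ` {..Suc n} \<noteq> {}" by auto
      then have "Min (xh ` {..Suc n}) \<in> xh ` {..Suc n}" "\<And>i. i \<le> Suc n \<Longrightarrow> Min (xh ` {..Suc n}) \<le> xh i"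
        by (auto intro: Min_in Min_le)
      then show ?thesis using that by (metis atMost_iff imageE)
    qed
    define \<mu> where "\<mu> = - xh k"
    have \<mu>: "\<mu> > 0"
    proof (rule ccontr)
      assume "\<not> ?thesis"
      then have "0 \<le> xh i" if "i \<le> Suc n" for i using k(2)[OF that] by (simp add: \<mu>_def)
      then have "xh i = 0" if "i \<le> Suc n" for i
        using xh0 that sum_nonneg_eq_0_iff[of "{..Suc n}" xh] by auto
      then have "x i = 0" if "i \<le> n" for i using that by (metis xh_def le_SucI)
      then show False using x(1) by simp
    qed
    \<comment> \<open>The ray in direction \<open>xh\<close> leaves the simplex when its least
      coordinate, \<open>c - \<mu> * s\<close> at scale \<open>s\<close>, reaches 0; this fixes the
      scale \<open>c / \<mu>\<close>.\<close>
    define y where "y i = (if i \<le> Suc n then c + xh i * (c / \<mu>) else 0)" for i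
    have "y \<in> standard_simplex (Suc n)"
    proof (rule standard_simplexI)
      fix i assume i: "i \<le> Suc n"
      have "0 \<le> c / \<mu>" using c(1) \<mu> by simp
      moreover have "- \<mu> \<le> xh i" using k(2)[OF i] by (simp add: \<mu>_def)
      ultimately have "- \<mu> * (c / \<mu>) \<le> xh i * (c / \<mu>)" by (rule mult_right_mono[rotated])
      then show "0 \<le> y i" using i \<mu> by (simp add: y_def)
    next
      have "(\<Sum>i\<le>Suc n. y i) = (\<Sum>i\<le>Suc n. c + xh i * (c / \<mu>))" by (intro sum.cong) (auto simp: y_def)
      also have "\<dots> = (real n + 2) * c + (\<Sum>i\<le>Suc n. xh i) * (c / \<mu>)"
        by (simp only: sum.distrib sum_distrib_right[symmetric]) (simp add: distrib_right)
      finally show "(\<Sum>i\<le>Suc n. y i) = 1" using xh0 c(2) by simp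
    qed (simp add: y_def)
    moreover have "y k = 0" using k(1) \<mu> by (simp add: y_def) (simp add: \<mu>_def)
    ultimately have yB: "y \<in> simplex_boundary (Suc n)" using k(1) by (auto simp: simplex_boundary_def)
    have yi: "y i - c = x i * (c / \<mu>)" if "i \<le> n" for i using that by (simp add: y_def xh_def)
    have "(\<Sum>i\<le>n. (y i - c)\<^sup>2) = (\<Sum>i\<le>n. (x i)\<^sup>2 * (c / \<mu>)\<^sup>2)"
      by (intro sum.cong) (auto simp: yi power_mult_distrib simp del: times_divide_eq_right)
    also have "\<dots> = (c / \<mu>)\<^sup>2" using x(1) by (simp add: sum_distrib_right[symmetric])
    finally have "sqrt (\<Sum>i\<le>n. (y i - c)\<^sup>2) = c / \<mu>" using c(1) \<mu> by simp
    then have "sphere_proj n y i = x i" for i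
      using yi[of i] x(2)[of i] c(1) \<mu> by (simp add: sphere_proj_def c_def[symmetric])
    then show "x \<in> sphere_proj n ` simplex_boundary (Suc n)" using yB by (metis ext image_eqI)
  qed
qed

section \<open>The simplex as the cone over its boundary\<close>

text \<open>Straight lines from a boundary point at time 0 to the barycentre at time 1; the end of
  the cylinder at 1 is collapsed to a point.\<close>

definition cone_coord :: "nat \<Rightarrow> real \<times> (nat \<Rightarrow> real) \<Rightarrow> nat \<Rightarrow> real" where
  "cone_coord m = (\<lambda>(t, y) i. (1 - t) * y i + t * (if i \<le> m then 1 / (real m + 1) else 0))"

abbreviation cylinder :: "nat \<Rightarrow> (real \<times> (nat \<Rightarrow> real)) topology" where
  "cylinder m \<equiv> prod_topology (top_of_set {0..1}) (boundary_top m)"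

lemma cone_coord_in:
  assumes "t \<in> {0..1}" "y \<in> standard_simplex m"
  shows "cone_coord m (t, y) \<in> standard_simplex m"
proof -
  have "(\<lambda>i. if i \<le> m then 1 / (real m + 1) else 0) \<in> standard_simplex m"
    by (rule standard_simplexI) (auto simp: field_simps)
  then show ?thesis using convex_standard_simplex[OF assms(2)] assms(1) unfolding cone_coord_def by simp
qed

lemma cone_coord_continuous: "continuous_map (cylinder m) (simplex_top m) (cone_coord m)"
proof -
  have f: "continuous_map (cylinder m) euclideanreal fst"
    using continuous_map_into_fulltopology[OF continuous_map_fst[of "top_of_set {0..1::real}" "boundary_top m"]] by simp
  have s: "continuous_map (cylinder m) euclideanreal (\<lambda>x. snd x i)" for i
  proof -
    have "continuous_map (boundary_top m) euclideanreal (\<lambda>y. y i)"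
      by (intro continuous_map_from_subtopology continuous_map_product_projection) auto
    from continuous_map_compose[OF continuous_map_snd this] show ?thesis by (simp add: o_def)
  qed
  have "continuous_map (cylinder m) euclideanreal (\<lambda>x. cone_coord m x i)" for i
    unfolding cone_coord_def case_prod_unfold
    by (intro continuous_map_add continuous_map_real_mult continuous_map_diff f s) auto
  moreover have "cone_coord m x \<in> standard_simplex m" if "x \<in> topspace (cylinder m)" for x
    using that cone_coord_in[of "fst x" "snd x" m] by (auto simp: simplex_boundary_def)
  ultimately show ?thesis
    unfolding continuous_map_in_subtopology continuous_map_componentwise_UNIV by auto
qed

lemma cone_coord_surj:
  assumes "m > 0"
  shows "cone_coord m ` topspace (cylinder m) = standard_simplex m"
proof
  show "cone_coord m ` topspace (cylinder m) \<subseteq> standard_simplex m"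
    using continuous_map_image_subset_topspace[OF cone_coord_continuous[of m]] by simp
  show "standard_simplex m \<subseteq> cone_coord m ` topspace (cylinder m)"
  proof
    fix z assume z: "z \<in> standard_simplex m"
    define c where "c = 1 / (real m + 1)"
    have c: "c > 0" "(real m + 1) * c = 1" by (simp_all add: c_def)
    obtain k where k: "k \<le> m" "\<And>i. i \<le> m \<Longrightarrow> z k \<le> z i"
    proof -
      have "finite (z ` {..m})" "z ` {..m} \<noteq> {}" by auto
      then have "Min (z ` {..m}) \<in> z ` {..m}" "\<And>i. i \<le> m \<Longrightarrow> Min (z ` {..m}) \<le> z i"
        by (auto intro: Min_in Min_le)
      then show ?thesis using that by (metis atMost_iff imageE)
    qed
    have z1: "(\<Sum>i\<le>m. z i) = 1" using standard_simplexD[OF z] by simp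
    have "(\<Sum>i\<le>m. z k) \<le> (\<Sum>i\<le>m. z i)" using k by (intro sum_mono) auto
    then have le: "(real m + 1) * z k \<le> 1" using z1 by (simp add: algebra_simps)
    \<comment> \<open>A boundary point has least coordinate 0, so at time \<open>\<tau>\<close> the
      least coordinate is \<open>\<tau> / (m + 1)\<close>, which determines
      \<open>\<tau>\<close>.\<close>
    define \<tau> where "\<tau> = (real m + 1) * z k"
    have \<tau>: "0 \<le> \<tau>" "\<tau> \<le> 1" using le standard_simplexD(1)[OF z, of k] by (auto simp: \<tau>_def)
    have \<tau>c: "\<tau> * c = z k" by (simp add: \<tau>_def c_def)
    show "z \<in> cone_coord m ` topspace (cylinder m)"
    proof (cases "\<tau> = 1")
      case True
      have "(\<Sum>i\<le>m. z i - c) = 0" using z1 c by (simp add: sum_subtractf algebra_simps)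
      moreover have "0 \<le> z i - c" if "i \<le> m" for i using k(2)[OF that] \<tau>c True by simp
      ultimately have zc: "z i = c" if "i \<le> m" for i
        using that sum_nonneg_eq_0_iff[of "{..m}" "\<lambda>i. z i - c"] by auto
      \<comment> \<open>At the barycentre any boundary point serves; a vertex is one because
        \<open>m > 0\<close>.\<close>
      let ?y = "\<lambda>j. if j = (0::nat) then 1 else (0::real)"
      have "?y \<in> simplex_boundary m" using assms by (auto simp: simplex_boundary_def intro!: exI[of _ m])
      moreover have "cone_coord m (1, ?y) = z"
        using zc standard_simplexD(2)[OF z] by (auto simp: cone_coord_def fun_eq_iff c_def add.commute)
      ultimately show ?thesis by (intro image_eqI[where x="(1, ?y)"]) auto
    next
      case False
      then have lt: "1 - \<tau> > 0" using \<tau> by simp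
      define y where "y i = (if i \<le> m then (z i - z k) / (1 - \<tau>) else 0)" for i
      have "y \<in> standard_simplex m"
      proof (rule standard_simplexI)
        show "0 \<le> y i" if "i \<le> m" for i using k(2)[OF that] lt by (simp add: y_def)
        have "(\<Sum>i\<le>m. y i) = (\<Sum>i\<le>m. z i - z k) / (1 - \<tau>)" by (simp add: y_def sum_divide_distrib)
        also have "(\<Sum>i\<le>m. z i - z k) = 1 - \<tau>" using z1 by (simp add: sum_subtractf \<tau>_def algebra_simps)
        finally show "(\<Sum>i\<le>m. y i) = 1" using lt by simp
      qed (simp add: y_def)
      moreover have "y k = 0" using k by (simp add: y_def)
      ultimately have "y \<in> simplex_boundary m" using k by (auto simp: simplex_boundary_def)
      moreover have "cone_coord m (\<tau>, y) i = z i" for i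
        using lt \<tau>c standard_simplexD(2)[OF z, of i]
        by (auto simp: cone_coord_def y_def c_def add.commute)
      ultimately show ?thesis using \<tau> by (intro image_eqI[where x="(\<tau>, y)"]) auto
    qed
  qed
qed

text \<open>The least coordinate determines the time, and before time 1 the boundary point can be
  solved for. So the fibres are points, except over the barycentre.\<close>

lemma cone_coord_eq:
  assumes y: "y \<in> simplex_boundary m" and z: "z \<in> simplex_boundary m"
    and st: "s \<in> {0..1}" "t \<in> {0..1}" and eq: "cone_coord m (s, y) = cone_coord m (t, z)"
  shows "s = t" "s \<noteq> 1 \<Longrightarrow> y = z"
proof -
  define c where "c = 1 / (real m + 1)"
  have c: "c > 0" by (simp add: c_def)
  obtain i j where ij: "i \<le> m" "y i = 0" "j \<le> m" "z j = 0" using y z by (auto simp: simplex_boundary_def)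
  have ge: "0 \<le> y i" "0 \<le> z i" for i using y z by (auto simp: simplex_boundary_def dest: standard_simplexD)
  have "s * c = (1 - t) * z i + t * c" using fun_cong[OF eq, of i] ij by (simp add: cone_coord_def c_def add.commute)
  then have 1: "t * c \<le> s * c" using ge(2)[of i] st by simp
  have "(1 - s) * y j + s * c = t * c" using fun_cong[OF eq, of j] ij by (simp add: cone_coord_def c_def add.commute)
  moreover have "0 \<le> (1 - s) * y j" using ge(1)[of j] st by simp
  ultimately have "s * c \<le> t * c" by linarith
  with 1 show "s = t" using c by simp
  then show "y = z" if "s \<noteq> 1"
    using eq that by (auto simp: cone_coord_def fun_eq_iff)
qed

text \<open>Transport \<open>f\<close> to the sphere. A homotopy from it to a constant is a map on
  the cylinder that is constant at time 1, so it descends along \<open>cone_coord\<close> to the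
  simplex.\<close>

lemma extend_from_simplex_boundary:
  assumes null: "\<And>f. continuous_map (nsphere n) X f \<Longrightarrow> \<exists>c. homotopic_with (\<lambda>_. True) (nsphere n) X f (\<lambda>_. c)"
    and f: "continuous_map (boundary_top (Suc n)) X f"
  obtains F where "continuous_map (simplex_top (Suc n)) X F" "\<And>x. x \<in> simplex_boundary (Suc n) \<Longrightarrow> F x = f x"
proof -
  let ?B = "boundary_top (Suc n)"
  have cB: "compact_space ?B" using compactin_simplex_boundary by (simp add: compact_space_subtopology)
  have q: "quotient_map ?B (nsphere n) (sphere_proj n)"
    using cB sphere_proj_surj[of n] by (intro compact_quotient sphere_proj_continuous) (auto simp: nsphere Hausdorff_powertop)
  obtain g where g: "continuous_map (nsphere n) X g" "\<And>y. y \<in> simplex_boundary (Suc n) \<Longrightarrow> g (sphere_proj n y) = f y"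
  proof (rule quotient_map_lift_exists[OF q f])
    show "f x = f y" if "x \<in> topspace ?B" "y \<in> topspace ?B" "sphere_proj n x = sphere_proj n y" for x y
      using sphere_proj_inj[of n, THEN inj_onD, of x y] that by auto
  qed auto
  obtain c where "homotopic_with (\<lambda>_. True) (nsphere n) X g (\<lambda>_. c)" using null[OF g(1)] by blast
  then obtain H where H: "continuous_map (prod_topology (top_of_set {0..1::real}) (nsphere n)) X H"
    "\<And>x. H (0, x) = g x" "\<And>x. H (1, x) = c"
    by (auto simp: homotopic_with_def)
  have Q: "quotient_map (cylinder (Suc n)) (simplex_top (Suc n)) (cone_coord (Suc n))"
    using cB cone_coord_surj[of "Suc n"]
    by (intro compact_quotient cone_coord_continuous Hausdorff_powertop)
      (auto simp: compact_space_prod_topology compact_space_subtopology)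
  have "continuous_map (cylinder (Suc n)) (prod_topology (top_of_set {0..1::real}) (nsphere n)) (\<lambda>(t, y). (t, sphere_proj n y))"
    unfolding case_prod_unfold
    using continuous_map_compose[OF continuous_map_snd sphere_proj_continuous]
    by (intro continuous_map_pairedI) (auto simp: o_def continuous_map_fst)
  from continuous_map_compose[OF this H(1)]
  have h: "continuous_map (cylinder (Suc n)) X (\<lambda>(t, y). H (t, sphere_proj n y))" by (simp add: o_def case_prod_unfold)
  obtain F where F: "continuous_map (simplex_top (Suc n)) X F"
    "\<And>x. x \<in> topspace (cylinder (Suc n)) \<Longrightarrow> F (cone_coord (Suc n) x) = (\<lambda>(t, y). H (t, sphere_proj n y)) x"
  proof (rule quotient_map_lift_exists[OF Q h])
    fix x x' assume "x \<in> topspace (cylinder (Suc n))" "x' \<in> topspace (cylinder (Suc n))"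
      "cone_coord (Suc n) x = cone_coord (Suc n) x'"
    then show "(\<lambda>(t, y). H (t, sphere_proj n y)) x = (\<lambda>(t, y). H (t, sphere_proj n y)) x'"
      using cone_coord_eq[of "snd x" "Suc n" "snd x'" "fst x" "fst x'"] H(3)
      by (cases x; cases x'; cases "fst x = 1") auto
  qed auto
  show ?thesis
  proof (rule that[OF F(1)])
    fix x assume x: "x \<in> simplex_boundary (Suc n)"
    have "cone_coord (Suc n) (0, x) = x" by (simp add: cone_coord_def)
    then show "F x = f x" using F(2)[of "(0, x)"] x H(2) g(2)[OF x] by simp
  qed
qed

section \<open>Filling simplices and coherent singular cones\<close>

definition drop_coord :: "nat \<Rightarrow> (nat \<Rightarrow> 'c) \<Rightarrow> nat \<Rightarrow> 'c" where
  "drop_coord k x = (\<lambda>i. if i < k then x i else x (Suc i))"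

lemma drop_coord_simplical_face: "drop_coord k (simplical_face k x) = x"
  by (auto simp: simplical_face_def drop_coord_def fun_eq_iff)

lemma sum_drop_coord:
  fixes x :: "nat \<Rightarrow> real"
  assumes "k \<le> Suc n"
  shows "(\<Sum>i\<le>n. drop_coord k x i) = (\<Sum>i\<le>Suc n. x i) - x k"
proof -
  have "(\<Sum>i\<le>Suc n. x i) = x k + (\<Sum>i\<in>{..Suc n} - {k}. x i)" using assms by (intro sum.remove) auto
  also have "(\<Sum>i\<in>{..Suc n} - {k}. x i) = (\<Sum>i\<le>n. drop_coord k x i)"
    by (rule sum.reindex_bij_witness[where j="\<lambda>i. if i < k then i else i - 1" and i="\<lambda>i. if i < k then i else Suc i"])
      (use assms in \<open>auto simp: drop_coord_def\<close>)
  finally show ?thesis by simp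
qed

lemma drop_coord_in_simplex:
  assumes "x \<in> standard_simplex (Suc n)" "x k = 0" "k \<le> Suc n"
  shows "drop_coord k x \<in> standard_simplex n"
proof (rule standard_simplexI)
  show "(\<Sum>i\<le>n. drop_coord k x i) = 1"
    using standard_simplexD(3)[OF assms(1)] sum_drop_coord[OF assms(3), of x] assms(2) by simp
qed (use standard_simplexD[OF assms(1)] assms(3) in \<open>auto simp: drop_coord_def\<close>)

lemma drop_coord_continuous:
  "continuous_map (powertop_real UNIV) (powertop_real UNIV) (drop_coord k)"
  unfolding continuous_map_componentwise_UNIV drop_coord_def
  by (auto intro: continuous_map_product_projection)

text \<open>The facets are closed and agree on pairwise intersections by the simplicial identities,
  so they paste to a map on the boundary, which is then extended. For \<open>n = 0\<close> the two
  facets are disjoint points, and nothing has to agree.\<close>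

lemma fill_simplex_boundary:
  assumes null: "\<And>f. continuous_map (nsphere n) X f \<Longrightarrow> \<exists>c. homotopic_with (\<lambda>_. True) (nsphere n) X f (\<lambda>_. c)"
    and G: "\<And>k. k \<le> Suc n \<Longrightarrow> singular_simplex n X (G k)"
    and compat: "\<And>k l. k < l \<Longrightarrow> l \<le> Suc n \<Longrightarrow> n \<noteq> 0 \<Longrightarrow> singular_face n (l - 1) (G k) = singular_face n k (G l)"
  shows "\<exists>F. singular_simplex (Suc n) X F \<and> (\<forall>k\<le>Suc n. singular_face (Suc n) k F = G k)"
proof -
  let ?B = "boundary_top (Suc n)"
  let ?T = "\<lambda>k. {x \<in> simplex_boundary (Suc n). x k = 0}"
  have BS: "simplex_boundary (Suc n) \<subseteq> standard_simplex (Suc n)" by (auto simp: simplex_boundary_def)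
  have agree: "G k (drop_coord k x) = G l (drop_coord l x)"
    if kl: "k < l" "l \<le> Suc n" and x: "x \<in> standard_simplex (Suc n)" "x k = 0" "x l = 0" for k l x
  proof -
    have n: "n \<noteq> 0"
    proof
      assume "n = 0"
      then have "k = 0" "l = 1" using kl by auto
      then show False using standard_simplexD(3)[OF x(1)] x \<open>n = 0\<close> by simp
    qed
    let ?y = "drop_coord k (drop_coord l x)"
    have 1: "drop_coord k x = simplical_face (l - 1) ?y"
      using kl x by (auto simp: drop_coord_def simplical_face_def fun_eq_iff)
    have 2: "drop_coord l x = simplical_face k ?y"
      using kl x by (auto simp: drop_coord_def simplical_face_def fun_eq_iff)
    have "drop_coord l x \<in> standard_simplex n" using drop_coord_in_simplex x kl by blast
    then have "drop_coord l x \<in> standard_simplex (Suc (n - 1))" using n by simp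
    then have y: "?y \<in> standard_simplex (n - 1)"
      using kl x n by (intro drop_coord_in_simplex) (auto simp: drop_coord_def)
    have "singular_face n (l - 1) (G k) ?y = singular_face n k (G l) ?y"
      using compat[OF kl n] by simp
    then show ?thesis using y by (simp add: singular_face_def 1 2[symmetric])
  qed
  obtain f where f: "continuous_map ?B X f" "\<And>x k. k \<in> {..Suc n} \<Longrightarrow> x \<in> topspace ?B \<inter> ?T k \<Longrightarrow> f x = G k (drop_coord k x)"
  proof (rule pasting_lemma_exists_closed[where X="?B" and Y=X and T="?T" and I="{..Suc n}" and f="\<lambda>k x. G k (drop_coord k x)"])
    show "topspace ?B \<subseteq> \<Union> (?T ` {..Suc n})" by (auto simp: simplex_boundary_def)
    show "closedin ?B (?T k)" for k
    proof -
      have "continuous_map ?B euclideanreal (\<lambda>x. x k)"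
        by (intro continuous_map_from_subtopology continuous_map_product_projection) auto
      from closedin_continuous_map_preimage[OF this, of "{0}"] show ?thesis by simp
    qed
    show "continuous_map (subtopology ?B (?T k)) X (\<lambda>x. G k (drop_coord k x))" if "k \<in> {..Suc n}" for k
    proof -
      have "continuous_map (subtopology ?B (?T k)) (simplex_top n) (drop_coord k)"
        using drop_coord_in_simplex BS that
        by (auto simp: continuous_map_in_subtopology intro!: continuous_map_from_subtopology drop_coord_continuous)
      from continuous_map_compose[OF this, of X "G k"] G that show ?thesis
        by (simp add: singular_simplex_def o_def)
    qed
    show "G k (drop_coord k x) = G l (drop_coord l x)"
      if "k \<in> {..Suc n}" "l \<in> {..Suc n}" "x \<in> topspace ?B \<inter> ?T k \<inter> ?T l" for k l x
    proof -
      have x: "x \<in> standard_simplex (Suc n)" "x k = 0" "x l = 0" "k \<le> Suc n" "l \<le> Suc n"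
        using that BS by auto
      consider "k < l" | "k = l" | "l < k" by linarith
      then show ?thesis
      proof cases
        case 1
        then show ?thesis by (rule agree[OF _ x(5) x(1,2,3)])
      next
        case 2
        then show ?thesis by (rule arg_cong)
      next
        case 3
        then show ?thesis by (rule agree[OF _ x(4) x(1,3,2), symmetric])
      qed
    qed
  qed auto
  obtain F where F: "continuous_map (simplex_top (Suc n)) X F" "\<And>x. x \<in> simplex_boundary (Suc n) \<Longrightarrow> F x = f x"
    by (rule extend_from_simplex_boundary[OF null f(1)]) auto
  let ?F = "restrict F (standard_simplex (Suc n))"
  have "singular_simplex (Suc n) X ?F"
    using F(1) by (auto simp: singular_simplex_def intro: continuous_map_eq)
  moreover have "singular_face (Suc n) k ?F = G k" if k: "k \<le> Suc n" for k
  proof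
    fix y
    show "singular_face (Suc n) k ?F y = G k y"
    proof (cases "y \<in> standard_simplex n")
      case True
      let ?x = "simplical_face k y"
      have x: "?x \<in> standard_simplex (Suc n)"
        using simplical_face_in_standard_simplex[of "Suc n" k y] True k by simp
      have xk: "?x k = 0" by (simp add: simplical_face_def)
      then have xB: "?x \<in> simplex_boundary (Suc n)" using x k by (auto simp: simplex_boundary_def)
      have "f ?x = G k (drop_coord k ?x)" using f(2)[of k ?x] xB xk k by simp
      then show ?thesis using True x F(2)[OF xB] by (simp add: singular_face_def drop_coord_simplical_face)
    next
      case False
      then show ?thesis using G[OF k] by (auto simp: singular_face_def singular_simplex_def extensional_def)
    qed
  qed
  ultimately show ?thesis by blast
qed

lemma singular_face_singular_face:
  assumes "i \<le> j" "j \<le> Suc p"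
  shows "singular_face (Suc p) i (singular_face (Suc (Suc p)) (Suc j) g) =
         singular_face (Suc p) j (singular_face (Suc (Suc p)) i g)"
proof
  fix t
  show "singular_face (Suc p) i (singular_face (Suc (Suc p)) (Suc j) g) t =
         singular_face (Suc p) j (singular_face (Suc (Suc p)) i g) t"
  proof (cases "t \<in> standard_simplex p")
    case True
    have "simplical_face i t \<in> standard_simplex (Suc p)" "simplical_face j t \<in> standard_simplex (Suc p)"
      using simplical_face_in_standard_simplex[of "Suc p" _ t] True assms by auto
    moreover have "simplical_face (Suc j) (simplical_face i t) = simplical_face i (simplical_face j t)"
      using assms by (auto simp: simplical_face_def fun_eq_iff)
    ultimately show ?thesis by (simp add: singular_face_def)
  qed (simp add: singular_face_def)
qed

text \<open>The boundary to be filled consists of \<open>f\<close> as facet 0 and the cones over the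
  facets of \<open>f\<close>. The cone is chosen as a function of the singular simplex, by recursion
  on dimension, so that the facets of a cone are literally the cones chosen before; in alternating
  sums this is a contracting homotopy.\<close>

theorem singular_cone_exists:
  fixes X :: "'a topology"
  assumes conn: "homotopically_connected X j" and x0: "x0 \<in> topspace X"
  shows "\<exists>h. \<forall>n f. int n \<le> j \<longrightarrow> singular_simplex n X f \<longrightarrow>
     singular_simplex (Suc n) X (h n f) \<and> singular_face (Suc n) 0 (h n f) = f \<and>
     (\<forall>k\<le>n. singular_face (Suc n) (Suc k) (h n f) =
        (if n = 0 then restrict (\<lambda>_. x0) (standard_simplex 0) else h (n - 1) (singular_face n k f)))"
proof -
  let ?pt = "restrict (\<lambda>_. x0) (standard_simplex 0)"
  have pt: "singular_simplex 0 X ?pt"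
    using x0 by (auto simp: singular_simplex_def intro: continuous_map_eq[where f="\<lambda>_. x0"])
  have null: "\<exists>c. homotopic_with (\<lambda>_. True) (nsphere n) X f (\<lambda>_. c)"
    if "int n \<le> j" "continuous_map (nsphere n) X f" for n f
    using conn that unfolding homotopically_connected_def by blast
  \<comment> \<open>The second conjunct is the simplicial identity among the cones over the facets
    of one simplex, exactly what filling needs one dimension higher. It has to be part of the
    invariant of the recursion.\<close>
  define P where "P n h \<longleftrightarrow> (int n \<le> j \<longrightarrow>
      (\<forall>f. singular_simplex n X f \<longrightarrow> singular_simplex (Suc n) X (h f) \<and> singular_face (Suc n) 0 (h f) = f
          \<and> (n = 0 \<longrightarrow> singular_face (Suc n) 1 (h f) = ?pt)) \<and>
      (\<forall>f k l. singular_simplex (Suc n) X f \<longrightarrow> k < l \<longrightarrow> l \<le> Suc n \<longrightarrow>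
          singular_face (Suc n) l (h (singular_face (Suc n) k f)) =
          singular_face (Suc n) (Suc k) (h (singular_face (Suc n) l f))))" for n h
  define Q where "Q n h h' \<longleftrightarrow> (int (Suc n) \<le> j \<longrightarrow>
      (\<forall>f. singular_simplex (Suc n) X f \<longrightarrow>
         (\<forall>k\<le>Suc n. singular_face (Suc (Suc n)) (Suc k) (h' f) = h (singular_face (Suc n) k f))))" for n
    and h h' :: "((nat \<Rightarrow> real) \<Rightarrow> 'a) \<Rightarrow> (nat \<Rightarrow> real) \<Rightarrow> 'a"
  have face: "singular_simplex n X (singular_face (Suc n) k f)" if "singular_simplex (Suc n) X f" "k \<le> Suc n" for n k f
    using singular_simplex_singular_face[OF that(1), of k] that by simp
  have "\<exists>h. P 0 h"
  proof (cases "0 \<le> j")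
    case False
    then show ?thesis by (simp add: P_def)
  next
    case True
    have "\<exists>F. singular_simplex (Suc 0) X F \<and> (\<forall>k\<le>Suc 0. singular_face (Suc 0) k F = (if k = 0 then f else ?pt))"
      if "singular_simplex 0 X f" for f
      using null[of 0] True that pt by (intro fill_simplex_boundary) auto
    then obtain h where h: "\<And>f. singular_simplex 0 X f \<Longrightarrow> singular_simplex (Suc 0) X (h f) \<and>
        (\<forall>k\<le>Suc 0. singular_face (Suc 0) k (h f) = (if k = 0 then f else ?pt))" by metis
    have "P 0 h"
      unfolding P_def
    proof (intro impI conjI allI)
      fix f k l assume f: "singular_simplex (Suc 0) X f" "k < l" "l \<le> Suc 0"
      then have kl: "k = 0" "l = 1" by auto
      show "singular_face (Suc 0) l (h (singular_face (Suc 0) k f)) =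
          singular_face (Suc 0) (Suc k) (h (singular_face (Suc 0) l f))"
        using h[OF face[OF f(1), of 0]] h[OF face[OF f(1), of 1]] kl by simp
    qed (use h in auto)
    then show ?thesis by blast
  qed
  moreover have "\<exists>h'. P (Suc n) h' \<and> Q n h h'" if h: "P n h" for n h
  proof (cases "int (Suc n) \<le> j")
    case False
    then show ?thesis by (simp add: P_def Q_def)
  next
    case True
    have hs: "singular_simplex (Suc n) X (h f)" "singular_face (Suc n) 0 (h f) = f" if "singular_simplex n X f" for f
      using h True that unfolding P_def by auto
    have hc: "singular_face (Suc n) l (h (singular_face (Suc n) k f)) =
          singular_face (Suc n) (Suc k) (h (singular_face (Suc n) l f))"
      if "singular_simplex (Suc n) X f" "k < l" "l \<le> Suc n" for f k l
      using h True that unfolding P_def by auto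
    have "\<exists>F. singular_simplex (Suc (Suc n)) X F \<and>
       (\<forall>k\<le>Suc (Suc n). singular_face (Suc (Suc n)) k F = (if k = 0 then f else h (singular_face (Suc n) (k - 1) f)))"
      if f: "singular_simplex (Suc n) X f" for f
    proof (rule fill_simplex_boundary)
      show "singular_simplex (Suc n) X (if k = 0 then f else h (singular_face (Suc n) (k - 1) f))"
        if "k \<le> Suc (Suc n)" for k
        using f hs face[OF f, of "k - 1"] that by auto
      fix k l :: nat assume kl: "k < l" "l \<le> Suc (Suc n)"
      show "singular_face (Suc n) (l - 1) (if k = 0 then f else h (singular_face (Suc n) (k - 1) f)) =
          singular_face (Suc n) k (if l = 0 then f else h (singular_face (Suc n) (l - 1) f))"
      proof (cases "k = 0")
        case True
        then show ?thesis using kl hs(2)[OF face[OF f, of "l - 1"]] by simp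
      next
        case False
        then show ?thesis using kl hc[OF f, of "k - 1" "l - 1"] by simp
      qed
    qed (use null True in auto)
    then obtain h' where h': "\<And>f. singular_simplex (Suc n) X f \<Longrightarrow> singular_simplex (Suc (Suc n)) X (h' f) \<and>
       (\<forall>k\<le>Suc (Suc n). singular_face (Suc (Suc n)) k (h' f) = (if k = 0 then f else h (singular_face (Suc n) (k - 1) f)))"
      by metis
    have "P (Suc n) h'"
      unfolding P_def
    proof (intro impI conjI allI)
      fix f k l assume f: "singular_simplex (Suc (Suc n)) X f" "k < l" "l \<le> Suc (Suc n)"
      obtain l' where l: "l = Suc l'" using f by (cases l) auto
      have "singular_face (Suc n) k (singular_face (Suc (Suc n)) l f) = singular_face (Suc n) l' (singular_face (Suc (Suc n)) k f)"
        unfolding l using f l by (intro singular_face_singular_face) auto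
      then show "singular_face (Suc (Suc n)) l (h' (singular_face (Suc (Suc n)) k f)) =
          singular_face (Suc (Suc n)) (Suc k) (h' (singular_face (Suc (Suc n)) l f))"
        using h'[OF face[OF f(1), of k]] h'[OF face[OF f(1), of l]] f l by simp
    qed (use h' in auto)
    moreover have "Q n h h'" using h' by (auto simp: Q_def)
    ultimately show ?thesis by blast
  qed
  ultimately obtain H where H: "\<And>n. P n (H n) \<and> Q n (H n) (H (Suc n))"
    using dependent_nat_choice[of P Q] by blast
  show ?thesis
  proof (intro exI[of _ H] allI impI)
    fix n f assume n: "int n \<le> j" "singular_simplex n X f"
    have 1: "singular_simplex (Suc n) X (H n f)" "singular_face (Suc n) 0 (H n f) = f"
      "n = 0 \<Longrightarrow> singular_face (Suc n) 1 (H n f) = ?pt"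
      using H[of n] n unfolding P_def by auto
    show "singular_simplex (Suc n) X (H n f) \<and> singular_face (Suc n) 0 (H n f) = f \<and>
     (\<forall>k\<le>n. singular_face (Suc n) (Suc k) (H n f) =
        (if n = 0 then ?pt else H (n - 1) (singular_face n k f)))"
    proof (cases n)
      case 0
      then show ?thesis using 1 by simp
    next
      case (Suc m)
      then show ?thesis using 1 H[of m] n unfolding Q_def by simp
    qed
  qed
qed

section \<open>Contracting homotopies\<close>

definition drop_nth :: "nat \<Rightarrow> 'c list \<Rightarrow> 'c list" where
  "drop_nth k xs = take k xs @ drop (Suc k) xs"

lemma drop_nth_simps [simp]:
  "drop_nth 0 (x # xs) = xs" "drop_nth (Suc k) (x # xs) = x # drop_nth k xs"
  by (simp_all add: drop_nth_def)

lemma length_drop_nth: "k < length xs \<Longrightarrow> length (drop_nth k xs) = length xs - 1"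
  by (simp add: drop_nth_def)

lemma nth_drop_nth: "k < length xs \<Longrightarrow> i < length xs - 1 \<Longrightarrow> drop_nth k xs ! i = (if i < k then xs ! i else xs ! Suc i)"
  by (auto simp: drop_nth_def nth_append min_def)

lemma set_drop_nth_subset: "set (drop_nth k xs) \<subseteq> set xs"
  by (auto simp: drop_nth_def dest: in_set_takeD in_set_dropD)

lemma distinct_drop_nth: "distinct xs \<Longrightarrow> distinct (drop_nth k xs)"
proof (induction xs arbitrary: k)
  case (Cons x xs)
  then show ?case using set_drop_nth_subset by (cases k) fastforce+
qed (simp add: drop_nth_def)

lemma set_drop_nth: "distinct xs \<Longrightarrow> k < length xs \<Longrightarrow> set (drop_nth k xs) = set xs - {xs ! k}"
proof (induction xs arbitrary: k)
  case (Cons x xs)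
  show ?case
  proof (cases k)
    case 0
    then show ?thesis using Cons.prems by auto
  next
    case (Suc j)
    then have "x \<noteq> xs ! j" using Cons.prems by auto
    then show ?thesis using Cons Suc by auto
  qed
qed simp

section \<open>Oriented simplices of vertex lists\<close>

text \<open>The oriented simplex of an ordered tuple, which is 0 as soon as a vertex repeats;
  degenerate images of singular simplices thus vanish by themselves.\<close>

definition wedge_list :: "('b \<Rightarrow> nat) \<Rightarrow> 'b list \<Rightarrow> 'b set \<Rightarrow> rat" where
  "wedge_list p xs = foldr (wedge p) xs (\<lambda>S. if S = {} then 1 else 0)"

lemma wedge_list_Nil: "wedge_list p [] = (\<lambda>S. if S = {} then 1 else 0)"
  by (simp add: wedge_list_def)

lemma wedge_list_Cons: "wedge_list p (x # xs) = wedge p x (wedge_list p xs)"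
  by (simp add: wedge_list_def)

lemma wedge_list_nonzero: "wedge_list p xs S \<noteq> 0 \<Longrightarrow> S = set xs \<and> distinct xs"
proof (induction xs arbitrary: S)
  case (Cons x xs)
  then have "x \<in> S" "wedge_list p xs (S - {x}) \<noteq> 0" by (auto simp: wedge_list_Cons wedge_def split: if_splits)
  then show ?case using Cons.IH[of "S - {x}"] by auto
qed (auto simp: wedge_list_Nil split: if_splits)

lemma wedge_list_set_chains: "set xs \<in> K \<Longrightarrow> wedge_list p xs \<in> set_chains K (length xs)"
  using wedge_list_nonzero distinct_card by (fastforce simp: set_chains_def)

lemma wedge_list_sorted: "sorted_wrt (\<lambda>a b. p a < p b) xs \<Longrightarrow> wedge_list p xs S = (if S = set xs then 1 else 0)"
proof (induction xs arbitrary: S)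
  case (Cons x xs)
  have x: "x \<notin> set xs" using Cons.prems by auto
  have "{u \<in> set xs. p u < p x} = {}" using Cons.prems by force
  then have s: "sgn_at p x (set xs) = 1" unfolding sgn_at_def by (simp only: card.empty power_0)
  show ?case
  proof (cases "S = insert x (set xs)")
    case True
    then have "S - {x} = set xs" "x \<in> S" using x by auto
    then show ?thesis using Cons s True by (simp add: wedge_list_Cons wedge_def)
  next
    case False
    then have "x \<in> S \<Longrightarrow> S - {x} \<noteq> set xs" by auto
    then show ?thesis using Cons False by (simp add: wedge_list_Cons wedge_def)
  qed
qed (simp add: wedge_list_Nil)

context ordered_ground
begin

lemma bdry_wedge_list:
  assumes "set xs \<subseteq> W"
  shows "bdry p W (wedge_list p xs) = (\<lambda>S. \<Sum>k<length xs. (-1) ^ k * wedge_list p (drop_nth k xs) S)"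
  using assms
proof (induction xs)
  case Nil
  show ?case by (simp add: bdry_def wedge_list_Nil)
next
  case (Cons x xs)
  have "bdry p W (wedge_list p (x # xs)) = (\<lambda>S. wedge_list p xs S - wedge p x (bdry p W (wedge_list p xs)) S)"
    unfolding wedge_list_Cons
  proof (rule bdry_wedge)
    show "S \<subseteq> W" if "wedge_list p xs S \<noteq> 0" for S using wedge_list_nonzero[OF that] Cons.prems by simp
  qed (use Cons.prems in simp)
  also have "wedge p x (bdry p W (wedge_list p xs)) = (\<lambda>S. \<Sum>k<length xs. (-1) ^ k * wedge_list p (x # drop_nth k xs) S)"
    using Cons by (simp add: wedge_sum wedge_mult wedge_list_Cons)
  finally show ?case
    by (simp add: sum.lessThan_Suc_shift fun_eq_iff sum_negf del: sum.lessThan_Suc)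
qed

lemma sorted_list_exists:
  assumes "S \<subseteq> W"
  shows "\<exists>xs. sorted_wrt (\<lambda>a b. p a < p b) xs \<and> set xs = S"
proof -
  have "finite S" using assms fin finite_subset by blast
  then show ?thesis using assms
  proof (induction "card S" arbitrary: S)
    case 0
    then show ?case by (intro exI[of _ "[]"]) auto
  next
    case (Suc n)
    have "S \<noteq> {}" using Suc.hyps(2) by auto
    then have "Min (p ` S) \<in> p ` S" using Suc.prems by (intro Min_in) auto
    then obtain x where x: "x \<in> S" "p x = Min (p ` S)" by (metis imageE)
    have le: "p x \<le> p y" if "y \<in> S" for y using x(2) that Suc.prems by simp
    have "n = card (S - {x})" using Suc.hyps(2) x Suc.prems by simp
    then obtain xs where xs: "sorted_wrt (\<lambda>a b. p a < p b) xs" "set xs = S - {x}"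
      using Suc.hyps(1)[of "S - {x}"] Suc.prems by auto
    have "p x < p y" if "y \<in> S - {x}" for y
      using le[of y] that x inj Suc.prems by (metis Diff_iff inj_onD insertI1 le_neq_implies_less subsetD)
    then have "sorted_wrt (\<lambda>a b. p a < p b) (x # xs)" "set (x # xs) = S" using xs x by auto
    then show ?case by blast
  qed
qed

lemma sorted_wrt_distinct: "sorted_wrt (\<lambda>a b. p a < p b) xs \<Longrightarrow> distinct xs"
  by (induction xs) auto

lemma sorted_wrt_unique:
  assumes "sorted_wrt (\<lambda>a b. p a < p b) xs" "sorted_wrt (\<lambda>a b. p a < p b) ys" "set xs = set ys"
  shows "xs = ys"
  using assms
proof (induction xs arbitrary: ys)
  case (Cons x xs)
  then obtain y ys' where ys: "ys = y # ys'" by (cases ys) auto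
  have "x = y"
  proof (rule ccontr)
    assume "x \<noteq> y"
    then have "x \<in> set ys'" "y \<in> set xs" using Cons.prems(3) ys by auto
    then have "p x < p y" "p y < p x" using Cons.prems(1,2) ys by auto
    then show False by simp
  qed
  moreover have "x \<notin> set xs" "y \<notin> set ys'" using Cons.prems(1,2) ys by auto
  ultimately have "set xs = set ys'" using Cons.prems(3) ys by auto
  then show ?case using Cons ys \<open>x = y\<close> by auto
qed simp

definition slist :: "'b set \<Rightarrow> 'b list" where
  "slist S = (SOME xs. sorted_wrt (\<lambda>a b. p a < p b) xs \<and> set xs = S)"

lemma slist: "S \<subseteq> W \<Longrightarrow> sorted_wrt (\<lambda>a b. p a < p b) (slist S)" "S \<subseteq> W \<Longrightarrow> set (slist S) = S"
  using someI_ex[OF sorted_list_exists] unfolding slist_def by blast+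

lemma length_slist: "S \<subseteq> W \<Longrightarrow> length (slist S) = card S"
  using slist[of S] sorted_wrt_distinct distinct_card by metis

text \<open>In the sorted list, the position of \<open>v\<close> is the number of smaller elements,
  so positional signs equal \<open>sgn_at\<close> signs.\<close>

lemma sum_drop_nth_slist:
  fixes G :: "'b list \<Rightarrow> rat"
  assumes S: "S \<subseteq> W"
  shows "(\<Sum>k<length (slist S). (-1) ^ k * G (drop_nth k (slist S))) =
         (\<Sum>v\<in>S. sgn_at p v (S - {v}) * G (slist (S - {v})))"
proof -
  let ?xs = "slist S"
  have so: "sorted_wrt (\<lambda>a b. p a < p b) ?xs" and st: "set ?xs = S" using slist[OF S] by auto
  have di: "distinct ?xs" using so by (rule sorted_wrt_distinct)
  have bij: "bij_betw ((!) ?xs) {..<length ?xs} S" using bij_betw_nth[OF di] st by auto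
  have lt: "p (?xs ! i) < p (?xs ! j) \<longleftrightarrow> i < j" if "i < length ?xs" "j < length ?xs" for i j
    using sorted_wrt_nth_less[OF so, of i j] sorted_wrt_nth_less[OF so, of j i] that
    by (metis less_asym less_irrefl linorder_neqE_nat)
  have "(-1) ^ k * G (drop_nth k ?xs) = sgn_at p (?xs ! k) (S - {?xs ! k}) * G (slist (S - {?xs ! k}))"
    if k: "k < length ?xs" for k
  proof -
    have "sorted_wrt (\<lambda>a b. p a < p b) (drop_nth k ?xs)"
      unfolding sorted_wrt_iff_nth_less
      using k lt by (auto simp: nth_drop_nth length_drop_nth)
    moreover have s: "set (drop_nth k ?xs) = S - {?xs ! k}" using set_drop_nth[OF di k] st by simp
    ultimately have "drop_nth k ?xs = slist (S - {?xs ! k})"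
      using slist[of "S - {?xs ! k}"] S by (intro sorted_wrt_unique) auto
    moreover have "{u \<in> S - {?xs ! k}. p u < p (?xs ! k)} = (!) ?xs ` {..<k}"
    proof (intro equalityI subsetI)
      fix u assume u: "u \<in> {u \<in> S - {?xs ! k}. p u < p (?xs ! k)}"
      then obtain i where "i < length ?xs" "u = ?xs ! i" using st by (metis (no_types, lifting) DiffD1 in_set_conv_nth mem_Collect_eq)
      then show "u \<in> (!) ?xs ` {..<k}" using u lt[of i k] k by auto
    next
      fix u assume "u \<in> (!) ?xs ` {..<k}"
      then obtain i where i: "i < k" "u = ?xs ! i" by auto
      then have "p u < p (?xs ! k)" using lt[of i k] k by simp
      moreover have "u \<in> S" using i k st nth_mem[of i ?xs] by auto
      ultimately show "u \<in> {u \<in> S - {?xs ! k}. p u < p (?xs ! k)}" by auto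
    qed
    moreover have "inj_on ((!) ?xs) {..<k}" using di k by (auto intro!: inj_on_nth)
    ultimately show ?thesis by (simp add: sgn_at_def card_image)
  qed
  then have "(\<Sum>k<length ?xs. (-1) ^ k * G (drop_nth k ?xs)) =
     (\<Sum>k<length ?xs. sgn_at p (?xs ! k) (S - {?xs ! k}) * G (slist (S - {?xs ! k})))"
    by (intro sum.cong) auto
  also have "\<dots> = (\<Sum>v\<in>S. sgn_at p v (S - {v}) * G (slist (S - {v})))"
    by (rule sum.reindex_bij_betw[OF bij])
  finally show ?thesis .
qed

text \<open>\<open>\<Phi>\<close> is a contracting homotopy given on ordered simplices. Extended
  linearly through sorted lists, it sends a cycle \<open>z\<close> to a chain with boundary
  \<open>z\<close>. Only lists of length at most \<open>t\<close> are involved.\<close>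

lemma exact_at_of_contraction:
  assumes C: "C \<subseteq> Pow W"
    and \<Phi>: "\<And>xs. distinct xs \<Longrightarrow> set xs \<in> C \<Longrightarrow> length xs \<le> t \<Longrightarrow> \<Phi> xs \<in> set_chains C (Suc (length xs))"
    and b: "\<And>xs. distinct xs \<Longrightarrow> set xs \<in> C \<Longrightarrow> length xs \<le> t \<Longrightarrow>
       bdry p W (\<Phi> xs) = (\<lambda>S. wedge_list p xs S - (\<Sum>k<length xs. (-1) ^ k * \<Phi> (drop_nth k xs) S))"
  shows "exact_at p W C t"
  unfolding exact_at_def
proof (intro ballI impI)
  fix z assume z: "z \<in> set_chains C t" "bdry p W z = (\<lambda>_. 0)"
  have finC: "finite C" using C fin by (meson finite_Pow_iff finite_subset)
  let ?D = "{\<sigma> \<in> C. card \<sigma> = t}"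
  have D: "\<sigma> \<subseteq> W" "distinct (slist \<sigma>)" "set (slist \<sigma>) = \<sigma>" "length (slist \<sigma>) = t" if "\<sigma> \<in> ?D" for \<sigma>
    using that C slist[of \<sigma>] sorted_wrt_distinct length_slist[of \<sigma>] by auto
  define w where "w S = (\<Sum>\<sigma>\<in>?D. z \<sigma> * \<Phi> (slist \<sigma>) S)" for S
  have "w \<in> set_chains C (Suc t)"
    unfolding w_def
  proof (intro set_chains_sum set_chains_mult)
    fix \<sigma> assume s: "\<sigma> \<in> ?D"
    then show "\<Phi> (slist \<sigma>) \<in> set_chains C (Suc t)" using \<Phi>[of "slist \<sigma>"] D[OF s] by simp
  qed
  moreover have "bdry p W w S = z S" for S
  proof -
    have "bdry p W w S = (\<Sum>\<sigma>\<in>?D. z \<sigma> * bdry p W (\<Phi> (slist \<sigma>)) S)"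
      unfolding w_def by (simp add: bdry_sum bdry_mult)
    also have "\<dots> = (\<Sum>\<sigma>\<in>?D. z \<sigma> * wedge_list p (slist \<sigma>) S -
        (\<Sum>v\<in>\<sigma>. z \<sigma> * (sgn_at p v (\<sigma> - {v}) * \<Phi> (slist (\<sigma> - {v})) S)))"
    proof (intro sum.cong refl)
      fix \<sigma> assume s: "\<sigma> \<in> ?D"
      have "bdry p W (\<Phi> (slist \<sigma>)) S = wedge_list p (slist \<sigma>) S -
          (\<Sum>v\<in>\<sigma>. sgn_at p v (\<sigma> - {v}) * \<Phi> (slist (\<sigma> - {v})) S)"
        using b[of "slist \<sigma>"] D[OF s] s sum_drop_nth_slist[OF D(1)[OF s], of "\<lambda>xs. \<Phi> xs S"] by simp
      then show "z \<sigma> * bdry p W (\<Phi> (slist \<sigma>)) S = z \<sigma> * wedge_list p (slist \<sigma>) S -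
        (\<Sum>v\<in>\<sigma>. z \<sigma> * (sgn_at p v (\<sigma> - {v}) * \<Phi> (slist (\<sigma> - {v})) S))"
        by (simp add: right_diff_distrib sum_distrib_left)
    qed
    also have "\<dots> = (\<Sum>\<sigma>\<in>?D. z \<sigma> * wedge_list p (slist \<sigma>) S) -
        (\<Sum>\<sigma>\<in>?D. \<Sum>v\<in>\<sigma>. z \<sigma> * (sgn_at p v (\<sigma> - {v}) * \<Phi> (slist (\<sigma> - {v})) S))"
      by (rule sum_subtractf)
    also have "(\<Sum>\<sigma>\<in>?D. z \<sigma> * wedge_list p (slist \<sigma>) S) = (\<Sum>\<sigma>\<in>?D. if S = \<sigma> then z \<sigma> else 0)"
      using wedge_list_sorted[OF slist(1)] slist(2) D(1) by (intro sum.cong) auto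
    also have "\<dots> = z S"
      using finC set_chainsD[OF z(1), of S] by (auto simp: sum.delta)
    \<comment> \<open>Summing over facets \<open>\<tau>\<close> instead of simplices
      \<open>\<sigma>\<close> shows this term to be \<open>\<Phi>\<close> applied to the boundary of
      \<open>z\<close>, which is 0.\<close>
    also have "(\<Sum>\<sigma>\<in>?D. \<Sum>v\<in>\<sigma>. z \<sigma> * (sgn_at p v (\<sigma> - {v}) * \<Phi> (slist (\<sigma> - {v})) S)) =
      (\<Sum>\<sigma>\<in>Pow W. \<Sum>v\<in>\<sigma>. z \<sigma> * (sgn_at p v (\<sigma> - {v}) * \<Phi> (slist (\<sigma> - {v})) S))"
    proof (rule sum.mono_neutral_left)
      show "\<forall>\<sigma>\<in>Pow W - ?D. (\<Sum>v\<in>\<sigma>. z \<sigma> * (sgn_at p v (\<sigma> - {v}) * \<Phi> (slist (\<sigma> - {v})) S)) = 0"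
      proof
        fix \<sigma> assume "\<sigma> \<in> Pow W - ?D"
        then have "z \<sigma> = 0" using set_chainsD[OF z(1), of \<sigma>] by auto
        then show "(\<Sum>v\<in>\<sigma>. z \<sigma> * (sgn_at p v (\<sigma> - {v}) * \<Phi> (slist (\<sigma> - {v})) S)) = 0" by simp
      qed
    qed (use C fin in auto)
    also have "\<dots> = (\<Sum>(\<sigma>, v)\<in>Sigma (Pow W) (\<lambda>\<sigma>. \<sigma>). z \<sigma> * (sgn_at p v (\<sigma> - {v}) * \<Phi> (slist (\<sigma> - {v})) S))"
      by (rule sum.Sigma) (use fin finite_subset in auto)
    also have "\<dots> = (\<Sum>(\<tau>, v)\<in>Sigma (Pow W) (\<lambda>\<tau>. W - \<tau>). z (insert v \<tau>) * (sgn_at p v \<tau> * \<Phi> (slist \<tau>) S))"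
      by (rule sum.reindex_bij_witness[where j="\<lambda>(\<sigma>, v). (\<sigma> - {v}, v)" and i="\<lambda>(\<tau>, v). (insert v \<tau>, v)"])
        (auto simp: insert_absorb)
    also have "\<dots> = (\<Sum>\<tau>\<in>Pow W. \<Sum>v\<in>W - \<tau>. z (insert v \<tau>) * (sgn_at p v \<tau> * \<Phi> (slist \<tau>) S))"
      by (rule sum.Sigma[symmetric]) (use fin in auto)
    also have "\<dots> = (\<Sum>\<tau>\<in>Pow W. bdry p W z \<tau> * \<Phi> (slist \<tau>) S)"
      by (intro sum.cong refl) (simp add: bdry_def sum_distrib_left sum_distrib_right ac_simps)
    also have "\<dots> = 0" using z(2) by simp
    finally show ?thesis by simp
  qed
  ultimately show "\<exists>d\<in>set_chains C (Suc t). bdry p W d = z" by blast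
qed

end

section \<open>Simplicial approximation of singular chains\<close>

definition vertex_point :: "nat \<Rightarrow> nat \<Rightarrow> real" where
  "vertex_point i = (\<lambda>j. if j = i then 1 else 0)"

lemma vertex_point_in: "vertex_point i \<in> standard_simplex n \<longleftrightarrow> i \<le> n"
  unfolding vertex_point_def by simp

lemma simplical_face_vertex_point: "simplical_face k (vertex_point i) = vertex_point (if i < k then i else Suc i)"
  by (auto simp: simplical_face_def vertex_point_def fun_eq_iff)

section \<open>Iterated barycentric subdivision\<close>

lemma singular_chain_iterated_subdivision:
  "singular_chain n X c \<Longrightarrow> singular_chain n X ((singular_subdivision n ^^ m) c)"
  by (induction m) (auto simp: singular_chain_singular_subdivision)

lemma chain_boundary_iterated_subdivision:
  "singular_chain n X c \<Longrightarrow> chain_boundary n ((singular_subdivision n ^^ m) c) =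
     (singular_subdivision (n - 1) ^^ m) (chain_boundary n c)"
proof (induction m)
  case (Suc m)
  then show ?case
    using chain_boundary_singular_subdivision[OF singular_chain_iterated_subdivision[OF Suc.prems, of m]] by simp
qed simp

lemma iterated_subdivision_zero: "singular_chain 0 X c \<Longrightarrow> (singular_subdivision 0 ^^ m) c = c"
  by (induction m) (auto simp: singular_subdivision_zero)

lemma iterated_subdivision_cmul:
  "(singular_subdivision n ^^ m) (frag_cmul a c) = frag_cmul a ((singular_subdivision n ^^ m) c)"
  by (induction m) (auto simp: singular_subdivision_def frag_extend_cmul)

lemma iterated_subdivision_add:
  "(singular_subdivision n ^^ m) (c + d) = (singular_subdivision n ^^ m) c + (singular_subdivision n ^^ m) d"
  by (induction m) (auto simp: singular_subdivision_add)

lemma iterated_subdivision_sum: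
  "(singular_subdivision n ^^ m) (\<Sum>i\<in>I. c i) = (\<Sum>i\<in>I. (singular_subdivision n ^^ m) (c i))"
  by (induction I rule: infinite_finite_induct) (auto simp: iterated_subdivision_add)

locale finite_complex = ordered_ground p W for p :: "'b \<Rightarrow> nat" and W :: "'b set" +
  fixes C :: "'b set set"
  assumes sub: "C \<subseteq> Pow W" and down: "\<sigma> \<in> C \<Longrightarrow> \<tau> \<subseteq> \<sigma> \<Longrightarrow> \<tau> \<in> C"
begin

abbreviation supp :: "('b \<Rightarrow> real) \<Rightarrow> 'b set" where
  "supp x \<equiv> {v. x v \<noteq> 0}"

lemma topspace_realization:
  "topspace (realization C) = {x. (\<forall>v. 0 \<le> x v) \<and> supp x \<in> C \<and> sum x (supp x) = 1}"
  by (simp add: realization_def)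

text \<open>A vertex whose barycentric coordinate is at least the average over the ground set. Points that
  are close together then have their chosen vertices in a common simplex.\<close>
definition pick :: "('b \<Rightarrow> real) \<Rightarrow> 'b" where
  "pick x = (SOME v. v \<in> W \<and> 1 / real (card W) \<le> x v)"

lemma pick:
  assumes x: "x \<in> topspace (realization C)"
  shows "pick x \<in> W" "1 / real (card W) \<le> x (pick x)" "0 < x (pick x)" "pick x \<in> supp x"
proof -
  have s: "supp x \<subseteq> W" "sum x (supp x) = 1" and ge: "\<And>v. 0 \<le> x v"
    using x sub by (auto simp: topspace_realization)
  have one: "sum x W = 1" using s fin by (subst sum.mono_neutral_right[of W "supp x"]) auto
  then have ne: "W \<noteq> {}" by auto
  have "\<exists>v. v \<in> W \<and> 1 / real (card W) \<le> x v"
  proof (rule ccontr)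
    assume n: "\<not> ?thesis"
    have "sum x W < (\<Sum>v\<in>W. 1 / real (card W))"
    proof (rule sum_strict_mono[OF fin ne])
      show "x v < 1 / real (card W)" if "v \<in> W" for v using n that by (meson not_le)
    qed
    also have "\<dots> = 1" using fin ne by simp
    finally show False using one by simp
  qed
  then have *: "pick x \<in> W \<and> 1 / real (card W) \<le> x (pick x)" unfolding pick_def by (rule someI_ex)
  have "0 < 1 / real (card W)" using fin ne by (simp add: card_gt_0_iff)
  also have "\<dots> \<le> x (pick x)" using * by simp
  finally have "0 < x (pick x)" .
  then show "pick x \<in> W" "1 / real (card W) \<le> x (pick x)" "0 < x (pick x)" "pick x \<in> supp x" using * by auto
qed

text \<open>Two points of the neighbourhood differ by less than \<open>1 / card W\<close> in each
  coordinate, whereas a picked coordinate is at least that large. Hence the vertex picked for one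
  point has positive coordinate at the other.\<close>

definition small_nbhd :: "('b \<Rightarrow> real) \<Rightarrow> ('b \<Rightarrow> real) set" where
  "small_nbhd x = {y \<in> topspace (realization C). \<forall>v\<in>W. \<bar>y v - x v\<bar> < 1 / (2 * real (card W))}"

lemma small_nbhd_open: "openin (realization C) (small_nbhd x)"
proof -
  let ?U = "\<lambda>v. {y \<in> topspace (realization C). y v \<in> ball (x v) (1 / (2 * real (card W)))}"
  have o: "openin (realization C) (?U v)" for v
  proof (rule openin_continuous_map_preimage[where Y=euclideanreal])
    show "continuous_map (realization C) euclideanreal (\<lambda>y. y v)"
      unfolding realization_def by (intro continuous_map_from_subtopology continuous_map_product_projection) auto
  qed auto
  have "small_nbhd x = topspace (realization C) \<inter> (\<Inter>v\<in>W. ?U v)"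
    by (auto simp: small_nbhd_def dist_real_def abs_minus_commute)
  moreover have "openin (realization C) (topspace (realization C) \<inter> (\<Inter>v\<in>W. ?U v))"
  proof (cases "W = {}")
    case False
    then show ?thesis using fin o by (intro openin_Int openin_topspace openin_Inter) auto
  qed simp
  ultimately show ?thesis by simp
qed

lemma small_nbhd_pick:
  assumes "y \<in> small_nbhd x" "y' \<in> small_nbhd x"
  shows "pick y \<in> supp y'"
proof -
  have "y \<in> topspace (realization C)" using assms by (simp add: small_nbhd_def)
  note y = pick[OF this]
  have "\<bar>y (pick y) - x (pick y)\<bar> < 1 / (2 * real (card W))" "\<bar>y' (pick y) - x (pick y)\<bar> < 1 / (2 * real (card W))"
    using assms y(1) by (auto simp: small_nbhd_def)
  moreover have "1 / (2 * real (card W)) + 1 / (2 * real (card W)) = 1 / real (card W)" by (simp add: field_simps)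
  ultimately have "y' (pick y) > 0" using y(2) by argo
  then show ?thesis by simp
qed

section \<open>The approximating chain map\<close>

definition vertex_list :: "nat \<Rightarrow> ((nat \<Rightarrow> real) \<Rightarrow> 'b \<Rightarrow> real) \<Rightarrow> 'b list" where
  "vertex_list n f = map (\<lambda>i. pick (f (vertex_point i))) [0..<Suc n]"

text \<open>Each singular simplex goes to the oriented tuple of vertices picked at its corners. This
  is a chain of the full simplex on \<open>W\<close>; only small singular simplices are sure to land
  in \<open>C\<close>.\<close>

definition simplicial_approx :: "nat \<Rightarrow> ('b \<Rightarrow> real) chain \<Rightarrow> 'b set \<Rightarrow> rat" where
  "simplicial_approx n c = (\<lambda>S. \<Sum>f\<in>Poly_Mapping.keys c. of_int (Poly_Mapping.lookup c f) * wedge_list p (vertex_list n f) S)"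

lemma simplicial_approx_superset:
  assumes "finite A" "Poly_Mapping.keys c \<subseteq> A"
  shows "simplicial_approx n c S = (\<Sum>f\<in>A. of_int (Poly_Mapping.lookup c f) * wedge_list p (vertex_list n f) S)"
  unfolding simplicial_approx_def using assms by (intro sum.mono_neutral_left) (auto simp: in_keys_iff)

lemma simplicial_approx_add: "simplicial_approx n (c + d) = (\<lambda>S. simplicial_approx n c S + simplicial_approx n d S)"
proof
  fix S
  let ?A = "Poly_Mapping.keys c \<union> Poly_Mapping.keys d"
  have "finite ?A" "Poly_Mapping.keys (c + d) \<subseteq> ?A" using keys_add[of c d] by auto
  then show "simplicial_approx n (c + d) S = simplicial_approx n c S + simplicial_approx n d S"
    by (simp add: simplicial_approx_superset[of ?A] lookup_add distrib_right sum.distrib)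
qed

lemma simplicial_approx_cmul: "simplicial_approx n (frag_cmul a c) = (\<lambda>S. of_int a * simplicial_approx n c S)"
proof
  fix S
  have "Poly_Mapping.keys (frag_cmul a c) \<subseteq> Poly_Mapping.keys c" by (rule keys_cmul)
  then show "simplicial_approx n (frag_cmul a c) S = of_int a * simplicial_approx n c S"
    by (simp add: simplicial_approx_superset[of "Poly_Mapping.keys c"] sum_distrib_left mult.assoc)
qed

lemma simplicial_approx_0: "simplicial_approx n 0 = (\<lambda>_. 0)"
  by (simp add: simplicial_approx_def)

lemma simplicial_approx_diff: "simplicial_approx n (c - d) = (\<lambda>S. simplicial_approx n c S - simplicial_approx n d S)"
  using simplicial_approx_add[of n c "frag_cmul (-1) d"] unfolding simplicial_approx_cmul by simp

lemma simplicial_approx_sum: "simplicial_approx n (\<Sum>i\<in>I. c i) = (\<lambda>S. \<Sum>i\<in>I. simplicial_approx n (c i) S)"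
  by (induction I rule: infinite_finite_induct) (auto simp: simplicial_approx_0 simplicial_approx_add)

lemma simplicial_approx_of: "simplicial_approx n (frag_of f) = wedge_list p (vertex_list n f)"
  by (simp add: simplicial_approx_def)

lemma vertex_list_singular_face:
  assumes "k \<le> Suc n"
  shows "vertex_list n (singular_face (Suc n) k f) = drop_nth k (vertex_list (Suc n) f)"
proof (rule nth_equalityI)
  have l: "length (vertex_list (Suc n) f) = Suc (Suc n)" by (simp add: vertex_list_def)
  show "length (vertex_list n (singular_face (Suc n) k f)) = length (drop_nth k (vertex_list (Suc n) f))"
    using assms by (simp add: length_drop_nth l) (simp add: vertex_list_def)
  fix i assume "i < length (vertex_list n (singular_face (Suc n) k f))"
  then have i: "i \<le> n" by (simp add: vertex_list_def)
  have "singular_face (Suc n) k f (vertex_point i) = f (vertex_point (if i < k then i else Suc i))"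
    using i by (simp add: singular_face_def vertex_point_in simplical_face_vertex_point)
  moreover have "vertex_list n g ! i = pick (g (vertex_point i))" for g
    using i unfolding vertex_list_def by (subst nth_map) (auto simp del: upt_Suc)
  moreover have "vertex_list (Suc n) f ! m = pick (f (vertex_point m))" if "m \<le> Suc n" for m
    using that unfolding vertex_list_def by (subst nth_map) (auto simp del: upt_Suc)
  ultimately show "vertex_list n (singular_face (Suc n) k f) ! i = drop_nth k (vertex_list (Suc n) f) ! i"
    using assms i by (simp add: nth_drop_nth l)
qed

lemma singular_simplex_vertex:
  assumes "singular_simplex n X f" "i \<le> n"
  shows "f (vertex_point i) \<in> topspace X"
  using assms continuous_map_image_subset_topspace[of "simplex_top n" X f] vertex_point_in[of i n]
  by (auto simp: singular_simplex_def)

lemma set_vertex_list: "set (vertex_list n f) = (\<lambda>i. pick (f (vertex_point i))) ` {..n}"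
  unfolding vertex_list_def by (auto simp del: upt_Suc)

lemma length_vertex_list: "length (vertex_list n f) = Suc n"
  by (simp add: vertex_list_def)

text \<open>Passing to the k-th facet drops the k-th corner. Smallness plays no part here, as the
  boundary is taken over all of \<open>W\<close>.\<close>

lemma bdry_simplicial_approx:
  assumes "singular_chain (Suc n) (realization C) c"
  shows "bdry p W (simplicial_approx (Suc n) c) = simplicial_approx n (chain_boundary (Suc n) c)"
  using assms unfolding singular_chain_def
proof (induction rule: frag_induction)
  case (one f)
  then have f: "singular_simplex (Suc n) (realization C) f" by simp
  have "set (vertex_list (Suc n) f) \<subseteq> W"
    using pick(1)[OF singular_simplex_vertex[OF f]] by (auto simp: set_vertex_list)
  then show ?case
    by (simp add: simplicial_approx_of bdry_wedge_list chain_boundary_of simplicial_approx_sum simplicial_approx_cmul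
        vertex_list_singular_face length_vertex_list lessThan_Suc_atMost del: sum.atMost_Suc)
next
  case (diff a b)
  then show ?case by (simp add: simplicial_approx_diff chain_boundary_diff bdry_diff)
qed (simp add: simplicial_approx_0 bdry_0)

text \<open>The linear parametrization with corners \<open>xs\<close>, in barycentric coordinates.
  The restriction makes it extensional, as \<open>singular_simplex\<close> demands.\<close>

definition affine_simplex :: "nat \<Rightarrow> 'b list \<Rightarrow> (nat \<Rightarrow> real) \<Rightarrow> 'b \<Rightarrow> real" where
  "affine_simplex n xs = restrict (\<lambda>x v. \<Sum>i\<le>n. if xs ! i = v then x i else 0) (standard_simplex n)"

lemma affine_face:
  assumes "length xs = Suc (Suc n)" "k \<le> Suc n"
  shows "singular_face (Suc n) k (affine_simplex (Suc n) xs) = affine_simplex n (drop_nth k xs)"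
proof (intro ext)
  fix y v
  show "singular_face (Suc n) k (affine_simplex (Suc n) xs) y v = affine_simplex n (drop_nth k xs) y v"
  proof (cases "y \<in> standard_simplex n")
    case True
    have y: "simplical_face k y \<in> standard_simplex (Suc n)"
      using simplical_face_in_standard_simplex[of "Suc n" k y] True assms by simp
    let ?g = "\<lambda>i. if xs ! i = v then simplical_face k y i else 0"
    have "(\<Sum>i\<le>Suc n. ?g i) = (\<Sum>i\<le>n. drop_coord k ?g i)"
      using sum_drop_coord[OF assms(2), of ?g] by (simp add: simplical_face_def)
    also have "\<dots> = (\<Sum>i\<le>n. if drop_nth k xs ! i = v then y i else 0)"
      using assms by (intro sum.cong) (auto simp: drop_coord_def simplical_face_def nth_drop_nth)
    finally show ?thesis using True y by (simp add: singular_face_def affine_simplex_def)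
  qed (simp add: singular_face_def affine_simplex_def)
qed

lemma affine_singular:
  assumes "length xs = Suc n" "set xs \<in> C"
  shows "singular_simplex n (subtopology (realization C) {x. supp x \<subseteq> set xs}) (affine_simplex n xs)"
proof -
  let ?A = "\<lambda>x v. \<Sum>i\<le>n. if xs ! i = v then x i else 0 :: real"
  have supp: "supp (?A x) \<subseteq> set xs" for x
  proof
    fix v assume "v \<in> supp (?A x)"
    then obtain i where "i \<le> n" "xs ! i = v" by (auto elim!: sum.not_neutral_contains_not_neutral split: if_splits)
    then show "v \<in> set xs" using assms(1) nth_mem[of i xs] by auto
  qed
  have top: "?A x \<in> topspace (realization C)" if x: "x \<in> standard_simplex n" for x
  proof -
    have "sum (?A x) (supp (?A x)) = sum (?A x) (set xs)"
      using supp by (intro sum.mono_neutral_left) auto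
    also have "\<dots> = (\<Sum>i\<le>n. \<Sum>v\<in>set xs. if xs ! i = v then x i else 0)" by (rule sum.swap)
    also have "\<dots> = (\<Sum>i\<le>n. x i)" using assms(1) by (intro sum.cong) auto
    finally have "sum (?A x) (supp (?A x)) = 1" using standard_simplexD(3)[OF x] by simp
    moreover have "0 \<le> ?A x v" for v using standard_simplexD(1)[OF x] by (intro sum_nonneg) auto
    ultimately show ?thesis using down[OF assms(2) supp] by (auto simp: topspace_realization)
  qed
  have "continuous_map (simplex_top n) euclideanreal (\<lambda>x. if xs ! i = v then x i else 0)" for i v
    by (cases "xs ! i = v") (auto intro: continuous_map_from_subtopology continuous_map_product_projection)
  then have "continuous_map (simplex_top n) (powertop_real UNIV) ?A"
    unfolding continuous_map_componentwise_UNIV by (intro allI continuous_map_sum) auto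
  then have "continuous_map (simplex_top n) (subtopology (realization C) {x. supp x \<subseteq> set xs}) ?A"
    using top supp unfolding realization_def continuous_map_in_subtopology
    by (auto simp: realization_def)
  then show ?thesis
    unfolding singular_simplex_def affine_simplex_def by (auto intro: continuous_map_eq)
qed

lemma affine_singular_realization:
  "length xs = Suc n \<Longrightarrow> set xs \<in> C \<Longrightarrow> singular_simplex n (realization C) (affine_simplex n xs)"
  using affine_singular[of xs n] by (simp add: singular_simplex_subtopology)

text \<open>Picked vertices lie in the support of their point, hence in \<open>set xs\<close>, so
  the approximation can differ from the oriented simplex only in the coefficient of
  \<open>set xs\<close>. By induction on dimension both have the same boundary, and this detects the
  coefficient. In dimension 0 the support is a single vertex.\<close>

lemma simplicial_approx_affine:
  assumes "length xs = Suc n" "distinct xs" "set xs \<in> C"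
  shows "simplicial_approx n ((singular_subdivision n ^^ m) (frag_of (affine_simplex n xs))) = wedge_list p xs"
  using assms
proof (induction n arbitrary: xs)
  case 0
  then obtain v where v: "xs = [v]" by (cases xs) auto
  have ch: "singular_chain 0 (realization C) (frag_of (affine_simplex 0 xs))"
    using affine_singular_realization[OF 0(1,3)] by (simp add: singular_chain_of)
  have top: "affine_simplex 0 xs (vertex_point 0) \<in> topspace (realization C)"
    using singular_simplex_vertex[OF affine_singular_realization[OF 0(1,3)]] by simp
  have "affine_simplex 0 xs (vertex_point 0) = (\<lambda>u. if v = u then 1 else 0)"
    using vertex_point_in[of 0 0] by (auto simp: affine_simplex_def v vertex_point_def fun_eq_iff)
  then have "pick (affine_simplex 0 xs (vertex_point 0)) = v"
    using pick(3)[OF top] by (simp split: if_splits)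
  then show ?case
    unfolding iterated_subdivision_zero[OF ch] simplicial_approx_of vertex_list_def by (simp add: v)
next
  case (Suc n)
  let ?c = "(singular_subdivision (Suc n) ^^ m) (frag_of (affine_simplex (Suc n) xs))"
  let ?D = "\<lambda>S. simplicial_approx (Suc n) ?c S - wedge_list p xs S"
  have xsW: "set xs \<subseteq> W" using Suc.prems sub by auto
  have ch0: "singular_chain (Suc n) (realization C) (frag_of (affine_simplex (Suc n) xs))"
    using affine_singular_realization[OF Suc.prems(1,3)] by (simp add: singular_chain_of)
  \<comment> \<open>Subdivision is carried out inside the face of the realization that
    \<open>xs\<close> spans, so no piece leaves it.\<close>
  have chs: "singular_chain (Suc n) (subtopology (realization C) {x. supp x \<subseteq> set xs}) ?c"
    using affine_singular[OF Suc.prems(1,3)]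
    by (intro singular_chain_iterated_subdivision) (simp add: singular_chain_of)
  have supp: "S = set xs" if "?D S \<noteq> 0" for S
  proof (rule ccontr)
    assume S: "S \<noteq> set xs"
    then have "wedge_list p xs S = 0" using wedge_list_nonzero[of p xs S] by auto
    then have "simplicial_approx (Suc n) ?c S \<noteq> 0" using that by simp
    then obtain f where f: "f \<in> Poly_Mapping.keys ?c" "wedge_list p (vertex_list (Suc n) f) S \<noteq> 0"
      unfolding simplicial_approx_def by (auto elim!: sum.not_neutral_contains_not_neutral)
    have fs: "singular_simplex (Suc n) (subtopology (realization C) {x. supp x \<subseteq> set xs}) f"
      using chs f(1) by (auto simp: singular_chain_def)
    have "pick (f (vertex_point i)) \<in> set xs" if "i \<le> Suc n" for i
      using singular_simplex_vertex[OF fs that] pick(4)[of "f (vertex_point i)"] by auto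
    then have "set (vertex_list (Suc n) f) \<subseteq> set xs" by (auto simp: set_vertex_list)
    moreover have vl: "S = set (vertex_list (Suc n) f)" "distinct (vertex_list (Suc n) f)"
      using wedge_list_nonzero[OF f(2)] by auto
    moreover have "card S = card (set xs)"
      using distinct_card[OF vl(2)] distinct_card[OF Suc.prems(2)] vl(1) Suc.prems(1)
      by (simp add: vertex_list_def)
    ultimately show False using S by (simp add: card_subset_eq)
  qed
  have face: "simplicial_approx n ((singular_subdivision n ^^ m) (frag_of (affine_simplex n (drop_nth k xs)))) = wedge_list p (drop_nth k xs)"
    if "k \<le> Suc n" for k
    using that Suc.prems down[OF Suc.prems(3) set_drop_nth_subset]
    by (intro Suc.IH) (auto simp: length_drop_nth distinct_drop_nth)
  have "bdry p W (simplicial_approx (Suc n) ?c) =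
      simplicial_approx n ((singular_subdivision n ^^ m) (chain_boundary (Suc n) (frag_of (affine_simplex (Suc n) xs))))"
    using bdry_simplicial_approx[OF singular_chain_iterated_subdivision[OF ch0]]
      chain_boundary_iterated_subdivision[OF ch0] by simp
  also have "\<dots> = (\<lambda>S. \<Sum>k\<le>Suc n. (-1) ^ k * wedge_list p (drop_nth k xs) S)"
    using face Suc.prems
    by (simp add: chain_boundary_of affine_face iterated_subdivision_sum iterated_subdivision_cmul
        simplicial_approx_sum simplicial_approx_cmul fun_eq_iff del: sum.atMost_Suc)
  also have "\<dots> = bdry p W (wedge_list p xs)"
    by (simp add: bdry_wedge_list[OF xsW] Suc.prems lessThan_Suc_atMost del: sum.atMost_Suc)
  finally have bD: "bdry p W ?D = (\<lambda>_. 0)" by (simp add: bdry_diff)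
  \<comment> \<open>The facet opposite to \<open>a\<close> has \<open>set xs\<close> as the only
    coface in the support of the difference, so its boundary coefficient is that of
    \<open>set xs\<close> up to sign.\<close>
  obtain a where a: "a \<in> set xs" using Suc.prems by (cases xs) auto
  have "bdry p W ?D (set xs - {a}) = (\<Sum>v\<in>{a}. sgn_at p v (set xs - {a}) * ?D (insert v (set xs - {a})))"
    unfolding bdry_def
  proof (rule sum.mono_neutral_right)
    show "\<forall>v\<in>W - (set xs - {a}) - {a}. sgn_at p v (set xs - {a}) * ?D (insert v (set xs - {a})) = 0"
    proof
      fix v assume "v \<in> W - (set xs - {a}) - {a}"
      then have "insert v (set xs - {a}) \<noteq> set xs" using a by auto
      then show "sgn_at p v (set xs - {a}) * ?D (insert v (set xs - {a})) = 0" using supp by auto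
    qed
  qed (use a xsW fin in auto)
  then have "?D (set xs) = 0" using bD a by (simp add: insert_absorb sgn_at_nonzero)
  then have "?D S = 0" for S using supp by blast
  then show ?case by (simp add: fun_eq_iff)
qed

text \<open>All corners of a piece lie in one small neighbourhood, so every picked vertex belongs to
  the support of corner 0, which is a simplex of \<open>C\<close>.\<close>

lemma simplicial_approx_small:
  assumes "singular_chain n (realization C) c"
    and "\<And>f. f \<in> Poly_Mapping.keys c \<Longrightarrow> \<exists>V\<in>range small_nbhd. f \<in> standard_simplex n \<rightarrow> V"
  shows "simplicial_approx n c \<in> set_chains C (Suc n)"
  unfolding simplicial_approx_def
proof (intro set_chains_sum set_chains_mult)
  fix f assume f: "f \<in> Poly_Mapping.keys c"
  then obtain x where x: "\<And>y. y \<in> standard_simplex n \<Longrightarrow> f y \<in> small_nbhd x" using assms(2) by blast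
  have v: "f (vertex_point i) \<in> small_nbhd x" if "i \<le> n" for i using x vertex_point_in that by blast
  have "set (vertex_list n f) \<subseteq> supp (f (vertex_point 0))"
    using small_nbhd_pick[OF v v[of 0]] by (auto simp: set_vertex_list)
  moreover have "supp (f (vertex_point 0)) \<in> C"
    using v[of 0] by (simp add: small_nbhd_def topspace_realization)
  ultimately have "set (vertex_list n f) \<in> C" using down by blast
  then have "wedge_list p (vertex_list n f) \<in> set_chains C (length (vertex_list n f))" by (rule wedge_list_set_chains)
  then show "wedge_list p (vertex_list n f) \<in> set_chains C (Suc n)" by (simp add: vertex_list_def)
qed

text \<open>The homotopy cones the affine simplex of a list, subdivides and approximates. Facet 0 of
  the cone gives back the list by \<open>simplicial_approx_affine\<close>; the other facets give the
  homotopy on shorter lists.\<close>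

theorem exact_at_of_homotopically_connected:
  assumes conn: "homotopically_connected (realization C) (int t - 1)"
  shows "exact_at p W C t"
proof -
  let ?X = "realization C"
  have "topspace ?X \<noteq> {}" using conn unfolding homotopically_connected_def by (rule conjunct1)
  then obtain x0 where x0: "x0 \<in> topspace ?X" by blast
  let ?pt = "restrict (\<lambda>_. x0) (standard_simplex 0)"
  obtain h where h: "\<And>n f. int n \<le> int t - 1 \<Longrightarrow> singular_simplex n ?X f \<Longrightarrow>
     singular_simplex (Suc n) ?X (h n f) \<and> singular_face (Suc n) 0 (h n f) = f \<and>
     (\<forall>k\<le>n. singular_face (Suc n) (Suc k) (h n f) = (if n = 0 then ?pt else h (n - 1) (singular_face n k f)))"
    using singular_cone_exists[OF conn x0] by metis
  define L where "L = {xs. set xs \<subseteq> W \<and> distinct xs \<and> set xs \<in> C \<and> 0 < length xs \<and> length xs \<le> t}"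
  have finL: "finite L"
    by (rule finite_subset[OF _ finite_lists_length_le[OF fin, of t]]) (auto simp: L_def)
  define H where "H xs = h (length xs - 1) (affine_simplex (length xs - 1) xs)" for xs
  have Hs: "singular_simplex (length xs) ?X (H xs)" if xs: "xs \<in> L" for xs
  proof -
    obtain n where n: "length xs = Suc n" using xs by (cases xs) (auto simp: L_def)
    then have "singular_simplex n ?X (affine_simplex n xs)" "int n \<le> int t - 1"
      using xs by (auto simp: L_def intro: affine_singular_realization)
    then show ?thesis using h[of n "affine_simplex n xs"] by (simp add: H_def n)
  qed
  have "\<exists>N. \<forall>m f. N \<le> m \<longrightarrow> f \<in> Poly_Mapping.keys ((singular_subdivision (length xs) ^^ m) (frag_of (H xs))) \<longrightarrow>
      (\<exists>V\<in>range small_nbhd. f \<in> standard_simplex (length xs) \<rightarrow> V)" if "xs \<in> L" for xs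
  proof -
    have cov: "topspace ?X \<subseteq> \<Union> (range small_nbhd)"
    proof
      fix x assume x: "x \<in> topspace ?X"
      have "0 < card W" using pick(1)[OF x] fin by (auto simp: card_gt_0_iff)
      then have "x \<in> small_nbhd x" using x by (simp add: small_nbhd_def)
      then show "x \<in> \<Union> (range small_nbhd)" by blast
    qed
    have op: "openin ?X U" if "U \<in> range small_nbhd" for U using that small_nbhd_open by blast
    have chn: "singular_chain (length xs) ?X (frag_of (H xs))" using Hs[OF that] by (simp add: singular_chain_of)
    obtain N where "\<And>m f. N \<le> m \<Longrightarrow> f \<in> Poly_Mapping.keys ((singular_subdivision (length xs) ^^ m) (frag_of (H xs))) \<Longrightarrow>
      \<exists>V\<in>range small_nbhd. f \<in> standard_simplex (length xs) \<rightarrow> V"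
      by (rule sufficient_iterated_singular_subdivision_exists[OF op cov chn]) auto
    then show ?thesis by blast
  qed
  then obtain N where N: "\<And>xs m f. xs \<in> L \<Longrightarrow> N xs \<le> m \<Longrightarrow>
      f \<in> Poly_Mapping.keys ((singular_subdivision (length xs) ^^ m) (frag_of (H xs))) \<Longrightarrow>
      \<exists>V\<in>range small_nbhd. f \<in> standard_simplex (length xs) \<rightarrow> V" by metis
  \<comment> \<open>One number of subdivisions for all lists: the boundary formula relates lists of
    different lengths, which therefore have to be subdivided equally often.\<close>
  define m where "m = Max (insert 0 (N ` L))"
  have m: "N xs \<le> m" if "xs \<in> L" for xs unfolding m_def using finL that by (intro Max_ge) auto
  \<comment> \<open>The empty list goes to the vertex picked at the apex \<open>x0\<close>, which
    settles the augmentation degree.\<close>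
  define \<Phi> where "\<Phi> xs = (if xs = [] then wedge_list p [pick x0] else
     simplicial_approx (length xs) ((singular_subdivision (length xs) ^^ m) (frag_of (H xs))))" for xs
  have inL: "xs \<in> L" if "distinct xs" "set xs \<in> C" "length xs \<le> t" "xs \<noteq> []" for xs
    using that sub by (auto simp: L_def)
  have ch: "singular_chain (length xs) ?X (frag_of (H xs))" if "xs \<in> L" for xs
    using Hs[OF that] by (simp add: singular_chain_of)
  show ?thesis
  proof (rule exact_at_of_contraction[OF sub, of t \<Phi>])
    fix xs assume xs: "distinct xs" "set xs \<in> C" "length xs \<le> t"
    show "\<Phi> xs \<in> set_chains C (Suc (length xs))"
    proof (cases "xs = []")
      case True
      have "{pick x0} \<in> C" using pick(4)[OF x0] down[of "supp x0" "{pick x0}"] x0 by (auto simp: topspace_realization)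
      then have "wedge_list p [pick x0] \<in> set_chains C (length [pick x0])" by (intro wedge_list_set_chains) simp
      then show ?thesis using True by (simp add: \<Phi>_def)
    next
      case False
      have "simplicial_approx (length xs) ((singular_subdivision (length xs) ^^ m) (frag_of (H xs)))
          \<in> set_chains C (Suc (length xs))"
        using N[OF inL[OF xs False] m[OF inL[OF xs False]]]
        by (intro simplicial_approx_small singular_chain_iterated_subdivision ch inL xs False)
      then show ?thesis using False by (simp add: \<Phi>_def)
    qed
    show "bdry p W (\<Phi> xs) = (\<lambda>S. wedge_list p xs S - (\<Sum>k<length xs. (-1) ^ k * \<Phi> (drop_nth k xs) S))"
    proof (cases xs)
      case Nil
      then show ?thesis using pick(1)[OF x0] by (simp add: \<Phi>_def bdry_wedge_list)
    next
      case (Cons y ys)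
      define n where "n = length ys"
      have len: "length xs = Suc n" using Cons by (simp add: n_def)
      have L: "xs \<in> L" using inL xs Cons by simp
      have aff: "singular_simplex n ?X (affine_simplex n xs)" using affine_singular_realization[OF len xs(2)] .
      have H: "singular_simplex (Suc n) ?X (H xs)" "singular_face (Suc n) 0 (H xs) = affine_simplex n xs"
        "\<And>k. k \<le> n \<Longrightarrow> singular_face (Suc n) (Suc k) (H xs) =
            (if n = 0 then ?pt else h (n - 1) (singular_face n k (affine_simplex n xs)))"
        using h[of n "affine_simplex n xs"] aff xs(3) len by (auto simp: H_def)
      let ?S = "\<lambda>n. singular_subdivision n ^^ m"
      have fc: "simplicial_approx n (?S n (frag_of (singular_face (Suc n) (Suc k) (H xs)))) = \<Phi> (drop_nth k xs)"
        if k: "k \<le> n" for k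
      proof (cases n)
        \<comment> \<open>The cone over a vertex is a path whose other end is \<open>x0\<close>.
          Subdivision does not change a 0-simplex, so the approximation there is the value of
          \<open>\<Phi>\<close> on the empty list.\<close>
        case 0
        have "singular_chain 0 ?X (frag_of ?pt)"
          using singular_simplex_singular_face[OF H(1), of "Suc 0"] H(3)[of 0] 0 by (simp add: singular_chain_of)
        then have "?S 0 (frag_of ?pt) = frag_of ?pt" by (rule iterated_subdivision_zero)
        moreover have "vertex_list 0 ?pt = [pick x0]"
          using vertex_point_in[of 0 0] by (simp add: vertex_list_def)
        moreover have "drop_nth k xs = []" using len 0 k by (simp add: drop_nth_def)
        ultimately show ?thesis using 0 k H(3)[OF k] by (simp add: \<Phi>_def simplicial_approx_of)
      next
        case (Suc n')
        have l: "length (drop_nth k xs) = n" using length_drop_nth[of k xs] len k by simp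
        have "singular_face n k (affine_simplex n xs) = affine_simplex n' (drop_nth k xs)"
          using affine_face[of xs n' k] len k Suc by simp
        then have "singular_face (Suc n) (Suc k) (H xs) = H (drop_nth k xs)"
          using H(3)[OF k] Suc l by (simp add: H_def)
        moreover have "drop_nth k xs \<noteq> []" using l Suc by auto
        ultimately show ?thesis using l by (simp add: \<Phi>_def)
      qed
      have "bdry p W (\<Phi> xs) = simplicial_approx n (?S n (chain_boundary (Suc n) (frag_of (H xs))))"
        using bdry_simplicial_approx[OF singular_chain_iterated_subdivision[OF ch[OF L, unfolded len]], of m]
          chain_boundary_iterated_subdivision[OF ch[OF L, unfolded len], of m] Cons len
        by (simp add: \<Phi>_def)
      also have "\<dots> = (\<lambda>S. \<Sum>k\<le>Suc n. (-1) ^ k * simplicial_approx n (?S n (frag_of (singular_face (Suc n) k (H xs)))) S)"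
        by (simp add: chain_boundary_of iterated_subdivision_sum iterated_subdivision_cmul
            simplicial_approx_sum simplicial_approx_cmul fun_eq_iff del: sum.atMost_Suc)
      also have "\<dots> = (\<lambda>S. wedge_list p xs S - (\<Sum>k\<le>n. (-1) ^ k * \<Phi> (drop_nth k xs) S))"
        unfolding sum.atMost_Suc_shift using simplicial_approx_affine[OF len xs(1,2), of m]
        by (simp add: H(2) fc sum_negf)
      finally show ?thesis by (simp add: len lessThan_Suc_atMost)
    qed
  qed
qed

end

section \<open>Conclusion for both connectivity parameters\<close>

lemma exact_at_of_eta_pi:
  assumes "ordered_ground q V" "D \<subseteq> Pow V" "\<And>\<sigma> \<tau>. \<sigma> \<in> D \<Longrightarrow> \<tau> \<subseteq> \<sigma> \<Longrightarrow> \<tau> \<in> D" "enat (Suc t) \<le> eta_pi D"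
  shows "exact_at q V D t"
proof -
  interpret finite_complex q V D using assms by (simp add: finite_complex_def finite_complex_axioms_def)
  show ?thesis
    using eta_of_ge[OF assms(4)[unfolded eta_pi_def]] by (rule exact_at_of_homotopically_connected)
qed

lemma eta_pi_nonempty:
  assumes "enat 1 \<le> eta_pi D"
  shows "D \<noteq> {}"
proof -
  have "homotopically_connected (realization D) (int 0 - 1)"
    by (rule eta_of_ge[of 0 "homotopically_connected (realization D)"]) (use assms in \<open>simp add: eta_pi_def\<close>)
  then have "topspace (realization D) \<noteq> {}" unfolding homotopically_connected_def by (rule conjunct1)
  then show ?thesis by (auto simp: realization_def)
qed

theorem theorem5p2:
  fixes V :: "'a set" and C M :: "'a set set" and k :: nat and eta :: "'a set set \<Rightarrow> enat"
  assumes "finite V"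
    and "abstract_simplicial_complex V C"
    and "matroid V M"
    and "1 \<le> k" and "k \<le> mrank M"
    and "eta = eta_pi \<or> eta = eta_H"
    and "\<forall>X. X \<subseteq> V \<and> flat V M (V - X) \<and> mrank (restr M (V - X)) \<le> k - 1 \<longrightarrow>
           eta (induced C X) + enat (mrank (restr M (V - X))) \<ge> enat (k + 1)"
  shows "RG_connected C M k"
proof -
  obtain q :: "'a \<Rightarrow> nat" where "inj_on q V" using finite_imp_inj_to_nat_seg[OF assms(1)] by blast
  then have q: "ordered_ground q V" using assms(1) by (simp add: ordered_ground_def)
  show ?thesis
  proof (rule RG_connected_if_eta[OF q assms(2-5,7)])
    fix X t assume e: "enat (Suc t) \<le> eta (induced C X)"
    have "induced C X \<subseteq> Pow V" "\<And>\<sigma> \<tau>. \<sigma> \<in> induced C X \<Longrightarrow> \<tau> \<subseteq> \<sigma> \<Longrightarrow> \<tau> \<in> induced C X"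
      using assms(2) unfolding abstract_simplicial_complex_def induced_def by blast+
    then show "exact_at q V (induced C X) t"
      using assms(6) e exact_at_of_eta_pi[OF q] exact_at_of_eta_H[OF q] by blast
  next
    fix X assume "enat 1 \<le> eta (induced C X)"
    then show "induced C X \<noteq> {}" using assms(6) eta_pi_nonempty eta_H_nonempty by blast
  qed
qed

end
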